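(* The basis $\mathbf B_1$ of $W^{(N)}(b)$ simultaneously diagonalizes all the type B Murphy elements $J_n^{(\mathrm B)}$, $n=0,1,\dots,N-1$, and on the basis vector of a path $(0,h_1,h_2,\dots,h_N)$ (with $h_0=0$) the eigenvalue of $J_n^{(\mathrm B)}$ is $$q^{\omega_1(h_{n+1}-h_n)-\frac12(h_{n+1}^2-h_n^2)+\frac12(1-2n)}.$$
   Context: Let $N\ge2$. Fix complex numbers $\eta,\omega_1,\omega_2,\theta$; write $q^x=e^{\eta x}$ and $[x]=\frac{q^x-q^{-x}}{q-q^{-1}}$. Assume genericity: $q$ is not a root of unity, $[\omega_1-m]\neq0$ for all $m\in\mathbb Z$, and $[\omega_2],[\omega_2+1]\ne0$. Put $\delta=[2]$, $s_1=\frac{[\omega_1]}{[\omega_1+1]}$, $s_2=\frac{[\omega_2]}{[\omega_2+1]}$. The 2BTL algebra is the unital complex algebra with generators $e_0,\dots,e_N$ and relations $e_i^2=\delta e_i$, $e_ie_{i\pm1}e_i=e_i$ for $1\le i\le N-1$ (with $i\pm1\in\{0,\dots,N\}$), $e_0^2=s_1e_0$, $e_N^2=s_2e_N$, $e_ie_j=e_je_i$ for $|i-j|>1$. For $N$ even set $I_1=e_1e_3\cdots e_{N-1}$, $I_2=e_0e_2\cdots e_N$ and $b=\frac{[(\omega_1+\omega_2+1+\theta)/2][(\omega_1+\omega_2+1-\theta)/2]}{[\omega_1+1][\omega_2+1]}$; for $N$ odd set $I_1=e_1e_3\cdots e_N$, $I_2=e_0e_2\cdots e_{N-1}$ and $b=-\frac{[(\omega_1-\omega_2+\theta)/2][(\omega_1-\omega_2-\theta)/2]}{[\omega_1+1][\omega_2+1]}$.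 The double quotient $\mathcal A_b$ is the quotient of 2BTL by $I_1I_2I_1=bI_1$, $I_2I_1I_2=bI_2$. Define $E_0=1$ and $E_i=s_1^{(-1)^i}E_{i-1}e_{i-1}E_{i-1}$ for $1\le i\le N$ (idempotents). The $2^N$-dimensional module $W^{(N)}(b)$ is realised as the left ideal $\mathcal A_bE_N$. Put $r(u)=\frac{[u+1]}{[u]}$, $k(u)=-\frac{[(u-\omega_2+\theta)/2][(u-\omega_2-\theta)/2]}{[u][\omega_2+1]}$, $R_i(u)=e_i-r(u)$, $K_N(u)=e_N-k(u)$. A path is $p=(h_0,\dots,h_N)$ with $h_0=0$, $h_{i+1}-h_i=\pm1$. The fundamental path is $p_0=(0,-1,0,-1,0,\dots)$. A path $p'$ is obtained from $p$ by adding a tile at point $i$ ($1\le i\le N-1$) if they agree except at $i$, $h_{i-1}=h_{i+1}$, and: either $h_{i-1}\ge0$, $h_i=h_{i-1}-1$, $h_i'=h_{i-1}+1$ (tile added from above), or $h_{i-1}<0$, $h_i=h_{i-1}+1$, $h'_i=h_{i-1}-1$ (tile added from below). It is obtained by adding a right boundary half-tile if they agree except at $N$ and the same conditions hold with $i=N$ (omitting the condition on $h_{i+1}$). Every path is obtained from $p_0$ by successive additions. The basis $\mathbf B_1=\{b_p\}$ of $W^{(N)}(b)$ is defined by $b_{p_0}=E_N$ and $b_{p'}=X_ib_p$ when $p'$ is obtained from $p$ by adding a tile or half-tile at $i$, where: from above, $X_i=R_i(\omega_1-h_{i-1})$ for $i<N$, and $X_N=K_N(\omega_1-h_{N-1})$;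 from below, $X_i=R_i(-\omega_1+h_{i-1})$ for $i<N$, and $X_N=K_N(-\omega_1+h_{N-1})$. (This is independent of the order of additions.) Type B Murphy elements: with $g_0=q^{\omega_1}-(q^{1+\omega_1}-q^{-1-\omega_1})e_0$ and $g_i=e_i-q^{-1}$ ($1\le i\le N-1$), put $J_0^{(\mathrm B)}=g_0$ and $J_i^{(\mathrm B)}=g_iJ_{i-1}^{(\mathrm B)}g_i$ for $1\le i\le N-1$. *)

theory Defs
  imports Complex_Main "HOL-Library.Poly_Mapping" "HOL-Algebra.Module" "HOL-Algebra.QuotRing"
begin

section \<open>Finitely presented complex algebras\<close>

text \<open>Words are wrapped in a type of their own so that concatenation can serve as the
  (noncommutative) \<open>+\<close> of a \<open>monoid_add\<close>; the convolution product of \<open>Poly_Mapping\<close> then makes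
  \<open>word \<Rightarrow>\<^sub>0 complex\<close> the free unital algebra on generators indexed by \<open>nat\<close>.\<close>

datatype word = Word (letters: "nat list")

instantiation word :: monoid_add
begin
definition zero_word :: word where "zero_word = Word []"
definition plus_word :: "word \<Rightarrow> word \<Rightarrow> word" where "plus_word v w = Word (letters v @ letters w)"
instance by standard (auto simp: zero_word_def plus_word_def)
end

type_synonym fpoly = "word \<Rightarrow>\<^sub>0 complex"

definition const :: "complex \<Rightarrow> fpoly" where "const c = Poly_Mapping.single 0 c"

definition gen :: "nat \<Rightarrow> fpoly" where "gen i = Poly_Mapping.single (Word [i]) 1"

text \<open>The free algebra on exactly the generators \<open>0, \<dots>, N\<close>.\<close>

definition free_alg :: "nat \<Rightarrow> fpoly ring" where
  "free_alg N = \<lparr>carrier = {x. \<forall>w \<in> Poly_Mapping.keys x. set (letters w) \<subseteq> {..N}},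
     monoid.mult = (*), one = 1, ring.zero = 0, add = (+)\<rparr>"

lemma ring_free_alg: "ring (free_alg N)"
proof -
  define C where "C = {x :: fpoly. \<forall>w \<in> Poly_Mapping.keys x. set (letters w) \<subseteq> {..N}}"
  have plus: "x + y \<in> C" if "x \<in> C" "y \<in> C" for x y
    using that Poly_Mapping.keys_add[of x y] unfolding C_def by blast
  have mult: "x * y \<in> C" if xy: "x \<in> C" "y \<in> C" for x y
  proof -
    have "set (letters w) \<subseteq> {..N}" if w: "w \<in> Poly_Mapping.keys (x * y)" for w
    proof -
      obtain u v where "w = u + v" "u \<in> Poly_Mapping.keys x" "v \<in> Poly_Mapping.keys y"
        using w keys_mult[of x y] by blast
      with xy show ?thesis
        by (simp add: plus_word_def C_def)
    qed
    then show ?thesis unfolding C_def by blast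
  qed
  have uminus: "- x \<in> C" if "x \<in> C" for x
    using that by (simp add: C_def)
  have one: "1 \<in> C"
    by (simp add: C_def zero_word_def flip: single_one)
  have zero: "0 \<in> C"
    by (simp add: C_def)
  have F: "free_alg N = \<lparr>carrier = C, monoid.mult = (*), one = 1, ring.zero = 0, add = (+)\<rparr>"
    by (simp add: free_alg_def C_def)
  have inv: "\<exists>y\<in>C. x + y = 0" if "x \<in> C" for x
    using uminus[OF that] by (intro bexI[of _ "- x"]) simp_all
  have "abelian_group (free_alg N)"
    unfolding F by (rule abelian_groupI) (simp_all add: plus zero inv add.assoc add.commute)
  moreover have "Group.monoid (free_alg N)"
    unfolding F by (rule monoidI) (simp_all add: mult one mult.assoc)
  ultimately show ?thesis
    by (rule ringI) (simp_all add: F distrib_left distrib_right)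
qed

text \<open>The algebra with generators \<open>0, \<dots>, N\<close> and defining relations \<open>x = 0\<close> for \<open>x \<in> S\<close>; scalars act
  through the image of \<open>const\<close>.\<close>

definition presented_alg :: "nat \<Rightarrow> fpoly set \<Rightarrow> (complex, fpoly set) module" where
  "presented_alg N S =
    (let I = Idl\<^bsub>free_alg N\<^esub> S; Q = free_alg N Quot I
     in \<lparr>carrier = carrier Q, monoid.mult = monoid.mult Q, one = one Q,
         ring.zero = ring.zero Q, add = add Q,
         smult = (\<lambda>c X. (I +>\<^bsub>free_alg N\<^esub> const c) \<otimes>\<^bsub>Q\<^esub> X)\<rparr>)"

text \<open>A finite indexed family is a basis of the subspace \<open>W\<close> of the complex vector space \<open>V\<close>.\<close>

definition is_basis ::
  "(complex, 'v, 'm) module_scheme \<Rightarrow> 'v set \<Rightarrow> 'i set \<Rightarrow> ('i \<Rightarrow> 'v) \<Rightarrow> bool" where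
  "is_basis V W I v \<longleftrightarrow>
     finite I \<and> v ` I \<subseteq> carrier V \<and>
     (\<forall>c :: 'i \<Rightarrow> complex. (\<Oplus>\<^bsub>V\<^esub>i\<in>I. c i \<odot>\<^bsub>V\<^esub> v i) = \<zero>\<^bsub>V\<^esub> \<longrightarrow> (\<forall>i\<in>I. c i = 0)) \<and>
     W = {(\<Oplus>\<^bsub>V\<^esub>i\<in>I. c i \<odot>\<^bsub>V\<^esub> v i) | c :: 'i \<Rightarrow> complex. True}"


section \<open>Paths\<close>

text \<open>A path \<open>(h\<^sub>0, \<dots>, h\<^sub>N)\<close> is the list of its heights.\<close>

definition paths :: "nat \<Rightarrow> int list set" where
  "paths N = {h. length h = N + 1 \<and> h ! 0 = 0 \<and> (\<forall>i<N. h ! (i + 1) - h ! i \<in> {1, -1})}"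

definition fund_path :: "nat \<Rightarrow> int list" where
  "fund_path N = map (\<lambda>i. if even i then 0 else -1) [0..<N + 1]"

text \<open>Both relations cover the tiles (\<open>1 \<le> i \<le> N - 1\<close>) and the right boundary half-tile (\<open>i = N\<close>).\<close>

definition added_above :: "nat \<Rightarrow> int list \<Rightarrow> nat \<Rightarrow> int list \<Rightarrow> bool" where
  "added_above N h i h' \<longleftrightarrow> 1 \<le> i \<and> i \<le> N \<and> (i < N \<longrightarrow> h ! (i - 1) = h ! (i + 1)) \<and>
     h ! (i - 1) \<ge> 0 \<and> h ! i = h ! (i - 1) - 1 \<and> h' = h[i := h ! (i - 1) + 1]"

definition added_below :: "nat \<Rightarrow> int list \<Rightarrow> nat \<Rightarrow> int list \<Rightarrow> bool" where
  "added_below N h i h' \<longleftrightarrow> 1 \<le> i \<and> i \<le> N \<and> (i < N \<longrightarrow> h ! (i - 1) = h ! (i + 1)) \<and>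
     h ! (i - 1) < 0 \<and> h ! i = h ! (i - 1) + 1 \<and> h' = h[i := h ! (i - 1) - 1]"


section \<open>The two-boundary Temperley-Lieb algebra and its double quotient\<close>

definition qpow :: "complex \<Rightarrow> complex \<Rightarrow> complex" where
  "qpow \<eta> x = exp (\<eta> * x)"

definition qnum :: "complex \<Rightarrow> complex \<Rightarrow> complex" where
  "qnum \<eta> x = (qpow \<eta> x - qpow \<eta> (- x)) / (qpow \<eta> 1 - qpow \<eta> (- 1))"

definition generic :: "complex \<Rightarrow> complex \<Rightarrow> complex \<Rightarrow> bool" where
  "generic \<eta> \<omega>1 \<omega>2 \<longleftrightarrow>
     (\<forall>n::nat. n > 0 \<longrightarrow> qpow \<eta> 1 ^ n \<noteq> 1) \<and>
     (\<forall>m::int. qnum \<eta> (\<omega>1 - of_int m) \<noteq> 0) \<and>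
     qnum \<eta> \<omega>2 \<noteq> 0 \<and> qnum \<eta> (\<omega>2 + 1) \<noteq> 0"

context
  fixes N :: nat and \<eta> \<omega>1 \<omega>2 \<theta> :: complex
begin

abbreviation br :: "complex \<Rightarrow> complex" where "br \<equiv> qnum \<eta>"

definition delta :: complex where "delta = br 2"
definition s1 :: complex where "s1 = br \<omega>1 / br (\<omega>1 + 1)"
definition s2 :: complex where "s2 = br \<omega>2 / br (\<omega>2 + 1)"

definition b_param :: complex where
  "b_param = (if even N
     then br ((\<omega>1 + \<omega>2 + 1 + \<theta>) / 2) * br ((\<omega>1 + \<omega>2 + 1 - \<theta>) / 2) / (br (\<omega>1 + 1) * br (\<omega>2 + 1))
     else - (br ((\<omega>1 - \<omega>2 + \<theta>) / 2) * br ((\<omega>1 - \<omega>2 - \<theta>) / 2) / (br (\<omega>1 + 1) * br (\<omega>2 + 1))))"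

definition tbtl_rels :: "fpoly set" where
  "tbtl_rels =
     {gen i * gen i - const delta * gen i | i. 1 \<le> i \<and> i \<le> N - 1} \<union>
     {gen i * gen j * gen i - gen i | i j. 1 \<le> i \<and> i \<le> N - 1 \<and> (j = i + 1 \<or> i = j + 1)} \<union>
     {gen 0 * gen 0 - const s1 * gen 0, gen N * gen N - const s2 * gen N} \<union>
     {gen i * gen j - gen j * gen i | i j. i \<le> N \<and> j \<le> N \<and> (i + 1 < j \<or> j + 1 < i)}"

text \<open>For either parity of \<open>N\<close>, \<open>I1\<close> is the product of the generators with odd index at most \<open>N\<close> and
  \<open>I2\<close> that of the generators with even index at most \<open>N\<close>.\<close>

definition I1 :: fpoly where "I1 = prod_list (map gen (filter odd [0..<N + 1]))"
definition I2 :: fpoly where "I2 = prod_list (map gen (filter even [0..<N + 1]))"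

definition dq_rels :: "fpoly set" where
  "dq_rels = {I1 * I2 * I1 - const b_param * I1, I2 * I1 * I2 - const b_param * I2}"

text \<open>Quotienting 2BTL by the double-quotient relations amounts to imposing both sets of relations on
  the free algebra.\<close>

definition Ab :: "(complex, fpoly set) module" where
  "Ab = presented_alg N (tbtl_rels \<union> dq_rels)"

definition e :: "nat \<Rightarrow> fpoly set" where
  "e i = (Idl\<^bsub>free_alg N\<^esub> (tbtl_rels \<union> dq_rels)) +>\<^bsub>free_alg N\<^esub> gen i"

primrec E :: "nat \<Rightarrow> fpoly set" where
  "E 0 = \<one>\<^bsub>Ab\<^esub>"
| "E (Suc i) = (s1 powi ((- 1) ^ Suc i)) \<odot>\<^bsub>Ab\<^esub> (E i \<otimes>\<^bsub>Ab\<^esub> e i \<otimes>\<^bsub>Ab\<^esub> E i)"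

definition W :: "fpoly set set" where
  "W = {x \<otimes>\<^bsub>Ab\<^esub> E N | x. x \<in> carrier Ab}"

definition r :: "complex \<Rightarrow> complex" where
  "r u = br (u + 1) / br u"

definition k :: "complex \<Rightarrow> complex" where
  "k u = - (br ((u - \<omega>2 + \<theta>) / 2) * br ((u - \<omega>2 - \<theta>) / 2) / (br u * br (\<omega>2 + 1)))"

definition R :: "nat \<Rightarrow> complex \<Rightarrow> fpoly set" where
  "R i u = e i \<ominus>\<^bsub>Ab\<^esub> r u \<odot>\<^bsub>Ab\<^esub> \<one>\<^bsub>Ab\<^esub>"

definition K :: "complex \<Rightarrow> fpoly set" where
  "K u = e N \<ominus>\<^bsub>Ab\<^esub> k u \<odot>\<^bsub>Ab\<^esub> \<one>\<^bsub>Ab\<^esub>"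

definition X :: "nat \<Rightarrow> complex \<Rightarrow> fpoly set" where
  "X i u = (if i < N then R i u else K u)"

text \<open>\<open>B1_vec h v\<close>: some sequence of additions leading from the fundamental path to \<open>h\<close> produces \<open>v\<close>.\<close>

inductive B1_vec :: "int list \<Rightarrow> fpoly set \<Rightarrow> bool" where
  fund: "B1_vec (fund_path N) (E N)"
| above: "B1_vec h v \<Longrightarrow> added_above N h i h' \<Longrightarrow>
    B1_vec h' (X i (\<omega>1 - of_int (h ! (i - 1))) \<otimes>\<^bsub>Ab\<^esub> v)"
| below: "B1_vec h v \<Longrightarrow> added_below N h i h' \<Longrightarrow>
    B1_vec h' (X i (- \<omega>1 + of_int (h ! (i - 1))) \<otimes>\<^bsub>Ab\<^esub> v)"

definition b_vec :: "int list \<Rightarrow> fpoly set" where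
  "b_vec h = (THE v. B1_vec h v)"

definition g :: "nat \<Rightarrow> fpoly set" where
  "g i = (if i = 0
     then qpow \<eta> \<omega>1 \<odot>\<^bsub>Ab\<^esub> \<one>\<^bsub>Ab\<^esub> \<ominus>\<^bsub>Ab\<^esub> (qpow \<eta> (1 + \<omega>1) - qpow \<eta> (- 1 - \<omega>1)) \<odot>\<^bsub>Ab\<^esub> e 0
     else e i \<ominus>\<^bsub>Ab\<^esub> qpow \<eta> (- 1) \<odot>\<^bsub>Ab\<^esub> \<one>\<^bsub>Ab\<^esub>)"

primrec JB :: "nat \<Rightarrow> fpoly set" where
  "JB 0 = g 0"
| "JB (Suc i) = g (Suc i) \<otimes>\<^bsub>Ab\<^esub> JB i \<otimes>\<^bsub>Ab\<^esub> g (Suc i)"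

end

end

theory Submission
  imports Defs "HOL-Library.Function_Algebras"
begin

text \<open>The vector of a path is controlled by how the generators act on it: \<open>e\<^sub>i\<close> kills it when the path
  has a slope at \<open>i\<close>, and mixes it with the flipped path when there is an extremum at \<open>i\<close>. The slope
  rule is proved by induction on the tiled area: tiles far from \<open>i\<close> commute with \<open>e\<^sub>i\<close>, and the two or
  three last tiles near \<open>i\<close> are absorbed by the unitarity relation \<open>r(-u) r(u - 1) = 1\<close> and the
  reflection relation \<open>r(-u) k(u - 1) + r(u) k(-u - 1) = 1\<close>, unless the path is the fundamental one
  with a single tile. That base case is a property of \<open>E\<^sub>N\<close>; at the right boundary it is exactly what
  the double quotient relation says about \<open>E\<^sub>N\<close>. Hence the span of the path vectors is stable, and the
  Murphy elements are diagonal by a computation in blocks of size two.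

  For independence the same formulas are used to define operators on functions on paths. These satisfy
  the double quotient relations because the image of \<open>I\<^sub>1\<close>, and likewise of \<open>I\<^sub>2\<close>, is a line, so
  that \<open>I\<^sub>1 I\<^sub>2 I\<^sub>1 = b I\<^sub>1\<close> need only be tested on the vector of the fundamental path.\<close>

section \<open>Quantum numbers\<close>

text \<open>Both halves of the argument run in one abstract setting: a vector v with
  \<open>e_0 v = s_1 v\<close>, \<open>e_{i-1} e_i v = s_1^{(-1)^i} e_{i-1} v\<close> and
  \<open>e_{N-1} e_N v = k e_{N-1} v\<close> for a suitable scalar k. In the quotient it is E_N, in
  the path model the point function of the fundamental path. The obstacle is that the quotient is
  only presented and might a priori collapse, so it yields spanning and eigenvalues, while
  independence must come from a concrete module. Local relations replace the global ones because I_1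
  and I_2 interlace: on v their product telescopes, and b is the product of the scalars met on the
  way with the coefficient k. Heights are measured from -1/2, the midpoint of the oscillation of the
  fundamental path: every added tile moves a point away from it. On one side of -1/2 the parameters
  of neighbouring stacked tiles differ by one, which is the shift in the unitarity and reflection
  relations.\<close>

lemma qpow_add: "qpow \<eta> (x + y) = qpow \<eta> x * qpow \<eta> y"
  by (simp add: qpow_def exp_add distrib_left)

lemma qpow_nonzero [simp]: "qpow \<eta> x \<noteq> 0"
  by (simp add: qpow_def)

lemma qpow_uminus: "qpow \<eta> (- x) = inverse (qpow \<eta> x)"
  by (simp add: qpow_def exp_minus)

lemma qnum_uminus: "qnum \<eta> (- x) = - qnum \<eta> x"
  by (simp add: qnum_def minus_divide_left)

text \<open>Linearises products: a quadratic identity among quantum numbers becomes a linear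
  identity among exponentials over one common denominator.\<close>

lemma qnum_mult:
  "qnum \<eta> x * qnum \<eta> y = (qpow \<eta> (x + y) + qpow \<eta> (- (x + y)) - qpow \<eta> (x - y) - qpow \<eta> (- (x - y)))
     / (qpow \<eta> 1 - qpow \<eta> (- 1))\<^sup>2"
proof -
  have "x - y = x + - y" "- (x - y) = - x + y" "- (x + y) = - x + - y" by simp_all
  then show ?thesis
    by (simp only: qpow_add qnum_def) (simp add: power2_eq_square algebra_simps)
qed

lemma generic_qpow_diff:
  assumes "generic \<eta> \<omega>1 \<omega>2"
  shows "qpow \<eta> 1 - qpow \<eta> (- 1) \<noteq> 0"
proof
  assume "qpow \<eta> 1 - qpow \<eta> (- 1) = 0"
  then have "qpow \<eta> 1 ^ 2 = 1"
    by (simp add: qpow_uminus power2_eq_square divide_simps)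
  with assms show False
    unfolding generic_def by (metis zero_less_numeral)
qed

locale generic_params =
  fixes \<eta> \<omega>1 \<omega>2 \<theta> :: complex
  assumes gen: "generic \<eta> \<omega>1 \<omega>2"
begin

abbreviation qn :: "complex \<Rightarrow> complex" where "qn \<equiv> qnum \<eta>"
abbreviation rr :: "complex \<Rightarrow> complex" where "rr \<equiv> r \<eta>"
abbreviation kk :: "complex \<Rightarrow> complex" where "kk \<equiv> k \<eta> \<omega>2 \<theta>"
abbreviation dlt :: complex where "dlt \<equiv> delta \<eta>"
abbreviation sL :: complex where "sL \<equiv> s1 \<eta> \<omega>1"
abbreviation sR :: complex where "sR \<equiv> s2 \<eta> \<omega>2"

lemmas qdiff = generic_qpow_diff[OF gen]

lemma qn_1 [simp]: "qn 1 = 1"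
  using qdiff by (simp add: qnum_def)

lemma qn_mult_eqI:
  assumes "qpow \<eta> (x + y) + qpow \<eta> (- (x + y)) - qpow \<eta> (x - y) - qpow \<eta> (- (x - y)) +
     (qpow \<eta> (x' + y') + qpow \<eta> (- (x' + y')) - qpow \<eta> (x' - y') - qpow \<eta> (- (x' - y'))) =
     qpow \<eta> (z + w) + qpow \<eta> (- (z + w)) - qpow \<eta> (z - w) - qpow \<eta> (- (z - w))"
  shows "qn x * qn y + qn x' * qn y' = qn z * qn w"
  unfolding qnum_mult using assms by (simp flip: add_divide_distrib)

lemma qn_shift_sum: "qn (u + 1) + qn (u - 1) = qn 2 * qn u"
proof -
  have "qn (u + 1) * qn 1 + qn (u - 1) * qn 1 = qn 2 * qn u"
    by (rule qn_mult_eqI) (simp add: algebra_simps)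
  then show ?thesis by simp
qed

lemma qn_shift_mult: "qn (u + 1) * qn (u - 1) + 1 = qn u * qn u"
proof -
  have "qn (u + 1) * qn (u - 1) + qn 1 * qn 1 = qn u * qn u"
    by (rule qn_mult_eqI) (simp add: algebra_simps)
  then show ?thesis by simp
qed

text \<open>[2] = 0 forces q^4 = 1. The path model needs \<delta> as a nonzero eigenvalue.\<close>

lemma dlt_nonzero: "dlt \<noteq> 0"
proof
  assume "dlt = 0"
  then have "qpow \<eta> 2 = qpow \<eta> (- 2)"
    using qdiff by (simp add: delta_def qnum_def)
  moreover have "qpow \<eta> 2 = qpow \<eta> 1 ^ 2"
    using qpow_add[of \<eta> 1 1] by (simp add: power2_eq_square)
  ultimately have "(qpow \<eta> 1 ^ 2) * (qpow \<eta> 1 ^ 2) = 1"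
    by (metis qpow_nonzero qpow_uminus right_inverse)
  then have "qpow \<eta> 1 ^ 4 = 1"
    by (simp flip: power_add)
  then show False
    using gen unfolding generic_def by (metis zero_less_numeral)
qed

lemma qn_\<omega>1_minus: "qn (\<omega>1 - of_int m) \<noteq> 0"
  using gen by (simp add: generic_def)

lemma qn_\<omega>1_plus: "qn (\<omega>1 + of_int m) \<noteq> 0"
  using qn_\<omega>1_minus[of "- m"] by simp

lemma qn_\<omega>1 [simp]: "qn \<omega>1 \<noteq> 0" "qn (\<omega>1 + 1) \<noteq> 0"
  using qn_\<omega>1_minus[of 0] qn_\<omega>1_plus[of 1] by simp_all

lemma qn_\<omega>2 [simp]: "qn \<omega>2 \<noteq> 0" "qn (\<omega>2 + 1) \<noteq> 0"
  using gen by (simp_all add: generic_def)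

lemma sL_nonzero [simp]: "sL \<noteq> 0"
  by (simp add: s1_def)

lemma sR_nonzero [simp]: "sR \<noteq> 0"
  by (simp add: s2_def)

lemma rr_sum: "qn u \<noteq> 0 \<Longrightarrow> rr u + rr (- u) = dlt"
  using qn_shift_sum[of u] qnum_uminus[of \<eta> "u - 1"]
  by (simp add: r_def delta_def qnum_uminus field_simps)

lemma rr_unit: "qn u \<noteq> 0 \<Longrightarrow> qn (u - 1) \<noteq> 0 \<Longrightarrow> rr (- u) * rr (u - 1) = 1"
  using qnum_uminus[of \<eta> "u - 1"] by (simp add: r_def qnum_uminus)

text \<open>The numerator of k as a function of u - \<omega>2. It is even and its differences are
  free of \<theta>, so \<open>knum_diff\<close> is the common source of \<open>kk_sum\<close> and
  \<open>kk_reflection\<close>.\<close>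

definition knum :: "complex \<Rightarrow> complex" where
  "knum a = qn ((a + \<theta>) / 2) * qn ((a - \<theta>) / 2)"

lemma kk_knum: "kk u = - (knum (u - \<omega>2) / (qn u * qn (\<omega>2 + 1)))"
  by (simp add: k_def knum_def)

lemma knum_uminus: "knum (- a) = knum a"
proof -
  have "(- a + \<theta>) / 2 = - ((a - \<theta>) / 2)" "(- a - \<theta>) / 2 = - ((a + \<theta>) / 2)"
    by (simp_all add: field_simps)
  then show ?thesis
    by (simp only: knum_def qnum_uminus) simp
qed

text \<open>By the product formula each value is a part depending on its argument minus a part
  depending on \<theta>; the latter cancels.\<close>

lemma knum_diff: "knum (x + y) - knum (x - y) = qn x * qn y"
proof -
  have half: "(a + \<theta>) / 2 + (a - \<theta>) / 2 = a" "(a + \<theta>) / 2 - (a - \<theta>) / 2 = \<theta>" for a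
    by (simp_all add: field_simps)
  show ?thesis
    unfolding knum_def qnum_mult half by (simp flip: diff_divide_distrib)
qed

lemma kk_sum:
  assumes "qn u \<noteq> 0"
  shows "kk u + kk (- u) = sR"
proof -
  have "knum (- u - \<omega>2) = knum (u + \<omega>2)"
    using knum_uminus[of "u + \<omega>2"] by simp
  then have "kk u + kk (- u) = (knum (u + \<omega>2) - knum (u - \<omega>2)) / (qn u * qn (\<omega>2 + 1))"
    by (simp add: kk_knum qnum_uminus diff_divide_distrib)
  then show ?thesis
    using assms unfolding knum_diff by (simp add: s2_def)
qed

text \<open>This is \<open>knum_diff\<close> with y = \<omega>2 + 1: the arguments u - 1 - \<omega>2
  and -u - 1 - \<omega>2 become u - y and, by evenness, u + y.\<close>

lemma kk_reflection:
  assumes "qn u \<noteq> 0" "qn (u - 1) \<noteq> 0" "qn (u + 1) \<noteq> 0"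
  shows "rr (- u) * kk (u - 1) + rr u * kk (- u - 1) = 1"
proof -
  have neg: "qn (- u + 1) = - qn (u - 1)" "qn (- u) = - qn u" "qn (- u - 1) = - qn (u + 1)"
    using qnum_uminus[of \<eta> "u - 1"] qnum_uminus[of \<eta> "u + 1"] qnum_uminus[of \<eta> u] by simp_all
  have "- u - 1 - \<omega>2 = - (u + (\<omega>2 + 1))" by simp
  then have args: "knum (- u - 1 - \<omega>2) = knum (u + (\<omega>2 + 1))" "u - 1 - \<omega>2 = u - (\<omega>2 + 1)"
    by (simp_all only: knum_uminus) simp
  have "rr (- u) = qn (u - 1) / qn u"
    by (simp only: r_def neg) simp
  then have "rr (- u) * kk (u - 1) = - (knum (u - (\<omega>2 + 1)) / (qn u * qn (\<omega>2 + 1)))"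
    using assms by (simp only: kk_knum args) simp
  moreover have "rr u * kk (- u - 1) = knum (u + (\<omega>2 + 1)) / (qn u * qn (\<omega>2 + 1))"
    using assms by (simp only: kk_knum args neg r_def) simp
  ultimately have "rr (- u) * kk (u - 1) + rr u * kk (- u - 1) =
      (knum (u + (\<omega>2 + 1)) - knum (u - (\<omega>2 + 1))) / (qn u * qn (\<omega>2 + 1))"
    by (simp add: diff_divide_distrib)
  then show ?thesis
    using assms unfolding knum_diff by simp
qed

text \<open>\<omega>1 and -\<omega>1 - 1 are the parameters of tiles over base heights 0 and -1, the
  only ones on the fundamental path; their coefficients match the normalisation of the idempotents
  E_i.\<close>

lemma rr_\<omega>1: "rr \<omega>1 = inverse sL" "rr (- \<omega>1 - 1) = sL"
  using qnum_uminus[of \<eta> "\<omega>1 + 1"] by (simp_all add: r_def s1_def qnum_uminus)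

end

section \<open>Tilings of paths\<close>

text \<open>The side of -1/2 on which a height lies; 0 counts as above, in line with the convention
  for tiles.\<close>

definition sg :: "int \<Rightarrow> int" where
  "sg a = (if a \<ge> 0 then 1 else - 1)"

text \<open>At i = N there is no right neighbour and the condition is empty, which puts half-tiles
  and tiles under one notion.\<close>

definition extremal :: "nat \<Rightarrow> int list \<Rightarrow> nat \<Rightarrow> bool" where
  "extremal N h i \<longleftrightarrow> 1 \<le> i \<and> i \<le> N \<and> (i < N \<longrightarrow> h ! (i - 1) = h ! (i + 1))"

definition addable :: "nat \<Rightarrow> int list \<Rightarrow> nat \<Rightarrow> bool" where
  "addable N h i \<longleftrightarrow> extremal N h i \<and> h ! i = h ! (i - 1) - sg (h ! (i - 1))"

definition removable :: "nat \<Rightarrow> int list \<Rightarrow> nat \<Rightarrow> bool" where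
  "removable N h i \<longleftrightarrow> extremal N h i \<and> h ! i = h ! (i - 1) + sg (h ! (i - 1))"

text \<open>Reflects h_i in the height h_{i-1}, so it is its own inverse and serves both to add and
  to remove a tile.\<close>

definition flip :: "nat \<Rightarrow> int list \<Rightarrow> int list" where
  "flip i h = h[i := 2 * h ! (i - 1) - h ! i]"

definition slope :: "nat \<Rightarrow> int list \<Rightarrow> nat \<Rightarrow> bool" where
  "slope N h i \<longleftrightarrow> 1 \<le> i \<and> i < N \<and> h ! (i - 1) \<noteq> h ! (i + 1)"

text \<open>Twice the total distance of the heights from -1/2. It is not the number of tiles: a tile
  over base height 0 or -1 raises it by 2, any other by 4. It still grows with every addition and is
  easy to compare between paths that differ in several points.\<close>

definition area :: "int list \<Rightarrow> int" where
  "area h = (\<Sum>i<length h. \<bar>2 * h ! i + 1\<bar>)"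

lemma sg_cases: "sg a = 1 \<and> a \<ge> 0 \<or> sg a = - 1 \<and> a < 0"
  by (auto simp: sg_def)

lemma sg_sq [simp]: "sg a * sg a = 1"
  by (simp add: sg_def)

lemma path_length: "h \<in> paths N \<Longrightarrow> length h = N + 1"
  by (simp add: paths_def)

lemma path_0: "h \<in> paths N \<Longrightarrow> h ! 0 = 0"
  by (simp add: paths_def)

lemma path_step: "h \<in> paths N \<Longrightarrow> i < N \<Longrightarrow> h ! (i + 1) = h ! i + 1 \<or> h ! (i + 1) = h ! i - 1"
  unfolding paths_def by force

lemma path_step': "h \<in> paths N \<Longrightarrow> 1 \<le> i \<Longrightarrow> i \<le> N \<Longrightarrow> h ! i = h ! (i - 1) + 1 \<or> h ! i = h ! (i - 1) - 1"
  using path_step[of h N "i - 1"] by auto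

lemma finite_paths: "finite (paths N)"
proof -
  have "\<bar>h ! i\<bar> \<le> int i" if "h \<in> paths N" "i \<le> N" for h i
    using that(2)
  proof (induction i)
    case (Suc i)
    then show ?case using path_step[OF that(1), of i] by auto
  qed (simp add: path_0[OF that(1)])
  then have "paths N \<subseteq> {h. set h \<subseteq> {- int N..int N} \<and> length h = N + 1}"
    by (auto simp: path_length in_set_conv_nth abs_le_iff) (smt (verit) less_Suc_eq_le of_nat_mono)+
  then show ?thesis
    by (rule finite_subset) (simp add: finite_lists_length_eq)
qed

lemma fund_path_nth: "i \<le> N \<Longrightarrow> fund_path N ! i = (if even i then 0 else - 1)"
  by (simp add: fund_path_def del: upt_Suc)

lemma fund_path_in_paths: "fund_path N \<in> paths N"
  by (simp add: paths_def fund_path_nth) (simp add: fund_path_def)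

lemma path_eqI: "h \<in> paths N \<Longrightarrow> h' \<in> paths N \<Longrightarrow> (\<And>i. i \<le> N \<Longrightarrow> h ! i = h' ! i) \<Longrightarrow> h = h'"
  by (rule nth_equalityI) (auto simp: path_length)

lemma length_flip [simp]: "length (flip i h) = length h"
  by (simp add: flip_def)

lemma nth_flip: "i < length h \<Longrightarrow> flip i h ! j = (if i = j then 2 * h ! (i - 1) - h ! i else h ! j)"
  by (simp add: flip_def)

lemma flip_in_paths:
  assumes h: "h \<in> paths N" and "extremal N h i"
  shows "flip i h \<in> paths N"
proof -
  have i: "1 \<le> i" "i \<le> N" "i < N \<Longrightarrow> h ! (i - 1) = h ! (i + 1)" "i < length h"
    using assms by (auto simp: extremal_def path_length)
  have "flip i h ! (j + 1) - flip i h ! j \<in> {1, - 1}" if "j < N" for j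
    using path_step[OF h that] path_step'[OF h i(1,2)] i that
    by (auto simp: nth_flip simp del: One_nat_def)
  then show ?thesis
    using i h by (auto simp: paths_def nth_flip)
qed

lemma flip_flip: "1 \<le> i \<Longrightarrow> flip i (flip i h) = h"
  by (cases "i < length h") (auto simp: flip_def list_eq_iff_nth_eq nth_list_update)

lemma flip_commute: "i + 1 < j \<or> j + 1 < i \<Longrightarrow> flip i (flip j h) = flip j (flip i h)"
  by (cases "i < length h"; cases "j < length h")
     (auto simp: flip_def list_update_swap nth_list_update)

lemma extremal_flip: "extremal N h i \<Longrightarrow> length h = N + 1 \<Longrightarrow> extremal N (flip i h) i"
  by (auto simp: extremal_def nth_flip)

lemma extremal_flip_far:
  "i + 1 < j \<or> j + 1 < i \<Longrightarrow> length h = N + 1 \<Longrightarrow> j \<le> N \<Longrightarrow> extremal N (flip j h) i = extremal N h i"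
  by (auto simp: extremal_def nth_flip)

lemma removable_flip_far:
  "i + 1 < j \<or> j + 1 < i \<Longrightarrow> length h = N + 1 \<Longrightarrow> j \<le> N \<Longrightarrow> removable N (flip j h) i = removable N h i"
  unfolding removable_def extremal_flip_far by (auto simp: nth_flip)

lemma slope_flip_far:
  "i + 1 < j \<or> j + 1 < i \<Longrightarrow> length h = N + 1 \<Longrightarrow> j \<le> N \<Longrightarrow> slope N (flip j h) i = slope N h i"
  by (auto simp: slope_def nth_flip)

lemma flip_nth_near:
  "extremal N h i \<Longrightarrow> length h = N + 1 \<Longrightarrow> flip i h ! i = 2 * h ! (i - 1) - h ! i"
  "extremal N h i \<Longrightarrow> length h = N + 1 \<Longrightarrow> flip i h ! (i - 1) = h ! (i - 1)"
  by (auto simp: extremal_def nth_flip)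

lemma removable_flip: "addable N h i \<Longrightarrow> length h = N + 1 \<Longrightarrow> removable N (flip i h) i"
  unfolding addable_def removable_def
  by (elim conjE) (simp add: extremal_flip flip_nth_near del: One_nat_def)

lemma addable_flip: "removable N h i \<Longrightarrow> length h = N + 1 \<Longrightarrow> addable N (flip i h) i"
  unfolding addable_def removable_def
  by (elim conjE) (simp add: extremal_flip flip_nth_near del: One_nat_def)

lemma area_nonneg: "area h \<ge> 0"
  by (simp add: area_def sum_nonneg)

lemma area_flip:
  assumes "i < length h"
  shows "area (flip i h) = area h - \<bar>2 * h ! i + 1\<bar> + \<bar>2 * (2 * h ! (i - 1) - h ! i) + 1\<bar>"
proof -
  have "area h' = (\<Sum>j\<in>{..<length h} - {i}. \<bar>2 * h' ! j + 1\<bar>) + \<bar>2 * h' ! i + 1\<bar>" if "length h' = length h" for h'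
    using assms that by (simp add: area_def sum.remove[of _ i])
  from this[of h] this[of "flip i h"] show ?thesis
    using assms by (simp add: nth_flip)
qed

lemma area_remove:
  assumes "removable N h i" "length h = N + 1"
  shows "area (flip i h) < area h"
proof -
  have "i < length h" using assms by (simp add: removable_def extremal_def)
  then show ?thesis
    using assms by (simp add: area_flip removable_def sg_def split: if_splits)
qed

text \<open>A removable tile at l returns to h_{l-1} at l + 1, whereas one at l + 1 would continue
  outward, as h_l and h_{l-1} lie on the same side of -1/2.\<close>

lemma removable_far:
  assumes "removable N h i" "removable N h j" "i \<noteq> j"
  shows "i + 1 < j \<or> j + 1 < i"
proof -
  have "\<not> removable N h (l + 1)" if "removable N h l" for l
  proof
    assume "removable N h (l + 1)"
    with that show False
      by (auto simp: removable_def extremal_def sg_def split: if_splits)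
  qed
  with assms show ?thesis
    by (metis Suc_eq_plus1 Suc_lessI linorder_neqE_nat)
qed

lemma not_slope_removable: "removable N h i \<Longrightarrow> \<not> slope N h i"
  by (auto simp: removable_def extremal_def slope_def)

text \<open>A point farthest from -1/2 is a local extremum pointing outward, hence removable, unless
  all heights are 0 or -1.\<close>

lemma ex_removable:
  assumes h: "h \<in> paths N" and ne: "h \<noteq> fund_path N"
  shows "\<exists>i. removable N h i"
proof -
  let ?f = "\<lambda>i. \<bar>2 * h ! i + 1\<bar>"
  obtain i where i: "i \<le> N" "\<And>j. j \<le> N \<Longrightarrow> ?f j \<le> ?f i"
    using Max_in[of "?f ` {..N}"] Max_ge[of "?f ` {..N}"] by fastforce
  have "?f i > 1"
  proof (rule ccontr)
    assume "\<not> ?f i > 1"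
    then have small: "h ! j = 0 \<or> h ! j = - 1" if "j \<le> N" for j
      using i(2)[OF that] by auto
    have "h ! j = fund_path N ! j" if "j \<le> N" for j
      using that
    proof (induction j)
      case (Suc j)
      then show ?case
        using path_step[OF h, of j] small[of "j + 1"] by (auto simp: fund_path_nth)
    qed (simp add: path_0[OF h] fund_path_nth)
    with h ne show False
      by (blast intro: path_eqI fund_path_in_paths)
  qed
  then have i1: "1 \<le> i"
    using path_0[OF h] by (cases i) auto
  have i': "i - 1 \<le> N" using i(1) by simp
  have prev: "h ! i = h ! (i - 1) + sg (h ! (i - 1))"
    using \<open>?f i > 1\<close> path_step'[OF h i1 i(1)] i(2)[OF i'] by (auto simp: sg_def)
  moreover have "h ! (i - 1) = h ! (i + 1)" if "i < N"
    using \<open>?f i > 1\<close> path_step[OF h that] i(2)[of "i + 1"] that prev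
    by (auto simp: sg_def split: if_splits)
  ultimately have "removable N h i"
    unfolding removable_def extremal_def using i1 i(1) by blast
  then show ?thesis ..
qed

lemma area_less_induct [consumes 1, case_names less]:
  assumes "h \<in> paths N"
    and "\<And>h. h \<in> paths N \<Longrightarrow> (\<And>h'. h' \<in> paths N \<Longrightarrow> area h' < area h \<Longrightarrow> P h') \<Longrightarrow> P h"
  shows "P h"
  using assms(1)
proof (induction "nat (area h)" arbitrary: h rule: less_induct)
  case less
  have "P h'" if "h' \<in> paths N" "area h' < area h" for h'
    using that area_nonneg[of h'] by (intro less.hyps) linarith+
  then show ?case
    by (rule assms(2)[OF less.prems])
qed

section \<open>Modules over the two-boundary Temperley-Lieb algebra\<close>

locale tbtl_params = generic_params \<eta> \<omega>1 \<omega>2 \<theta>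
  for N :: nat and \<eta> \<omega>1 \<omega>2 \<theta> :: complex +
  assumes N2: "N \<ge> 2"
begin

definition cc :: "nat \<Rightarrow> complex \<Rightarrow> complex" where
  "cc i u = (if i < N then rr u else kk u)"

text \<open>One formula for the argument \<omega>1 - h_{i-1} from above and -\<omega>1 + h_{i-1}
  from below.\<close>

definition par :: "int list \<Rightarrow> nat \<Rightarrow> complex" where
  "par h i = of_int (sg (h ! (i - 1))) * (\<omega>1 - of_int (h ! (i - 1)))"

end

text \<open>The double quotient relations are left out: they enter only through a condition on one
  vector, so that the same results serve the quotient algebra and the path model.\<close>

locale tbtl_module = tbtl_params N \<eta> \<omega>1 \<omega>2 \<theta> + vector_space scale
  for N :: nat and \<eta> \<omega>1 \<omega>2 \<theta> :: complex
    and scale :: "complex \<Rightarrow> 'v::ab_group_add \<Rightarrow> 'v" (infixr \<open>*s\<close> 75)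
    and ee :: "nat \<Rightarrow> 'v \<Rightarrow> 'v" +
  assumes ee_add: "ee i (x + y) = ee i x + ee i y"
    and ee_scale: "ee i (c *s x) = c *s ee i x"
    and ee_sq: "1 \<le> i \<Longrightarrow> i < N \<Longrightarrow> ee i (ee i v) = dlt *s ee i v"
    and ee_up: "1 \<le> i \<Longrightarrow> i < N \<Longrightarrow> ee i (ee (i + 1) (ee i v)) = ee i v"
    and ee_down: "1 \<le> i \<Longrightarrow> i < N \<Longrightarrow> ee i (ee (i - 1) (ee i v)) = ee i v"
    and ee_sq_0: "ee 0 (ee 0 v) = sL *s ee 0 v"
    and ee_sq_N: "ee N (ee N v) = sR *s ee N v"
    and ee_comm: "i + 1 < j \<Longrightarrow> j \<le> N \<Longrightarrow> ee i (ee j v) = ee j (ee i v)"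
begin

sublocale ee: additive "ee i" for i
  by unfold_locales (rule ee_add)

definition ss :: "nat \<Rightarrow> complex" where
  "ss i = sL powi ((- 1) ^ i)"

lemma ss_even: "even i \<Longrightarrow> ss i = sL" and ss_odd: "odd i \<Longrightarrow> ss i = inverse sL"
  by (simp_all add: ss_def power_int_minus)

lemma ss_Suc: "ss (Suc i) = inverse (ss i)"
  by (cases "even i") (simp_all add: ss_even ss_odd)

lemma ss_nonzero [simp]: "ss i \<noteq> 0"
  by (cases "even i") (simp_all add: ss_even ss_odd)

primrec EE :: "nat \<Rightarrow> 'v \<Rightarrow> 'v" where
  "EE 0 v = v"
| "EE (Suc i) v = ss (Suc i) *s EE i (ee i (EE i v))"

lemma EE_scale: "EE i (c *s x) = c *s EE i x"
  by (induction i arbitrary: x) (simp_all add: ee_scale mult.commute)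

lemma EE_comm: "i < j \<Longrightarrow> j \<le> N \<Longrightarrow> EE i (ee j v) = ee j (EE i v)"
proof (induction i arbitrary: v)
  case (Suc i)
  then show ?case by (simp add: ee_scale ee_comm[of i j])
qed simp

text \<open>The core is e_j e_{j-1} e_j = e_j. Idempotency is a hypothesis because this identity is
  used inside the induction for \<open>EE_idem\<close>; \<open>ee_EE_ee\<close> discharges it
  afterwards.\<close>

lemma ee_EE_ee_aux:
  assumes "j < N" and idem: "\<And>v. EE (j - 1) (EE (j - 1) v) = EE (j - 1) v"
  shows "ee j (EE j (ee j v)) = ss j *s EE (j - 1) (ee j v)"
proof (cases j)
  case 0
  then show ?thesis by (simp add: ee_sq_0 ss_even)
next
  case (Suc i)
  then show ?thesis
    using assms idem ee_down[of j] by (simp add: ee_scale EE_comm[of i "Suc i", symmetric])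
      (simp add: EE_comm[of i "Suc i"])
qed

lemma EE_idem: "i \<le> N \<Longrightarrow> EE i (EE i v) = EE i v"
proof (induction i arbitrary: v rule: less_induct)
  case (less i)
  show ?case
  proof (cases i)
    case (Suc j)
    have j: "\<And>v. EE j (EE j v) = EE j v" and j': "\<And>v. EE (j - 1) (EE (j - 1) v) = EE (j - 1) v"
      using less Suc by simp_all
    have absorb: "EE j (EE (j - 1) v) = EE j v" for v
      using j' by (cases j) simp_all
    have "EE i (EE i v) = (ss i * ss i) *s EE j (ee j (EE j (ee j (EE j v))))"
      by (simp add: Suc EE_scale ee_scale j)
    also have "\<dots> = (ss i * ss i * ss j) *s EE j (ee j (EE j v))"
      using Suc less.prems j' by (simp add: ee_EE_ee_aux EE_scale absorb[unfolded One_nat_def])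
    also have "ss i * ss i * ss j = ss i"
      by (simp add: Suc ss_Suc)
    finally show ?thesis by (simp add: Suc)
  qed simp
qed

lemma ee_EE_ee: "j < N \<Longrightarrow> ee j (EE j (ee j v)) = ss j *s EE (j - 1) (ee j v)"
  by (rule ee_EE_ee_aux) (simp_all add: EE_idem)

lemma EE_absorb:
  assumes "i \<le> j" "j \<le> N"
  shows "EE i (EE j v) = EE j v"
  using assms
proof (induction j arbitrary: v)
  case (Suc j)
  show ?case
  proof (cases "i = Suc j")
    case True
    then show ?thesis using Suc.prems EE_idem by blast
  next
    case False
    then show ?thesis using Suc by (simp add: EE_scale)
  qed
qed simp

text \<open>Under e_j the factors E_j e_j E_j of E_{j+1} collapse, and the two normalising scalars
  are inverse to each other.\<close>

lemma ee_EE_Suc: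
  assumes "j < N"
  shows "ee j (EE (Suc j) v) = ee j (EE j v)"
proof -
  have "ee j (EE (Suc j) v) = (ss (Suc j) * ss j) *s EE (j - 1) (ee j (EE j v))"
    using assms by (simp add: ee_scale ee_EE_ee)
  also have "\<dots> = EE (j - 1) (ee j (EE j v))"
    by (simp add: ss_Suc)
  also have "\<dots> = ee j (EE j v)"
    using assms by (cases j) (simp_all add: EE_comm EE_absorb del: EE.simps(2))
  finally show ?thesis .
qed

end


text \<open>Local relations equivalent to E_N v = v, by \<open>EE_v0\<close> and
  \<open>vacuum_EE\<close>. They involve two neighbouring generators at a time, so they are easy to
  check in the path model.\<close>

locale tbtl_vacuum = tbtl_module N \<eta> \<omega>1 \<omega>2 \<theta> scale ee
  for N :: nat and \<eta> \<omega>1 \<omega>2 \<theta> :: complex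
    and scale :: "complex \<Rightarrow> 'v::ab_group_add \<Rightarrow> 'v" (infixr \<open>*s\<close> 75)
    and ee :: "nat \<Rightarrow> 'v \<Rightarrow> 'v" +
  fixes v0 :: 'v
  assumes ee_0_v0: "ee 0 v0 = sL *s v0"
    and ee_ee_v0: "1 \<le> i \<Longrightarrow> i < N \<Longrightarrow> ee (i - 1) (ee i v0) = ss i *s ee (i - 1) v0"
begin

lemma EE_ee_v0_aux:
  assumes "i < N" "EE i v0 = v0" "EE (i - 1) v0 = v0"
  shows "EE i (ee i v0) = ss i *s v0"
proof (cases i)
  case 0
  then show ?thesis by (simp add: ee_0_v0 ss_even)
next
  case (Suc j)
  have v0: "v0 = ss i *s EE j (ee j v0)"
    using assms Suc by simp
  have "EE i (ee i v0) = ss i *s EE j (ee j (ee i v0))"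
    using assms Suc by (simp add: EE_comm)
  also have "\<dots> = ss i *s (ss i *s EE j (ee j v0))"
    using ee_ee_v0[of i] assms(1) Suc by (simp add: EE_scale)
  finally show ?thesis using v0 by simp
qed

lemma EE_v0: "i \<le> N \<Longrightarrow> EE i v0 = v0"
proof (induction i rule: less_induct)
  case (less i)
  show ?case
  proof (cases i)
    case (Suc j)
    then show ?thesis
      using less EE_ee_v0_aux[of j] by (simp add: ss_Suc)
  qed simp
qed

text \<open>Apply e_i to the vacuum relation and use e_i e_{i-1} e_i = e_i.\<close>

lemma ee_ee_v0': "1 \<le> i \<Longrightarrow> i < N \<Longrightarrow> ee i (ee (i - 1) v0) = ss (i - 1) *s ee i v0"
proof -
  assume i: "1 \<le> i" "i < N"
  then obtain j where j: "i = Suc j" by (cases i) auto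
  have "ee i (ee (i - 1) (ee i v0)) = ss i *s ee i (ee (i - 1) v0)"
    using ee_ee_v0[OF i] by (simp add: ee_scale)
  then have "ee i v0 = ss i *s ee i (ee (i - 1) v0)"
    using ee_down[OF i] by simp
  then have "ss j *s ee i v0 = ss j *s ss i *s ee i (ee (i - 1) v0)"
    by (rule arg_cong)
  then show ?thesis using j by (simp add: ss_Suc)
qed

end

lemma (in tbtl_module) vacuum_EE: "tbtl_vacuum N \<eta> \<omega>1 \<omega>2 scale ee (EE N z)"
proof unfold_locales
  let ?v = "EE N z"
  have EE_v: "EE i ?v = ?v" if "i \<le> N" for i
    using that by (simp add: EE_absorb)
  show "ee 0 ?v = sL *s ?v"
  proof -
    have "ss 1 *s ee 0 ?v = ?v" using EE_v[of 1] N2 by simp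
    then have "sL *s ss 1 *s ee 0 ?v = sL *s ?v" by (rule arg_cong)
    then show ?thesis by (simp add: ss_odd)
  qed
  show "ee (i - 1) (ee i ?v) = ss i *s ee (i - 1) ?v" if i: "1 \<le> i" "i < N" for i
  proof -
    obtain j where j: "i = Suc j" using i by (cases i) auto
    \<comment> \<open>E_{i+1} v = v and E_i v = v combine into a value for E_i e_i v. Applying
      e_{i-1} then strips E_i: by \<open>ee_EE_Suc\<close> down to E_{i-1}, which commutes with e_i
      and fixes v.\<close>
    have "inverse (ss i) *s EE i (ee i ?v) = ?v"
      using EE_v[of "Suc i"] EE_v[of i] i by (simp add: ss_Suc)
    then have "ss i *s inverse (ss i) *s EE i (ee i ?v) = ss i *s ?v"
      by (rule arg_cong)
    then have "ss i *s ?v = EE i (ee i ?v)" by simp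
    then have "ss i *s ee j ?v = ee j (EE (Suc j) (ee i ?v))"
      by (simp flip: ee_scale j)
    also have "\<dots> = ee j (EE j (ee i ?v))"
      using i j by (intro ee_EE_Suc) simp
    also have "\<dots> = ee j (ee i ?v)"
      using i j EE_v by (simp add: EE_comm)
    finally show ?thesis using j by simp
  qed
qed

section \<open>Alternating products of generators\<close>

context tbtl_module
begin

text \<open>\<open>alt n\<close> is the product of the generators with index less than \<open>n\<close> and of the parity of \<open>n - 1\<close>, so
  that \<open>I\<^sub>1\<close> and \<open>I\<^sub>2\<close> are \<open>alt N\<close> and \<open>alt (N + 1)\<close> in an order depending on the parity of \<open>N\<close>.\<close>

fun alt :: "nat \<Rightarrow> 'v \<Rightarrow> 'v" where
  "alt 0 v = v"
| "alt (Suc 0) v = ee 0 v"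
| "alt (Suc (Suc n)) v = ee (Suc n) (alt n v)"

text \<open>The scalar left when \<open>alt (n - 1)\<close> meets \<open>alt n\<close> on a vacuum
  vector, see \<open>alt_alt_v0\<close>. Consecutive values multiply to 1 or s_1.\<close>

fun cs :: "nat \<Rightarrow> complex" where
  "cs 0 = 1"
| "cs (Suc 0) = sL"
| "cs (Suc (Suc n)) = cs n * ss (Suc n)"

text \<open>\<open>uN\<close> is the parameter of the right boundary half-tile of the fundamental path.\<close>

definition uN :: complex where
  "uN = (if odd N then \<omega>1 else - \<omega>1 - 1)"

lemma alt_add: "alt n (x + y) = alt n x + alt n y"
  by (induction n x arbitrary: y rule: alt.induct) (simp_all add: ee_add)

lemma alt_scale: "alt n (c *s x) = c *s alt n x"
  by (induction n x rule: alt.induct) (simp_all add: ee_scale)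

sublocale alt: additive "alt n" for n
  by unfold_locales (rule alt_add)

lemma alt_comm: "n < j \<Longrightarrow> j \<le> N \<Longrightarrow> alt n (ee j v) = ee j (alt n v)"
proof (induction n v rule: alt.induct)
  case (3 n v)
  then show ?case by (simp add: ee_comm[of "Suc n" j])
next
  case (2 v)
  then show ?case by (simp add: ee_comm[of 0 j])
qed simp

text \<open>I_1 and I_2 list the indices increasingly while \<open>alt\<close> has the largest index
  outermost, whence the use of \<open>alt_comm\<close>. Both parities are proved together because
  each step of the induction swaps them.\<close>

lemma foldr_alternate:
  "n \<le> N + 1 \<Longrightarrow> foldr ee (filter (\<lambda>i. even i \<noteq> even n) [0..<n]) v = alt n v"
  "n \<le> N + 1 \<Longrightarrow> foldr ee (filter (\<lambda>i. even i = even n) [0..<n]) v = alt (n - 1) v"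
proof (induction n arbitrary: v)
  case (Suc n)
  {
    case 1
    then show ?case
      using Suc.IH(2) by (cases n) (simp_all add: alt_comm)
  next
    case 2
    then show ?case
      using Suc.IH(1) by simp
  }
qed simp_all

lemma cs_nonzero [simp]: "cs n \<noteq> 0"
  by (induction n rule: cs.induct) simp_all

lemma cs_mult: "cs (Suc n) * cs n = (if even n then sL else 1)"
proof (induction n)
  case (Suc n)
  have "cs (Suc (Suc n)) * cs (Suc n) = cs (Suc n) * cs n * ss (Suc n)"
    by (simp add: mult_ac)
  then show ?case
    by (cases "even n") (simp_all add: Suc ss_even ss_odd)
qed simp

text \<open>The two parity formulas for b are one: the half-tile coefficient of the fundamental path
  times the scalars accumulated by the alternating products. For N even the sign of the argument is
  changed by evenness of \<open>knum\<close>.\<close>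

lemma b_param_kk: "b_param N \<eta> \<omega>1 \<omega>2 \<theta> = cs N * cs (N - 1) * kk uN"
proof -
  have cs: "cs N * cs (N - 1) = (if even N then 1 else sL)"
    using N2 cs_mult[of "N - 1"] by simp
  have args: "- \<omega>1 - 1 - \<omega>2 = - (\<omega>1 + \<omega>2 + 1)" "- \<omega>1 - 1 = - (\<omega>1 + 1)" by simp_all
  have "kk (- \<omega>1 - 1) = knum (\<omega>1 + \<omega>2 + 1) / (qn (\<omega>1 + 1) * qn (\<omega>2 + 1))"
    unfolding kk_knum args(1) knum_uminus unfolding args(2) qnum_uminus by simp
  moreover have "sL * kk \<omega>1 = - (knum (\<omega>1 - \<omega>2) / (qn (\<omega>1 + 1) * qn (\<omega>2 + 1)))"
    by (simp add: kk_knum s1_def)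
  ultimately show ?thesis
    unfolding cs b_param_def uN_def knum_def by simp
qed

end

section \<open>Collapse of alternating products on a vacuum vector\<close>

context tbtl_vacuum
begin

text \<open>The two largest generators commute past the smaller ones, so the product collapses from
  the small end, each pair being resolved by the vacuum relation.\<close>

lemma alt_alt_v0: "n < N \<Longrightarrow> alt n (alt (Suc n) v0) = cs (Suc n) *s alt n v0"
proof (induction n rule: cs.induct)
  case 1
  then show ?case by (simp add: ee_0_v0)
next
  case 2
  then show ?case using ee_ee_v0[of 1] by simp
next
  case (3 n)
  have "alt (Suc (Suc n)) (alt (Suc (Suc (Suc n))) v0) = ee (Suc n) (ee (Suc (Suc n)) (alt n (alt (Suc n) v0)))"
    using 3 by (simp add: alt_comm)
  also have "\<dots> = cs (Suc n) *s alt n (ee (Suc n) (ee (Suc (Suc n)) v0))"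
    using 3 by (simp add: alt_comm ee_scale)
  also have "\<dots> = cs (Suc n) *s ss (Suc (Suc n)) *s alt n (ee (Suc n) v0)"
    using ee_ee_v0[of "Suc (Suc n)"] 3 by (simp add: alt_scale)
  finally show ?case
    using 3 by (simp add: alt_comm)
qed

lemma alt_Suc_alt_v0: "1 \<le> n \<Longrightarrow> n \<le> N \<Longrightarrow> alt (Suc n) (alt n v0) = cs n *s alt (Suc n) v0"
  using alt_alt_v0[of "n - 1"] by (cases n) (simp_all add: ee_scale)

text \<open>The same collapse stopped at the last pair: e_{N-1} e_N v0 is the unknown that the
  quotient relation has to determine.\<close>

lemma alt_N_alt_v0:
  "alt N (alt (Suc N) v0) = cs (N - 1) *s alt (N - 2) (ee (N - 1) (ee N v0))"
proof -
  obtain n where N: "N = Suc (Suc n)" using N2 by (auto simp: numeral_2_eq_2 dest!: le_Suc_ex)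
  have "alt N (alt (Suc N) v0) = ee (Suc n) (ee N (alt n (alt (Suc n) v0)))"
    unfolding N using N by (simp add: alt_comm)
  also have "\<dots> = cs (Suc n) *s alt n (ee (Suc n) (ee N v0))"
    using alt_alt_v0[of n] N by (simp add: alt_comm ee_scale)
  finally show ?thesis by (simp add: N)
qed

lemma alt_N_v0: "alt N v0 = alt (N - 2) (ee (N - 1) v0)"
proof -
  obtain n where N: "N = Suc (Suc n)" using N2 by (auto simp: numeral_2_eq_2 dest!: le_Suc_ex)
  then show ?thesis using alt_comm[of n "Suc n" v0] by simp
qed

text \<open>The quotient relation controls the boundary defect only after an alternating product.
  That product need not be injective, but on this defect it can be undone one index at a
  time.\<close>

lemma alt_cancel:
  assumes "m \<le> N - 2" "alt m (ee (N - 1) (ee N v0 - c *s v0)) = 0"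
  shows "ee (N - 1) (ee N v0 - c *s v0) = 0"
proof -
  define F where "F v = ee (N - 1) (ee N v - c *s v)" for v
  have F_comm: "alt n (F v) = F (alt n v)" if "n \<le> N - 2" for n v
    using that N2 by (simp add: F_def alt_comm alt.diff alt_scale del: One_nat_def)
  have F_scale: "F (d *s v) = d *s F v" for d v
    by (simp add: F_def ee_scale ee.diff scale_right_diff_distrib mult.commute)
  have "alt m (F v0) = 0 \<Longrightarrow> F v0 = 0" using assms(1)
  proof (induction m)
    case (Suc m)
    \<comment> \<open>F commutes with both products, so applying \<open>alt m\<close> to
      \<open>alt (Suc m) (F v0) = 0\<close> leaves a nonzero multiple of
      \<open>alt m (F v0)\<close>.\<close>
    have "cs (Suc m) *s alt m (F v0) = F (alt m (alt (Suc m) v0))"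
      using Suc.prems N2 by (simp add: F_comm alt_alt_v0 F_scale)
    also have "\<dots> = alt m (alt (Suc m) (F v0))"
      using F_comm[of m "alt (Suc m) v0"] F_comm[of "Suc m" v0] Suc.prems(2) by simp
    also have "\<dots> = 0"
      using Suc.prems by (simp add: alt.zero)
    finally show ?case using Suc by simp
  qed simp
  with assms(2) show ?thesis by (simp add: F_def)
qed

lemma boundary_from_quotient:
  assumes "alt N (alt (Suc N) (alt N v0)) = b_param N \<eta> \<omega>1 \<omega>2 \<theta> *s alt N v0"
  shows "ee (N - 1) (ee N v0) = kk uN *s ee (N - 1) v0"
proof -
  have "alt N (alt (Suc N) (alt N v0)) = (cs N * cs (N - 1)) *s alt (N - 2) (ee (N - 1) (ee N v0))"
    using N2 by (simp add: alt_Suc_alt_v0 alt_scale alt_N_alt_v0 del: One_nat_def)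
  then have "(cs N * cs (N - 1)) *s alt (N - 2) (ee (N - 1) (ee N v0)) =
      (cs N * cs (N - 1)) *s kk uN *s alt (N - 2) (ee (N - 1) v0)"
    unfolding assms b_param_kk by (simp add: alt_N_v0)
  then have "alt (N - 2) (ee (N - 1) (ee N v0)) = kk uN *s alt (N - 2) (ee (N - 1) v0)"
    by (rule scale_left_imp_eq[rotated]) simp
  then have "alt (N - 2) (ee (N - 1) (ee N v0 - kk uN *s v0)) = 0"
    by (simp add: alt.diff ee.diff alt_scale ee_scale)
  then show ?thesis
    using alt_cancel[of "N - 2" "kk uN"] by (simp add: ee.diff ee_scale)
qed

end

text \<open>The boundary analogue of the vacuum relation: in both, the scalar is the coefficient of
  the tile that fits on the fundamental path, see \<open>cc_par_fund\<close>.\<close>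

locale tbtl_full_vacuum = tbtl_vacuum N \<eta> \<omega>1 \<omega>2 \<theta> scale ee v0
  for N :: nat and \<eta> \<omega>1 \<omega>2 \<theta> :: complex
    and scale :: "complex \<Rightarrow> 'v::ab_group_add \<Rightarrow> 'v" (infixr \<open>*s\<close> 75)
    and ee :: "nat \<Rightarrow> 'v \<Rightarrow> 'v" and v0 :: 'v +
  assumes ee_N_v0: "ee (N - 1) (ee N v0) = kk uN *s ee (N - 1) v0"
begin

lemma quotient_v0:
  "alt N (alt (Suc N) (alt N v0)) = b_param N \<eta> \<omega>1 \<omega>2 \<theta> *s alt N v0"
  "alt (Suc N) (alt N (alt (Suc N) v0)) = b_param N \<eta> \<omega>1 \<omega>2 \<theta> *s alt (Suc N) v0"
proof -
  have *: "alt N (alt (Suc N) v0) = (cs (N - 1) * kk uN) *s alt N v0"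
    by (simp add: alt_N_alt_v0 ee_N_v0 alt_scale alt_N_v0 del: One_nat_def)
  then show "alt N (alt (Suc N) (alt N v0)) = b_param N \<eta> \<omega>1 \<omega>2 \<theta> *s alt N v0"
    using N2 by (simp add: alt_Suc_alt_v0 alt_scale b_param_kk)
  show "alt (Suc N) (alt N (alt (Suc N) v0)) = b_param N \<eta> \<omega>1 \<omega>2 \<theta> *s alt (Suc N) v0"
    using N2 unfolding * by (simp add: alt_Suc_alt_v0 alt_scale b_param_kk mult_ac)
qed

end

section \<open>The path basis in a module\<close>

context tbtl_params
begin

lemma par_fund: "1 \<le> i \<Longrightarrow> i \<le> N \<Longrightarrow> par (fund_path N) i = (if odd i then \<omega>1 else - \<omega>1 - 1)"
  by (cases i) (auto simp: par_def fund_path_nth sg_def)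

lemma qn_shift_nonzero:
  assumes "d = 1 \<or> d = - 1"
  shows "qn (of_int d * (\<omega>1 - of_int a) + of_int m) \<noteq> 0"
  using assms
proof
  assume "d = 1"
  then show ?thesis using qn_\<omega>1_minus[of "a - m"] by (simp add: algebra_simps)
next
  assume "d = - 1"
  moreover have "qn (- (\<omega>1 - of_int (a + m))) \<noteq> 0"
    using qn_\<omega>1_minus[of "a + m"] unfolding qnum_uminus by simp
  ultimately show ?thesis by (simp add: algebra_simps)
qed

lemma qn_nonzero:
  assumes "d = 1 \<or> d = - 1"
  shows "qn (of_int d * (\<omega>1 - of_int a)) \<noteq> 0"
    "qn (of_int d * (\<omega>1 - of_int a) + 1) \<noteq> 0"
    "qn (of_int d * (\<omega>1 - of_int a) - 1) \<noteq> 0"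
  using qn_shift_nonzero[OF assms, of a 0] qn_shift_nonzero[OF assms, of a 1] qn_shift_nonzero[OF assms, of a "- 1"]
  by simp_all

lemma qn_par: "qn (par h i) \<noteq> 0"
  using sg_cases[of "h ! (i - 1)"] unfolding par_def by (intro qn_nonzero) auto

lemma shift_minus:
  assumes "d = 1 \<or> d = - 1"
  shows "complex_of_int d * (\<omega>1 - of_int (a + d)) = of_int d * (\<omega>1 - of_int a) - 1"
    "complex_of_int d * (\<omega>1 - of_int (a - d)) = of_int d * (\<omega>1 - of_int a) + 1"
  using assms by (auto simp: algebra_simps)

end

section \<open>One added tile and its interaction with the generators\<close>

context tbtl_module
begin

lemma cc_par_fund: "1 \<le> i \<Longrightarrow> i \<le> N \<Longrightarrow> cc i (par (fund_path N) i) = (if i < N then ss i else kk uN)"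
proof -
  assume i: "1 \<le> i" "i \<le> N"
  then consider "i < N" | "i = N" by linarith
  then show ?thesis
    unfolding cc_def uN_def par_fund[OF i] using rr_\<omega>1 by cases (auto simp: ss_even ss_odd)
qed

definition XX :: "nat \<Rightarrow> complex \<Rightarrow> 'v \<Rightarrow> 'v" where
  "XX i u v = ee i v - cc i u *s v"

lemma ee_XX_far: "i + 1 < j \<or> j + 1 < i \<Longrightarrow> i \<le> N \<Longrightarrow> j \<le> N \<Longrightarrow> ee i (XX j u v) = XX j u (ee i v)"
  using ee_comm[of i j v] ee_comm[of j i v] by (auto simp: XX_def ee.diff ee_scale)

lemma XX_commute: "i + 1 < j \<or> j + 1 < i \<Longrightarrow> i \<le> N \<Longrightarrow> j \<le> N \<Longrightarrow> XX i u (XX j u' v) = XX j u' (XX i u v)"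
  using ee_XX_far[of i j u' v] by (simp add: XX_def ee.diff ee_scale algebra_simps)

text \<open>The coefficients at u and -u add up to the scalar of e_i^2, that is \<delta> or s_2, so
  subtracting one of them leaves the other.\<close>

lemma ee_XX_same:
  assumes "1 \<le> i" "i \<le> N" "qn u \<noteq> 0"
  shows "ee i (XX i u v) = cc i (- u) *s ee i v"
proof -
  have *: "cc i (- u) = (if i < N then dlt else sR) - cc i u"
    using rr_sum[OF assms(3)] kk_sum[OF assms(3)] unfolding cc_def
    by (simp add: eq_diff_eq add.commute)
  show ?thesis
    using assms ee_sq_N unfolding *
    by (cases "i = N") (auto simp: XX_def ee.diff ee_scale ee_sq scale_left_diff_distrib)
qed

text \<open>Two stacked tiles: the term with e_j w drops out, and e_i e_j e_i w = e_i w cancels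
  against r(u - 1) r(-u) e_i w by unitarity.\<close>

lemma triple_XX_interior:
  assumes i: "1 \<le> i" "i < N" and j: "j = i + 1 \<and> j < N \<or> i = j + 1 \<and> 1 \<le> j"
    and w: "ee j w = 0" and u: "qn u \<noteq> 0" "qn (u - 1) \<noteq> 0"
  shows "ee i (XX j (u - 1) (XX i u w)) = 0"
proof -
  have "j < N" using i j by auto
  have "ee i (ee j (ee i w)) = ee i w"
    using j ee_up[OF i] ee_down[OF i] by auto
  then have "ee i (XX j (u - 1) (XX i u w)) = ee i w - rr (u - 1) *s ee i (XX i u w)"
    using w \<open>j < N\<close> by (simp add: XX_def[of j] cc_def ee.diff ee_scale) (simp add: XX_def ee.diff ee_scale ee.zero)
  also have "\<dots> = (1 - rr (- u) * rr (u - 1)) *s ee i w"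
    using i ee_XX_same[of i u w] u by (simp add: cc_def scale_left_diff_distrib mult.commute)
  finally show ?thesis using rr_unit[OF u] by simp
qed

text \<open>There is no slope at N that would make e_N w vanish. The hypothesis records the value of
  e_{N-1} e_N w instead, and the reflection relation takes the place of unitarity.\<close>

lemma triple_XX_boundary:
  assumes w: "ee (N - 1) (ee N w) = kk (- u - 1) *s ee (N - 1) w"
    and u: "qn u \<noteq> 0" "qn (u - 1) \<noteq> 0" "qn (u + 1) \<noteq> 0"
  shows "ee (N - 1) (XX N (u - 1) (XX (N - 1) u w)) = 0"
proof -
  have N: "1 \<le> N - 1" "N - 1 < N" "N - 1 + 1 = N" using N2 by auto
  let ?i = "N - 1"
  have "ee ?i (ee N (ee ?i w)) = ee ?i w"
    using ee_up[OF N(1,2)] unfolding N(3) .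
  then have "ee ?i (XX N (u - 1) (XX ?i u w)) =
      ee ?i w - rr u *s kk (- u - 1) *s ee ?i w - kk (u - 1) *s ee ?i (XX ?i u w)"
    using w N2 by (simp add: XX_def[of N] cc_def ee.diff ee_scale del: One_nat_def)
      (simp add: XX_def cc_def ee.diff ee_scale)
  also have "\<dots> = (1 - (rr (- u) * kk (u - 1) + rr u * kk (- u - 1))) *s ee ?i w"
    using N ee_XX_same[of ?i u w] u(1)
    by (simp add: cc_def scale_left_diff_distrib scale_left_distrib mult.commute del: One_nat_def)
  finally show ?thesis using kk_reflection[OF u] by simp
qed

end

lemma not_removable_fund: "\<not> removable N (fund_path N) i"
  by (auto simp: removable_def extremal_def fund_path_nth sg_def)

lemma not_slope_fund: "\<not> slope N (fund_path N) i"
  by (auto simp: slope_def fund_path_nth)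

lemma removable_not_addable: "removable N h i \<Longrightarrow> \<not> addable N h i"
  by (auto simp: removable_def addable_def sg_def split: if_splits)

lemma extremal_cases:
  assumes "h \<in> paths N" "extremal N h i"
  shows "addable N h i \<or> removable N h i"
  using path_step'[OF assms(1), of i] assms(2)
  by (auto simp: addable_def removable_def extremal_def sg_def simp del: One_nat_def)

section \<open>Path vectors and the slope rule\<close>

context tbtl_full_vacuum
begin

inductive Bv :: "int list \<Rightarrow> 'v \<Rightarrow> bool" where
  Bv_fund: "Bv (fund_path N) v0"
| Bv_add: "Bv h v \<Longrightarrow> addable N h i \<Longrightarrow> Bv (flip i h) (XX i (par h i) v)"

lemma Bv_path: "Bv h v \<Longrightarrow> h \<in> paths N"
  by (induction rule: Bv.induct) (auto simp: fund_path_in_paths flip_in_paths addable_def)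

lemma par_flip: "extremal N h i \<Longrightarrow> length h = N + 1 \<Longrightarrow> par (flip i h) i = par h i"
  by (simp add: par_def flip_nth_near del: One_nat_def)

lemma par_flip_far: "i + 1 < j \<or> j + 1 < i \<Longrightarrow> j \<le> N \<Longrightarrow> length h = N + 1 \<Longrightarrow> par (flip j h) i = par h i"
  by (auto simp: par_def nth_flip)

text \<open>Any removable tile may be taken as the last one added, since removable tiles are never
  adjacent and their operators commute. Uniqueness of path vectors rests on this and not on linear
  independence.\<close>

lemma Bv_remove:
  "Bv h v \<Longrightarrow> removable N h i \<Longrightarrow> \<exists>w. Bv (flip i h) w \<and> v = XX i (par h i) w"
proof (induction arbitrary: i rule: Bv.induct)
  case Bv_fund
  then show ?case by (simp add: not_removable_fund)
next
  case (Bv_add h v j)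
  have h: "length h = N + 1" using Bv_path[OF Bv_add.hyps(1)] by (rule path_length)
  have ij: "1 \<le> i" "i \<le> N" "1 \<le> j" "j \<le> N" and ext: "extremal N h j"
    using Bv_add by (auto simp: removable_def addable_def extremal_def)
  have rem: "removable N (flip j h) j"
    using Bv_add.hyps h by (simp add: removable_flip)
  show ?case
  proof (cases "i = j")
    case True
    then show ?thesis using Bv_add.hyps ij ext h by (auto simp: flip_flip par_flip)
  next
    case False
    then have far: "i + 1 < j \<or> j + 1 < i"
      using removable_far[OF Bv_add.prems rem] by blast
    then have far': "j + 1 < i \<or> i + 1 < j" by blast
    have "removable N h i"
      using Bv_add.prems removable_flip_far[OF far h ij(4)] by simp
    then obtain w where w: "Bv (flip i h) w" "v = XX i (par h i) w"
      using Bv_add.IH by blast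
    have "addable N (flip i h) j"
    proof -
      have "removable N (flip i (flip j h)) j"
        using rem removable_flip_far[OF far' _ ij(2), of "flip j h"] h by simp
      then have "addable N (flip j (flip i (flip j h))) j"
        by (rule addable_flip) (simp add: h)
      then show ?thesis
        using ij by (simp add: flip_commute[OF far'] flip_flip)
    qed
    then have "Bv (flip j (flip i h)) (XX j (par (flip i h) j) w)"
      by (rule Bv.Bv_add[OF w(1)])
    moreover have "par (flip i h) j = par h j" "par (flip j h) i = par h i"
      using far far' ij h par_flip_far by blast+
    moreover have "XX j (par h j) v = XX i (par h i) (XX j (par h j) w)"
      unfolding w(2) using far' ij by (intro XX_commute)
    ultimately show ?thesis
      using flip_commute[OF far] by auto
  qed
qed

lemma Bv_fund_unique: "Bv (fund_path N) v \<Longrightarrow> v = v0"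
proof -
  have "Bv h v \<Longrightarrow> h = fund_path N \<Longrightarrow> v = v0" for h
    by (erule Bv.cases) (metis not_removable_fund removable_flip path_length Bv_path)+
  then show "Bv (fund_path N) v \<Longrightarrow> v = v0" by blast
qed

lemma Bv_ex1: "h \<in> paths N \<Longrightarrow> \<exists>!v. Bv h v"
proof (induction h rule: area_less_induct)
  case (less h)
  show ?case
  proof (cases "h = fund_path N")
    case True
    then show ?thesis using Bv_fund Bv_fund_unique by blast
  next
    case False
    then obtain i where i: "removable N h i"
      using ex_removable less by blast
    have len: "length h = N + 1" using less(1) by (rule path_length)
    have flip: "flip i h \<in> paths N"
      using i less(1) by (auto simp: removable_def intro: flip_in_paths)
    have "\<exists>!w. Bv (flip i h) w"
      using less(2)[OF flip area_remove[OF i len]] .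
    then obtain w where w: "Bv (flip i h) w" "\<And>w'. Bv (flip i h) w' \<Longrightarrow> w' = w"
      by blast
    have "Bv (flip i (flip i h)) (XX i (par (flip i h) i) w)"
      using w(1) addable_flip[OF i len] by (rule Bv_add)
    then have "Bv h (XX i (par (flip i h) i) w)"
      using i by (simp add: flip_flip removable_def extremal_def)
    moreover have "v = v'" if "Bv h v" "Bv h v'" for v v'
      using Bv_remove[OF that(1) i] Bv_remove[OF that(2) i] w(2) by blast
    ultimately show ?thesis by blast
  qed
qed

definition bv :: "int list \<Rightarrow> 'v" where
  "bv h = (THE v. Bv h v)"

lemma Bv_bv: "h \<in> paths N \<Longrightarrow> Bv h (bv h)"
  unfolding bv_def by (rule theI') (rule Bv_ex1)

lemma Bv_eq_bv: "Bv h v \<Longrightarrow> v = bv h"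
  using Bv_ex1 Bv_bv Bv_path by blast

lemma bv_fund: "bv (fund_path N) = v0"
  using Bv_eq_bv[OF Bv_fund] by simp

lemma bv_add: "h \<in> paths N \<Longrightarrow> addable N h i \<Longrightarrow> bv (flip i h) = XX i (par h i) (bv h)"
  using Bv_eq_bv[OF Bv_add[OF Bv_bv]] by metis

lemma bv_remove:
  assumes "h \<in> paths N" "removable N h i"
  shows "bv h = XX i (par h i) (bv (flip i h))"
  using Bv_remove[OF Bv_bv[OF assms(1)] assms(2)] Bv_eq_bv by metis

text \<open>The tile coefficient is exactly the scalar of the vacuum relation, or of the boundary
  relation for i = N. The case i = 1 is the one in which e_0 kills a path starting upward.\<close>

lemma fund_below:
  assumes "1 \<le> i" "i \<le> N"
  shows "ee (i - 1) (XX i (par (fund_path N) i) v0) = 0"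
proof (cases "i = N")
  case True
  have "cc N (par (fund_path N) N) = kk uN"
    using N2 by (simp add: cc_par_fund)
  then show ?thesis
    using True ee_N_v0 by (simp add: XX_def ee.diff ee_scale del: One_nat_def)
next
  case False
  then have "cc i (par (fund_path N) i) = ss i"
    using assms by (simp add: cc_par_fund)
  then show ?thesis
    using assms False ee_ee_v0[of i] by (simp add: XX_def ee.diff ee_scale del: One_nat_def)
qed

lemma fund_above:
  assumes "1 \<le> i" "i + 1 < N"
  shows "ee (i + 1) (XX i (par (fund_path N) i) v0) = 0"
proof -
  have "cc i (par (fund_path N) i) = ss i"
    using assms by (simp add: cc_par_fund)
  then show ?thesis
    using assms ee_ee_v0'[of "i + 1"] by (simp add: XX_def ee.diff ee_scale)
qed

text \<open>Another removable tile left after the removal would be far from j, hence removable in h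
  already.\<close>

lemma flip_fund_eqI:
  assumes h: "h \<in> paths N" and j: "removable N h j"
    and only: "\<And>l. removable N h l \<Longrightarrow> l = j"
    and near: "\<not> removable N (flip j h) (j - 1)" "\<not> removable N (flip j h) (j + 1)"
  shows "flip j h = fund_path N"
proof (rule ccontr)
  assume ne: "flip j h \<noteq> fund_path N"
  have len: "length h = N + 1" using h by (rule path_length)
  have jj: "1 \<le> j" "j \<le> N" using j by (auto simp: removable_def extremal_def)
  have "flip j h \<in> paths N"
    using h j by (auto simp: removable_def intro: flip_in_paths)
  then obtain l where l: "removable N (flip j h) l"
    using ex_removable ne by blast
  have "l \<noteq> j"
    using l addable_flip[OF j len] removable_not_addable by blast
  moreover have "l \<noteq> j - 1" "l \<noteq> j + 1"
    using l near by blast+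
  ultimately have far: "l + 1 < j \<or> j + 1 < l" by linarith
  then have "removable N h l"
    using l removable_flip_far[OF far len jj(2)] by blast
  then show False using only \<open>l \<noteq> j\<close> by blast
qed

text \<open>The heights at i - 1, i, i + 1 are a, a + d, a + 2d. Removing the tile at i + 1 exposes
  one at i, unless the path crosses -1/2 between i - 1 and i; then only one tile lies on the
  fundamental path.\<close>

lemma slope_zero_right:
  assumes h: "h \<in> paths N" and slope: "slope N h i" and rem: "removable N h (i + 1)"
    and near: "\<And>l. removable N h l \<Longrightarrow> l = i - 1 \<or> l = i + 1"
    and IH: "\<And>h' i. h' \<in> paths N \<Longrightarrow> area h' < area h \<Longrightarrow> slope N h' i \<Longrightarrow> ee i (bv h') = 0"
  shows "ee i (bv h) = 0"
proof -
  have len: "length h = N + 1" using h by (rule path_length)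
  have i: "1 \<le> i" "i < N" using slope by (auto simp: slope_def)
  define a where "a = h ! (i - 1)"
  define d where "d = h ! i - a"
  have d: "d = 1 \<or> d = - 1"
    using path_step'[OF h, of i] i unfolding d_def a_def by auto
  have hi: "h ! i = a + d" by (simp add: d_def)
  have hi1: "h ! (i + 1) = a + 2 * d"
    using path_step[OF h i(2)] slope hi d unfolding slope_def a_def by auto
  have sgi: "sg (a + d) = d"
    using rem hi hi1 by (simp add: removable_def)
  define g where "g = flip (i + 1) h"
  have rem_ext: "extremal N h (i + 1)" using rem by (simp add: removable_def)
  then have hi2: "i + 1 < N \<Longrightarrow> h ! (i + 2) = a + d"
    using hi by (simp add: extremal_def)
  have g: "g \<in> paths N"
    unfolding g_def using h rem_ext by (rule flip_in_paths)
  then have leng: "length g = N + 1" by (rule path_length)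
  have gn: "g ! j = (if j = i + 1 then a else h ! j)" for j
    unfolding g_def using i hi hi1 len by (simp add: nth_flip)
  have gn_prev: "g ! (i - 1) = a"
    using gn[of "i - 1"] i by (auto simp: a_def)
  have bh: "bv h = XX (i + 1) (par h (i + 1)) (bv g)"
    unfolding g_def using h rem by (rule bv_remove)
  have area_g: "area g < area h"
    unfolding g_def using rem len by (rule area_remove)
  show ?thesis
  proof (cases "sg a = d")
    case True
    \<comment> \<open>The parameter of the inner tile at i; the outer tile at i + 1 has u - 1, the
      shift required by the triple relations.\<close>
    define u where "u = of_int d * (\<omega>1 - of_int a)"
    note qnu = qn_nonzero[OF d, of a, folded u_def]
    have par_h: "par h (i + 1) = u - 1"
      unfolding par_def u_def using shift_minus(1)[OF d, of a] by (simp add: hi sgi)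
    have rem_g: "removable N g i"
      using i hi True gn[of i] gn[of "i + 1"] gn_prev
      by (simp add: removable_def extremal_def del: One_nat_def)
    define f where "f = flip i g"
    have f: "f \<in> paths N"
      unfolding f_def using g rem_g by (auto simp: removable_def intro: flip_in_paths)
    then have lenf: "length f = N + 1" by (rule path_length)
    have fn: "f ! j = (if j = i then a - d else if j = i + 1 then a else h ! j)" for j
      unfolding f_def using i hi leng gn[of j] gn[of i] gn[of "i - 1"]
      by (auto simp: nth_flip a_def)
    have area_f: "area f < area g"
      unfolding f_def using rem_g leng by (rule area_remove)
    have par_g: "par g i = u"
      using True gn_prev by (simp add: par_def u_def del: One_nat_def)
    have bg: "bv g = XX i u (bv f)"
      unfolding f_def using bv_remove[OF g rem_g] par_g by simp
    show ?thesis
    proof (cases "i + 1 < N")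
      case inner: True
      have "slope N f (i + 1)"
        using inner hi2 d fn[of i] fn[of "i + 2"] by (auto simp: slope_def)
      then have "ee (i + 1) (bv f) = 0"
        using IH[OF f] area_f area_g by simp
      then show ?thesis
        unfolding bh bg par_h using i inner qnu by (intro triple_XX_interior) auto
    next
      case False
      then have N: "N = i + 1" using i by auto
      have extf: "extremal N f N"
        using i by (simp add: extremal_def)
      \<comment> \<open>Every path is extremal at N, so the boundary hypothesis is obtained by
        flipping the last point of f: w has a slope at i = N - 1 and its vector is killed by
        induction.\<close>
      define w where "w = flip N f"
      have w: "w \<in> paths N"
        unfolding w_def using f extf by (rule flip_in_paths)
      have fN: "f ! N = a" "f ! (N - 1) = a - d" "f ! (i - 1) = a"
        using fn[of N] fn[of i] fn[of "i - 1"] i by (auto simp: N a_def)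
      have wn: "w ! N = a - 2 * d" "w ! (i - 1) = a"
        unfolding w_def using fN i lenf by (auto simp: N nth_flip)
      have slope_w: "slope N w i"
        using wn i d unfolding slope_def by (auto simp: N)
      have "ee i (ee N (bv f)) = kk (- u - 1) *s ee i (bv f)"
      proof (cases "sg (a - d) = d")
        case True
        have rem_f: "removable N f N"
          using extf fN True by (simp add: removable_def)
        have "area w < area f"
          unfolding w_def using rem_f lenf by (rule area_remove)
        then have z: "ee i (bv w) = 0"
          using IH[OF w _ slope_w] area_f area_g by simp
        have "par f N = u + 1"
          using True shift_minus(2)[OF d, of a] by (simp add: par_def fN u_def del: One_nat_def)
        then have bf: "bv f = XX N (u + 1) (bv w)"
          unfolding w_def using bv_remove[OF f rem_f] by simp
        have "ee N (bv f) = cc N (- (u + 1)) *s ee N (bv w)"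
          unfolding bf using N2 qnu by (intro ee_XX_same) auto
        moreover have "ee i (bv f) = ee i (ee N (bv w))"
          unfolding bf XX_def using z by (simp add: ee.diff ee_scale)
        ultimately show ?thesis by (simp add: ee_scale cc_def)
      next
        case False
        then have sgf: "sg (a - d) = - d"
          using d sg_cases[of "a - d"] by auto
        have add_f: "addable N f N"
          using extf fN sgf by (simp add: addable_def)
        have exc: "a = 0 \<and> d = 1 \<or> a = - 1 \<and> d = - 1"
          using sgf True d by (auto simp: sg_def split: if_splits)
        have "area g = area h - \<bar>2 * (a + 2 * d) + 1\<bar> + \<bar>2 * a + 1\<bar>"
          unfolding g_def using i len hi hi1 by (simp add: area_flip)
        moreover have "area f = area g - \<bar>2 * (a + d) + 1\<bar> + \<bar>2 * (a - d) + 1\<bar>"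
          unfolding f_def using i leng hi gn[of i] gn[of "i - 1"]
          by (simp add: area_flip a_def del: One_nat_def)
        moreover have "area w = area f - \<bar>2 * a + 1\<bar> + \<bar>2 * (a - 2 * d) + 1\<bar>"
          unfolding w_def using i lenf fN by (simp add: area_flip del: One_nat_def)
        \<comment> \<open>Here w has a half-tile more than f but is still smaller than h: the last
          heights are 0, -1, -2 against 0, 1, 2, or -1, 0, 1 against -1, -2, -3.\<close>
        ultimately have "area w < area h" using exc by auto
        then have z: "ee i (bv w) = 0"
          using IH[OF w _ slope_w] by simp
        have "par f N = - u - 1"
          using sgf shift_minus(2)[OF d, of a] by (simp add: par_def fN u_def del: One_nat_def)
        then have "bv w = XX N (- u - 1) (bv f)"
          unfolding w_def using bv_add[OF f add_f] by simp
        then show ?thesis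
          using z by (simp add: XX_def ee.diff ee_scale cc_def)
      qed
      then show ?thesis
        unfolding bh bg par_h using triple_XX_boundary[of "bv f" u] qnu by (simp add: N)
    qed
  next
    case False
    have "flip (i + 1) h = fund_path N"
    proof (rule flip_fund_eqI[OF h rem])
      fix l assume l: "removable N h l"
      then consider "l = i - 1" | "l = i + 1" using near by blast
      then show "l = i + 1"
      proof cases
        case 1
        then have "h ! (i - 1) = h ! (i - 2) + sg (h ! (i - 2))" "h ! (i - 2) = h ! i"
          using l i by (auto simp: removable_def extremal_def numeral_2_eq_2)
        then show ?thesis using hi sgi d by (auto simp: a_def)
      qed
    next
      show "\<not> removable N (flip (i + 1) h) (i + 1 - 1)"
        using False hi gn[of i] gn[of "i - 1"] unfolding g_def[symmetric]
        by (auto simp: removable_def a_def)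
      show "\<not> removable N (flip (i + 1) h) (i + 1 + 1)"
      proof
        assume r: "removable N (flip (i + 1) h) (i + 1 + 1)"
        then have "i + 1 < N" by (auto simp: removable_def extremal_def)
        then show False
          using r False hi2 gn[of "i + 1"] gn[of "i + 2"] unfolding g_def[symmetric]
          by (auto simp: removable_def)
      qed
    qed
    then have bg: "bv g = v0" and gf: "g = fund_path N"
      by (simp_all add: g_def bv_fund)
    have "par h (i + 1) = par g (i + 1)"
      unfolding g_def using rem_ext len by (rule par_flip[symmetric])
    then show ?thesis
      unfolding bh bg gf using i fund_below[of "i + 1"] by (simp add: bv_fund)
  qed
qed

text \<open>Mirror image of \<open>slope_zero_right\<close>: the outer tile sits at i - 1 and the
  exposed one at i. As i < N both are full tiles, and unitarity suffices.\<close>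

lemma slope_zero_left:
  assumes h: "h \<in> paths N" and slope: "slope N h i" and rem: "removable N h (i - 1)"
    and near: "\<And>l. removable N h l \<Longrightarrow> l = i - 1 \<or> l = i + 1"
    and IH: "\<And>h' i. h' \<in> paths N \<Longrightarrow> area h' < area h \<Longrightarrow> slope N h' i \<Longrightarrow> ee i (bv h') = 0"
  shows "ee i (bv h) = 0"
proof -
  have len: "length h = N + 1" using h by (rule path_length)
  have rem_ext: "extremal N h (i - 1)" using rem by (simp add: removable_def)
  then obtain j where ij: "i = j + 1" "1 \<le> j" by (cases i) (auto simp: extremal_def)
  have i: "j + 1 < N" using slope ij by (auto simp: slope_def)
  define a where "a = h ! (j - 1)"
  define d where "d = - sg a"
  have d: "d = 1 \<or> d = - 1" and sga: "sg a = - d"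
    using sg_cases[of a] by (auto simp: d_def)
  have hj: "h ! j = a - d" and hj1: "h ! (j + 1) = a"
    using rem i ij by (auto simp: removable_def extremal_def a_def d_def)
  have hj2: "h ! (j + 2) = a + d"
    using path_step[OF h, of "j + 1"] i slope ij hj hj1 d unfolding slope_def by auto
  define g where "g = flip j h"
  have g: "g \<in> paths N"
    unfolding g_def using h rem_ext ij by (intro flip_in_paths) simp_all
  then have leng: "length g = N + 1" by (rule path_length)
  have gn: "g ! l = (if l = j then a + d else h ! l)" for l
    unfolding g_def using i hj len by (simp add: nth_flip a_def)
  have gn_prev: "g ! (j - 1) = a"
    using gn[of "j - 1"] ij(2) by (cases j) (auto simp: a_def)
  have bh: "bv h = XX j (par h j) (bv g)"
    unfolding g_def using bv_remove[OF h rem] ij by simp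
  have area_g: "area g < area h"
    unfolding g_def using area_remove[OF rem len] ij by simp
  show ?thesis
  proof (cases "sg (a + d) = - d")
    case True
    \<comment> \<open>The inner tile at i has base height a + d on the side -d; the outer tile at i
      - 1 again has parameter u - 1.\<close>
    define u where "u = of_int (- d) * (\<omega>1 - of_int (a + d))"
    have d': "- d = 1 \<or> - d = - 1" using d by auto
    note qnu = qn_nonzero[OF d', of "a + d", folded u_def]
    have par_h: "par h j = u - 1"
      using shift_minus(1)[OF d', of "a + d"] by (simp add: par_def a_def[symmetric] sga u_def del: One_nat_def)
    have rem_g: "removable N g i"
      using ij i True hj1 hj2 gn[of j] gn[of "j + 1"] gn[of "j + 2"]
      by (simp add: removable_def extremal_def)
    define f where "f = flip i g"
    have f: "f \<in> paths N"
      unfolding f_def using g rem_g by (auto simp: removable_def intro: flip_in_paths)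
    then have lenf: "length f = N + 1" by (rule path_length)
    have area_f: "area f < area g"
      unfolding f_def using rem_g leng by (rule area_remove)
    have fn: "f ! (j - 1) = a" "f ! (j + 1) = a + 2 * d"
      unfolding f_def using i ij hj1 gn[of j] gn[of "j + 1"] gn[of "j - 1"] leng
      by (auto simp: nth_flip a_def)
    have "slope N f j"
      using i ij fn d by (auto simp: slope_def)
    then have z: "ee j (bv f) = 0"
      using IH[OF f] area_f area_g by simp
    have "par g i = u"
      using ij True gn[of j] by (simp add: par_def u_def)
    then have bg: "bv g = XX i u (bv f)"
      unfolding f_def using bv_remove[OF g rem_g] by simp
    show ?thesis
      unfolding bh bg par_h using i ij z qnu by (intro triple_XX_interior) auto
  next
    case False
    then have sgd: "sg (a + d) = d"
      using d sg_cases[of "a + d"] by auto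
    have "flip j h = fund_path N"
    proof (rule flip_fund_eqI[OF h])
      show "removable N h j" using rem ij by simp
    next
      fix l assume l: "removable N h l"
      then consider "l = j" | "l = i + 1" using near ij by auto
      then show "l = j"
      proof cases
        case 2
        then have "h ! (j + 2) = h ! (j + 1) + sg (h ! (j + 1))"
          using l ij by (simp add: removable_def)
        then show ?thesis using hj1 hj2 sga d by auto
      qed
    next
      show "\<not> removable N (flip j h) (j + 1)"
        using sgd d hj1 gn[of j] gn[of "j + 1"] unfolding g_def[symmetric]
        by (auto simp: removable_def)
      show "\<not> removable N (flip j h) (j - 1)"
      proof
        assume "removable N (flip j h) (j - 1)"
        then have "1 \<le> j - 1" "g ! (j - 1) = g ! (j - 1 - 1) + sg (g ! (j - 1 - 1))" "g ! (j - 1 - 1) = g ! j"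
          using i unfolding g_def[symmetric] removable_def extremal_def by auto
        then show False
          using sgd d gn[of j] gn_prev by auto
      qed
    qed
    then have bg: "bv g = v0" and gf: "g = fund_path N"
      by (simp_all add: g_def bv_fund)
    have "par h j = par g j"
      unfolding g_def using rem_ext len ij par_flip by simp
    then show ?thesis
      unfolding bh bg gf using i ij fund_above[of j] by (simp add: bv_fund)
  qed
qed

lemma slope_zero: "h \<in> paths N \<Longrightarrow> slope N h i \<Longrightarrow> ee i (bv h) = 0"
proof (induction h arbitrary: i rule: area_less_induct)
  case (less h)
  have h: "h \<in> paths N" by fact
  have len: "length h = N + 1" using h by (rule path_length)
  have i: "i \<le> N" using less.prems by (simp add: slope_def)
  obtain j where j: "removable N h j"
    using ex_removable[OF h] less.prems not_slope_fund by blast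
  show ?case
  proof (cases "\<exists>j. removable N h j \<and> (i + 1 < j \<or> j + 1 < i)")
    case True
    then obtain j where j: "removable N h j" and far: "i + 1 < j \<or> j + 1 < i" by blast
    have jN: "j \<le> N" and ext: "extremal N h j" using j by (auto simp: removable_def extremal_def)
    have "ee i (bv (flip j h)) = 0"
      using flip_in_paths[OF h ext] area_remove[OF j len] less.prems slope_flip_far[OF far len jN]
      by (intro less(2)) auto
    then show ?thesis
      unfolding bv_remove[OF h j] using far i jN by (simp add: ee_XX_far) (simp add: XX_def ee.zero)
  next
    case False
    have near: "l = i - 1 \<or> l = i + 1" if "removable N h l" for l
    proof -
      have "l \<noteq> i" using that less.prems not_slope_removable by blast
      moreover have "\<not> (i + 1 < l \<or> l + 1 < i)" using that False by blast
      ultimately show ?thesis by linarith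
    qed
    show ?thesis
      using near[OF j] j slope_zero_left[OF h less.prems _ near less(2)]
        slope_zero_right[OF h less.prems _ near less(2)] by auto
  qed
qed

text \<open>Tiles away from point 1 commute with e_0. If the only removable tile sits at 1, the path
  is the fundamental one with that tile, and \<open>fund_below\<close> gives 0.\<close>

lemma ee_0_bv: "h \<in> paths N \<Longrightarrow> ee 0 (bv h) = (if h ! 1 = - 1 then sL else 0) *s bv h"
proof (induction h rule: area_less_induct)
  case (less h)
  have h: "h \<in> paths N" by fact
  have len: "length h = N + 1" using h by (rule path_length)
  show ?case
  proof (cases "h = fund_path N")
    case True
    then show ?thesis using N2 by (simp add: bv_fund ee_0_v0 fund_path_nth)
  next
    case False
    show ?thesis
    proof (cases "\<exists>j. removable N h j \<and> j \<noteq> 1")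
      case True
      then obtain j where j: "removable N h j" "j \<noteq> 1" by blast
      have jN: "1 < j" "j \<le> N" and ext: "extremal N h j" using j by (auto simp: removable_def extremal_def)
      have "ee 0 (bv (flip j h)) = (if flip j h ! 1 = - 1 then sL else 0) *s bv (flip j h)"
        using flip_in_paths[OF h ext] area_remove[OF j(1) len] by (intro less(2)) auto
      moreover have "flip j h ! 1 = h ! 1" using jN len by (simp add: nth_flip)
      ultimately show ?thesis
        unfolding bv_remove[OF h j(1)] using jN
        by (simp add: ee_XX_far) (simp add: XX_def ee_scale ee.zero scale_right_diff_distrib)
    next
      case only: False
      then have r1: "removable N h 1"
        using ex_removable[OF h \<open>h \<noteq> fund_path N\<close>] by blast
      have h0: "h ! 0 = 0" using h by (rule path_0)
      have h1: "h ! 1 = 1" "h ! 2 = 0"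
        using r1 h0 N2 by (auto simp: removable_def extremal_def sg_def numeral_2_eq_2)
      have "flip 1 h = fund_path N"
      proof (rule flip_fund_eqI[OF h r1])
        show "l = 1" if "removable N h l" for l using that only by blast
        show "\<not> removable N (flip 1 h) (1 - 1)" by (simp add: removable_def extremal_def)
        show "\<not> removable N (flip 1 h) (1 + 1)"
          using h0 h1 N2 len by (auto simp: removable_def nth_flip sg_def numeral_2_eq_2)
      qed
      then have "bv h = XX 1 (par h 1) v0" "par h 1 = par (fund_path N) 1"
        using bv_remove[OF h r1] par_flip[of h 1] r1 len by (auto simp: bv_fund removable_def)
      then show ?thesis
        using fund_below[of 1] h1 N2 by simp
    qed
  qed
qed

lemma ee_bv_addable:
  "h \<in> paths N \<Longrightarrow> addable N h i \<Longrightarrow> ee i (bv h) = bv (flip i h) + cc i (par h i) *s bv h"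
  by (simp add: bv_add XX_def)

lemma ee_bv_removable:
  assumes h: "h \<in> paths N" and rem: "removable N h i"
  shows "ee i (bv h) = cc i (- par h i) *s (bv h + cc i (par h i) *s bv (flip i h))"
proof -
  have len: "length h = N + 1" using h by (rule path_length)
  have ext: "extremal N h i" using rem by (simp add: removable_def)
  have "ee i (bv h) = cc i (- par h i) *s ee i (bv (flip i h))"
    unfolding bv_remove[OF h rem] using qn_par ext by (intro ee_XX_same) (auto simp: extremal_def)
  also have "ee i (bv (flip i h)) = bv h + cc i (par h i) *s bv (flip i h)"
    using ee_bv_addable[OF flip_in_paths[OF h ext] addable_flip[OF rem len]] ext len
    by (simp add: par_flip flip_flip extremal_def)
  finally show ?thesis .
qed

end

section \<open>Murphy elements\<close>

definition murphy_weight :: "complex \<Rightarrow> complex \<Rightarrow> nat \<Rightarrow> int list \<Rightarrow> complex" where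
  "murphy_weight \<eta> \<omega>1 n h = qpow \<eta> (\<omega>1 * of_int (h ! (n + 1) - h ! n)
     - of_int ((h ! (n + 1))\<^sup>2 - (h ! n)\<^sup>2) / 2 + (1 - 2 * of_nat n) / 2)"

text \<open>d^2 = 1 makes the quadratic exponent linear in a. The two forms treat a step leaving
  base height a and a step returning to it.\<close>

lemma murphy_weight_step:
  assumes "d * d = 1"
  shows "h ! n = a \<Longrightarrow> h ! (n + 1) = a + d \<Longrightarrow>
      murphy_weight \<eta> \<omega>1 n h = qpow \<eta> (of_int d * (\<omega>1 - of_int a) - of_nat n)"
    "h ! n = a + d \<Longrightarrow> h ! (n + 1) = a \<Longrightarrow>
      murphy_weight \<eta> \<omega>1 n h = qpow \<eta> (- of_int d * (\<omega>1 - of_int a) + 1 - of_nat n)"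
proof -
  have sq: "complex_of_int d * complex_of_int d = 1"
    using assms by (metis of_int_1 of_int_mult)
  {
    assume "h ! n = a" "h ! (n + 1) = a + d"
    then have "\<omega>1 * of_int (h ! (n + 1) - h ! n) - of_int ((h ! (n + 1))\<^sup>2 - (h ! n)\<^sup>2) / 2 + (1 - 2 * of_nat n) / 2
      = of_int d * (\<omega>1 - of_int a) - of_nat n + (1 - of_int d * of_int d) / 2"
      by (simp add: power2_eq_square field_simps)
    then show "murphy_weight \<eta> \<omega>1 n h = qpow \<eta> (of_int d * (\<omega>1 - of_int a) - of_nat n)"
      unfolding murphy_weight_def sq by simp
  next
    assume "h ! n = a + d" "h ! (n + 1) = a"
    then have "\<omega>1 * of_int (h ! (n + 1) - h ! n) - of_int ((h ! (n + 1))\<^sup>2 - (h ! n)\<^sup>2) / 2 + (1 - 2 * of_nat n) / 2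
      = - of_int d * (\<omega>1 - of_int a) + 1 - of_nat n + (of_int d * of_int d - 1) / 2"
      by (simp add: power2_eq_square field_simps)
    then show "murphy_weight \<eta> \<omega>1 n h = qpow \<eta> (- of_int d * (\<omega>1 - of_int a) + 1 - of_nat n)"
      unfolding murphy_weight_def sq by simp
  }
qed

section \<open>Scalars in the blocks of the Murphy elements\<close>

context generic_params
begin

lemma qn_mult_qdiff: "qn x * (qpow \<eta> 1 - qpow \<eta> (- 1)) = qpow \<eta> x - qpow \<eta> (- x)"
  using qdiff by (simp add: qnum_def)

text \<open>The diagonal entries of g_i = e_i - q^{-1}: subtracting q^{-1} leaves a single
  exponential over [u].\<close>

lemma rr_minus_qpow:
  assumes "qn u \<noteq> 0"
  shows "rr u - qpow \<eta> (- 1) = qpow \<eta> u / qn u"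
proof -
  let ?D = "qpow \<eta> 1 - qpow \<eta> (- 1)"
  have "- (u + 1) = - u + - 1" by simp
  then have "qn (u + 1) * ?D = qpow \<eta> u * qpow \<eta> 1 - qpow \<eta> (- u) * qpow \<eta> (- 1)"
    by (simp only: qn_mult_qdiff qpow_add)
  moreover have "(qn (u + 1) - qpow \<eta> (- 1) * qn u) * ?D = qn (u + 1) * ?D - qpow \<eta> (- 1) * (qn u * ?D)"
    by (simp add: algebra_simps)
  ultimately have "(qn (u + 1) - qpow \<eta> (- 1) * qn u) * ?D = qpow \<eta> u * ?D"
    unfolding qn_mult_qdiff[of u] by (simp add: algebra_simps)
  then have "qn (u + 1) - qpow \<eta> (- 1) * qn u = qpow \<eta> u"
    using qdiff by (metis mult_right_cancel)
  then show ?thesis using assms by (simp add: r_def field_simps)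
qed

lemma rr_mult_rr: "qn u \<noteq> 0 \<Longrightarrow> rr (- u) * rr u = 1 - 1 / (qn u * qn u)"
  using qn_shift_mult[of u] qnum_uminus[of \<eta> "u - 1"]
  by (simp add: r_def qnum_uminus field_simps)

lemma murphy_zero_scalar:
  "qpow \<eta> \<omega>1 - (qpow \<eta> (1 + \<omega>1) - qpow \<eta> (- 1 - \<omega>1)) * sL = qpow \<eta> (- \<omega>1)"
proof -
  let ?D = "qpow \<eta> 1 - qpow \<eta> (- 1)"
  have "1 + \<omega>1 = \<omega>1 + 1" "- 1 - \<omega>1 = - (\<omega>1 + 1)" by simp_all
  then have "(qpow \<eta> (1 + \<omega>1) - qpow \<eta> (- 1 - \<omega>1)) * sL = (qn (\<omega>1 + 1) * ?D) * (qn \<omega>1 / qn (\<omega>1 + 1))"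
    by (simp only: qn_mult_qdiff s1_def)
  also have "\<dots> = qn \<omega>1 * ?D" by simp
  finally show ?thesis by (simp add: qn_mult_qdiff)
qed

end

context tbtl_module
begin

definition gg :: "nat \<Rightarrow> 'v \<Rightarrow> 'v" where
  "gg i v = (if i = 0 then qpow \<eta> \<omega>1 *s v - (qpow \<eta> (1 + \<omega>1) - qpow \<eta> (- 1 - \<omega>1)) *s ee 0 v
     else ee i v - qpow \<eta> (- 1) *s v)"

primrec JJ :: "nat \<Rightarrow> 'v \<Rightarrow> 'v" where
  "JJ 0 v = gg 0 v"
| "JJ (Suc i) v = gg (Suc i) (JJ i (gg (Suc i) v))"

lemma gg_add: "gg i (x + y) = gg i x + gg i y"
  by (simp add: gg_def ee_add scale_right_distrib)

lemma gg_scale: "gg i (c *s x) = c *s gg i x"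
  by (simp add: gg_def ee_scale scale_right_diff_distrib mult.commute)

lemma JJ_add: "JJ i (x + y) = JJ i x + JJ i y"
  by (induction i arbitrary: x y) (simp_all add: gg_add)

lemma JJ_scale: "JJ i (c *s x) = c *s JJ i x"
  by (induction i arbitrary: x) (simp_all add: gg_scale)

end

context tbtl_full_vacuum
begin

text \<open>On f and its flip J_n is diagonal with entries q^{-n-u} and q^{-n+u}; conjugation by
  g_{n+1} on both sides keeps it diagonal and exchanges the two.\<close>

lemma JJ_block:
  assumes f: "f \<in> paths N" and add: "addable N f (Suc n)" and n: "Suc n < N"
    and IH: "\<And>h. h \<in> paths N \<Longrightarrow> JJ n (bv h) = murphy_weight \<eta> \<omega>1 n h *s bv h"
  defines "f' \<equiv> flip (Suc n) f"
  shows "JJ (Suc n) (bv f) = murphy_weight \<eta> \<omega>1 (Suc n) f *s bv f"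
    "JJ (Suc n) (bv f') = murphy_weight \<eta> \<omega>1 (Suc n) f' *s bv f'"
proof -
  define a where "a = f ! n"
  define u where "u = par f (Suc n)"
  have len: "length f = N + 1" using f by (rule path_length)
  have ext: "extremal N f (Suc n)" using add by (simp add: addable_def)
  have f': "f' \<in> paths N" unfolding f'_def using f ext by (rule flip_in_paths)
  have u: "u = of_int (sg a) * (\<omega>1 - of_int a)"
    by (simp add: u_def par_def a_def)
  have qu: "qn u \<noteq> 0" unfolding u_def by (rule qn_par)
  have vals: "f ! n = a" "f ! (Suc n) = a + - sg a" "f ! (Suc (Suc n)) = a"
    "f' ! n = a" "f' ! (Suc n) = a + sg a" "f' ! (Suc (Suc n)) = a"
    using add n len by (auto simp: a_def addable_def extremal_def f'_def nth_flip)
  have d: "sg a * sg a = 1" "- sg a * - sg a = 1" by simp_all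
  have w: "murphy_weight \<eta> \<omega>1 n f = qpow \<eta> (- of_nat n) * qpow \<eta> (- u)"
    "murphy_weight \<eta> \<omega>1 n f' = qpow \<eta> (- of_nat n) * qpow \<eta> u"
    "murphy_weight \<eta> \<omega>1 (Suc n) f = qpow \<eta> (- of_nat n) * qpow \<eta> u"
    "murphy_weight \<eta> \<omega>1 (Suc n) f' = qpow \<eta> (- of_nat n) * qpow \<eta> (- u)"
    using murphy_weight_step(1)[OF d(2), of f n a \<eta> \<omega>1] murphy_weight_step(1)[OF d(1), of f' n a \<eta> \<omega>1]
      murphy_weight_step(2)[OF d(2), of f "Suc n" a \<eta> \<omega>1] murphy_weight_step(2)[OF d(1), of f' "Suc n" a \<eta> \<omega>1] vals
    by (simp_all add: u algebra_simps flip: qpow_add)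
  \<comment> \<open>\<open>\<alpha>\<close> and \<open>\<beta>\<close> are the diagonal entries of
    g_{n+1} on the block; its off-diagonal entries are 1 and \<open>\<gamma>\<close>.\<close>
  define \<alpha> where "\<alpha> = qpow \<eta> u / qn u"
  define \<beta> where "\<beta> = - (qpow \<eta> (- u) / qn u)"
  define \<gamma> where "\<gamma> = 1 - 1 / (qn u * qn u)"
  have qu': "qn (- u) \<noteq> 0" using qu by (simp add: qnum_uminus)
  have r: "rr u = \<alpha> + qpow \<eta> (- 1)" "rr (- u) = \<beta> + qpow \<eta> (- 1)" "rr (- u) * rr u = \<gamma>"
    using rr_minus_qpow[OF qu] rr_minus_qpow[OF qu'] rr_mult_rr[OF qu]
    by (simp_all add: \<alpha>_def \<beta>_def \<gamma>_def qnum_uminus eq_diff_eq[symmetric] diff_eq_eq)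
  have inv: "qpow \<eta> u * qpow \<eta> (- u) = 1"
    by (simp add: qpow_uminus)
  \<comment> \<open>The first relation kills both off-diagonal entries of the product, the other two
    give its diagonal.\<close>
  have rel: "\<beta> * qpow \<eta> u + \<alpha> * qpow \<eta> (- u) = 0" "\<gamma> * qpow \<eta> u + \<alpha> * \<alpha> * qpow \<eta> (- u) = qpow \<eta> u"
    "\<beta> * \<beta> * qpow \<eta> u + \<gamma> * qpow \<eta> (- u) = qpow \<eta> (- u)"
    using inv qu by (simp_all add: \<alpha>_def \<beta>_def \<gamma>_def field_simps)
  let ?x = "bv f" and ?y = "bv f'"
  have gx: "gg (Suc n) ?x = ?y + \<alpha> *s ?x"
    using ee_bv_addable[OF f add] n
    by (simp add: gg_def cc_def f'_def r u_def[symmetric] scale_left_distrib)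
  have "ee (Suc n) ?y = cc (Suc n) (- u) *s (?y + cc (Suc n) u *s ?x)"
    using ee_bv_removable[OF f' removable_flip[OF add len, folded f'_def]] par_flip[OF ext len] ext
    by (simp add: f'_def flip_flip u_def)
  then have gy: "gg (Suc n) ?y = \<beta> *s ?y + \<gamma> *s ?x"
    using n by (simp add: gg_def cc_def r(3) scale_right_distrib) (simp add: r(2) scale_left_distrib)
  let ?q = "qpow \<eta> (- of_nat n)"
  note J = IH[OF f] IH[OF f']
  have "JJ (Suc n) ?x = (?q * (\<beta> * qpow \<eta> u + \<alpha> * qpow \<eta> (- u))) *s ?y
      + (?q * (\<gamma> * qpow \<eta> u + \<alpha> * \<alpha> * qpow \<eta> (- u))) *s ?x"
    by (simp add: gx gy J w gg_add gg_scale JJ_add JJ_scale)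
      (simp add: scale_right_distrib scale_left_distrib algebra_simps)
  then show "JJ (Suc n) ?x = murphy_weight \<eta> \<omega>1 (Suc n) f *s ?x"
    by (simp only: rel w) simp
  have "JJ (Suc n) ?y = (?q * (\<beta> * \<beta> * qpow \<eta> u + \<gamma> * qpow \<eta> (- u))) *s ?y
      + (?q * \<gamma> * (\<beta> * qpow \<eta> u + \<alpha> * qpow \<eta> (- u))) *s ?x"
    by (simp add: gx gy J w gg_add gg_scale JJ_add JJ_scale)
      (simp add: scale_right_distrib scale_left_distrib algebra_simps)
  then show "JJ (Suc n) ?y = murphy_weight \<eta> \<omega>1 (Suc n) f' *s ?y"
    by (simp only: rel w) simp
qed

lemma JJ_bv: "n < N \<Longrightarrow> h \<in> paths N \<Longrightarrow> JJ n (bv h) = murphy_weight \<eta> \<omega>1 n h *s bv h"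
proof (induction n arbitrary: h)
  case 0
  have h0: "h ! 0 = 0" using 0 by (intro path_0)
  consider "h ! 1 = 1" | "h ! 1 = - 1"
    using path_step[OF 0(2), of 0] h0 0 by auto
  then show ?case
  proof cases
    case 1
    then show ?thesis
      using h0 ee_0_bv[OF 0(2)] by (simp add: gg_def murphy_weight_def)
  next
    case 2
    then have "JJ 0 (bv h) = qpow \<eta> (- \<omega>1) *s bv h"
      using ee_0_bv[OF 0(2)] unfolding murphy_zero_scalar[symmetric] by (simp add: gg_def scale_left_diff_distrib)
    then show ?thesis
      using 2 h0 by (simp add: murphy_weight_def)
  qed
next
  case (Suc n)
  have h: "h \<in> paths N" and n: "Suc n < N" by fact+
  have len: "length h = N + 1" using h by (rule path_length)
  have IH: "JJ n (bv h) = murphy_weight \<eta> \<omega>1 n h *s bv h" if "h \<in> paths N" for h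
    using Suc.IH[OF _ that] n by simp
  show ?case
  proof (cases "slope N h (Suc n)")
    case True
    define a where "a = h ! n"
    define d where "d = h ! Suc n - a"
    have d: "d * d = 1"
      using path_step[OF h, of n] n by (auto simp: d_def a_def)
    have vals: "h ! n = a" "h ! (n + 1) = a + d" "h ! (Suc n) = a + d" "h ! (Suc n + 1) = a + d + d"
      using path_step[OF h, of n] path_step[OF h, of "Suc n"] True n
      by (auto simp: slope_def a_def d_def)
    have sq: "complex_of_int d * complex_of_int d = 1"
      using d by (metis of_int_1 of_int_mult)
    \<comment> \<open>On a slope g acts as -q^{-1} on both sides of J_n. The resulting q^{-2} is the
      change of exponent between equal consecutive steps: -d^2 from the height and -1 from
      n.\<close>
    have "gg (Suc n) (bv h) = (- qpow \<eta> (- 1)) *s bv h"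
      using slope_zero[OF h True] by (simp add: gg_def)
    then have "JJ (Suc n) (bv h) = (qpow \<eta> (- 1) * qpow \<eta> (- 1) * murphy_weight \<eta> \<omega>1 n h) *s bv h"
      using IH[OF h] by (simp add: JJ_scale gg_scale mult_ac del: scale_minus_left)
    also have "qpow \<eta> (- 1) * qpow \<eta> (- 1) * murphy_weight \<eta> \<omega>1 n h = murphy_weight \<eta> \<omega>1 (Suc n) h"
      unfolding murphy_weight_step(1)[OF d vals(1,2)] murphy_weight_step(1)[OF d vals(3,4)]
      unfolding qpow_add[symmetric] using sq by (intro arg_cong[where f = "qpow \<eta>"]) (simp add: algebra_simps)
    finally show ?thesis .
  next
    case False
    then have ext: "extremal N h (Suc n)"
      using n by (auto simp: slope_def extremal_def)
    then consider "addable N h (Suc n)" | "removable N h (Suc n)"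
      using extremal_cases[OF h] by blast
    then show ?thesis
    proof cases
      case 1
      then show ?thesis by (rule JJ_block(1)[OF h _ n IH])
    next
      case 2
      show ?thesis
        using JJ_block(2)[OF flip_in_paths[OF h ext] addable_flip[OF 2 len] n IH]
        by (simp add: flip_flip)
    qed
  qed
qed

end

section \<open>The path model\<close>

context tbtl_module
begin

definition cst :: "nat \<Rightarrow> complex" where
  "cst i = (if i = 0 then sL else if i < N then dlt else sR)"

lemma cst_nonzero [simp]: "cst i \<noteq> 0"
  by (simp add: cst_def dlt_nonzero)

text \<open>Each factor absorbs itself up to its own scalar, so the images of I_1 and I_2 consist of
  joint eigenvectors.\<close>

lemma ee_alt: "n \<le> N + 1 \<Longrightarrow> i < n \<Longrightarrow> odd (n + i) \<Longrightarrow> ee i (alt n f) = cst i *s alt n f"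
proof (induction n f arbitrary: i rule: alt.induct)
  case (2 v)
  then show ?case by (simp add: ee_sq_0 cst_def)
next
  case (3 n v)
  show ?case
  proof (cases "i = Suc n")
    case True
    then show ?thesis
      using 3(2) ee_sq ee_sq_N by (cases "Suc n = N") (auto simp: cst_def)
  next
    case False
    then have "i < n" using 3 by (cases "i = n") auto
    then show ?thesis
      using 3 ee_comm[of i "Suc n"] by (simp add: ee_scale)
  qed
qed simp

end

context tbtl_vacuum
begin

text \<open>By \<open>alt_alt_v0\<close> the product \<open>alt n\<close> maps
  \<open>alt (Suc n) v0\<close> to a nonzero multiple of \<open>alt n v0\<close>, so nonvanishing
  propagates upward.\<close>

lemma alt_N_v0_nonzero:
  assumes "v0 \<noteq> 0"
  shows "alt N v0 \<noteq> 0"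
proof -
  have "n \<le> N \<Longrightarrow> alt n v0 \<noteq> 0" for n
  proof (induction n)
    case (Suc n)
    then have "cs (Suc n) *s alt n v0 \<noteq> 0" by simp
    then show ?case
      using alt_alt_v0[of n] Suc.prems alt.zero[of n] by auto
  qed (simp add: assms)
  then show ?thesis by simp
qed

lemma alt_Suc_N_v0_nonzero:
  assumes "ee N v0 \<noteq> 0"
  shows "alt (Suc N) v0 \<noteq> 0"
proof -
  have "n < N \<Longrightarrow> ee N (alt n v0) \<noteq> 0" for n
  proof (induction n)
    case (Suc n)
    then have "cs (Suc n) *s ee N (alt n v0) \<noteq> 0" by simp
    also have "cs (Suc n) *s ee N (alt n v0) = alt n (ee N (alt (Suc n) v0))"
      using Suc.prems by (simp add: alt_comm alt_alt_v0 ee_scale)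
    finally show ?case
      using alt.zero[of n] by auto
  qed (simp add: assms)
  from this[of "N - 1"] show ?thesis
    using N2 by (cases N) auto
qed

end

definition vscale :: "complex \<Rightarrow> ('a \<Rightarrow> complex) \<Rightarrow> 'a \<Rightarrow> complex" where
  "vscale c f = (\<lambda>p. c * f p)"

definition basis_fun :: "'a \<Rightarrow> 'a \<Rightarrow> complex" where
  "basis_fun h p = (if p = h then 1 else 0)"

lemma path_update:
  assumes h: "h \<in> paths N" and ext: "extremal N h i" and d: "d = 1 \<or> d = - 1"
  shows "h[i := h ! (i - 1) + d] \<in> paths N"
proof -
  have "h ! i = h ! (i - 1) + d \<or> h[i := h ! (i - 1) + d] = flip i h"
    using path_step'[OF h, of i] ext d by (auto simp: extremal_def flip_def)
  then show ?thesis
    using h flip_in_paths[OF h ext] by (metis list_update_id)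
qed

lemma extremal_update: "extremal N h i \<Longrightarrow> extremal N (h[i := x]) i"
  by (auto simp: extremal_def)

section \<open>Operators on functions on paths\<close>

context tbtl_params
begin

text \<open>The block of \<open>e\<^sub>i\<close> on a path and its flip is the rank one matrix \<open>out\<close> times \<open>inn\<close>. Only the products
  \<open>out i a d * inn i a d\<close> enter the relations; the normalisation is the one in which adding a tile has
  coefficient 1.\<close>

definition out :: "nat \<Rightarrow> int \<Rightarrow> int \<Rightarrow> complex" where
  "out i a d = (if d = sg a then 1 else cc i (of_int (sg a) * (\<omega>1 - of_int a)))"

definition inn :: "nat \<Rightarrow> int \<Rightarrow> int \<Rightarrow> complex" where
  "inn i a d = (if d = sg a then cc i (- (of_int (sg a) * (\<omega>1 - of_int a))) else 1)"

definition pairing :: "nat \<Rightarrow> (int list \<Rightarrow> complex) \<Rightarrow> int list \<Rightarrow> complex" where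
  "pairing i f h = inn i (h ! (i - 1)) 1 * f (h[i := h ! (i - 1) + 1])
     + inn i (h ! (i - 1)) (- 1) * f (h[i := h ! (i - 1) + - 1])"

text \<open>Defined for functions on all lists, with value 0 off the paths, so that a whole type
  carries the action. A function is a coordinate vector: the value at h reads the argument at both
  fillings of point i.\<close>

definition vop :: "nat \<Rightarrow> (int list \<Rightarrow> complex) \<Rightarrow> int list \<Rightarrow> complex" where
  "vop i f h = (if h \<notin> paths N then 0
     else if i = 0 then (if h ! 1 = - 1 then sL * f h else 0)
     else if extremal N h i then out i (h ! (i - 1)) (h ! i - h ! (i - 1)) * pairing i f h
     else 0)"

text \<open>The diagonal entries of the block: the normalisation has cancelled and only the
  direction d is left.\<close>

lemma out_inn:
  "d = 1 \<or> d = - 1 \<Longrightarrow> out i a d * inn i a d = cc i (- (of_int d * (\<omega>1 - of_int a)))"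
  using sg_cases[of a] by (auto simp: out_def inn_def)

lemma vop_update:
  assumes h: "h \<in> paths N" and ext: "extremal N h i" and d: "d = 1 \<or> d = - 1" and a: "h ! (i - 1) = a"
  shows "vop i f (h[i := a + d]) = out i a d * pairing i f h"
proof -
  have i: "1 \<le> i" "i < length h" using ext path_length[OF h] by (auto simp: extremal_def)
  have "h[i := a + d] \<in> paths N"
    using path_update[OF h ext d] a by simp
  then show ?thesis
    using i a extremal_update[OF ext] by (simp add: vop_def pairing_def)
qed

lemma vop_extremal:
  assumes h: "h \<in> paths N" and ext: "extremal N h i"
  shows "vop i f h = out i (h ! (i - 1)) (h ! i - h ! (i - 1)) * pairing i f h"
  using assms by (auto simp: vop_def extremal_def)

lemma vop_not_extremal: "1 \<le> i \<Longrightarrow> \<not> extremal N h i \<Longrightarrow> vop i f h = 0"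
  by (simp add: vop_def)

lemma vop_add: "vop i (f + f') = vop i f + vop i f'"
  by (auto simp: fun_eq_iff vop_def pairing_def algebra_simps)

lemma vop_scale: "vop i (vscale c f) = vscale c (vop i f)"
  by (auto simp: fun_eq_iff vop_def pairing_def vscale_def algebra_simps)

lemma cc_sum:
  assumes "d = 1 \<or> d = - 1"
  shows "cc i (of_int d * (\<omega>1 - of_int a)) + cc i (- (of_int d * (\<omega>1 - of_int a))) = (if i < N then dlt else sR)"
  using rr_sum kk_sum qn_nonzero(1)[OF assms, of a] by (simp add: cc_def)

text \<open>A rank one block squares to its trace times itself, and the trace is the sum of the
  coefficients at u and -u.\<close>

lemma vop_sq:
  assumes "1 \<le> i"
  shows "vop i (vop i f) = vscale (if i < N then dlt else sR) (vop i f)"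
proof
  fix h
  show "vop i (vop i f) h = vscale (if i < N then dlt else sR) (vop i f) h"
  proof (cases "h \<in> paths N \<and> extremal N h i")
    case True
    then have h: "h \<in> paths N" and ext: "extremal N h i" by auto
    define a where "a = h ! (i - 1)"
    have "pairing i (vop i f) h = (out i a 1 * inn i a 1 + out i a (- 1) * inn i a (- 1)) * pairing i f h"
      using vop_update[OF h ext, of 1 a f] vop_update[OF h ext, of "- 1" a f]
      unfolding pairing_def[of i "vop i f"] a_def[symmetric] by (simp add: algebra_simps)
    also have "out i a 1 * inn i a 1 + out i a (- 1) * inn i a (- 1) = (if i < N then dlt else sR)"
      using cc_sum[of 1 i a] unfolding out_inn[of 1, simplified] out_inn[of "- 1", simplified]
      by (simp add: add.commute)
    finally show ?thesis
      by (simp add: vop_extremal[OF h ext] vscale_def)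
  next
    case False
    then show ?thesis using assms by (auto simp: vop_def vscale_def)
  qed
qed

lemma vop_sq_0: "vop 0 (vop 0 f) = vscale sL (vop 0 f)"
  by (auto simp: fun_eq_iff vop_def vscale_def)

lemma vop_comm:
  assumes ij: "i + 1 < j" "j \<le> N"
  shows "vop i (vop j f) = vop j (vop i f)"
proof
  fix h
  show "vop i (vop j f) h = vop j (vop i f) h"
  proof (cases "h \<in> paths N")
    case h: True
    have len: "length h = N + 1" using h by (rule path_length)
    have nth_i: "h[i := x] ! (j - 1) = h ! (j - 1)" "h[i := x] ! j = h ! j" for x
      using ij by auto
    have nth_j: "h[j := x] ! (i - 1) = h ! (i - 1)" "h[j := x] ! i = h ! i" "h[j := x] ! (i + 1) = h ! (i + 1)" for x
      using ij by auto
    have ext_i: "extremal N (h[j := x]) i = extremal N h i" for x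
      using ij by (auto simp: extremal_def)
    have ext_j: "extremal N (h[i := x]) j = extremal N h j" for x
      using ij by (auto simp: extremal_def)
    have swap: "h[i := x, j := y] = h[j := y, i := x]" for x y
      using ij by (simp add: list_update_swap)
    have pi: "h[i := h ! (i - 1) + 1] \<in> paths N" "h[i := h ! (i - 1) + - 1] \<in> paths N" if "extremal N h i"
      using path_update[OF h that, of 1] path_update[OF h that, of "- 1"] by simp_all
    have pj: "h[j := h ! (j - 1) + 1] \<in> paths N" "h[j := h ! (j - 1) + - 1] \<in> paths N" if "extremal N h j"
      using path_update[OF h that, of 1] path_update[OF h that, of "- 1"] by simp_all
    have j0: "j \<noteq> 0" using ij by simp
    show ?thesis
    proof (cases "i = 0")
      case True
      show ?thesis
      proof (cases "extremal N h j")
        case ext: True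
        then show ?thesis
          using h j0 pj[OF ext] nth_j(3) True by (simp add: vop_def pairing_def algebra_simps)
      next
        case False
        then show ?thesis using h j0 True by (simp add: vop_def)
      qed
    next
      case i0: False
      show ?thesis
      proof (cases "extremal N h i \<and> extremal N h j")
        case True
        then have ei: "extremal N h i" and ej: "extremal N h j" by auto
        show ?thesis
          unfolding vop_extremal[OF h ei] vop_extremal[OF h ej]
          unfolding pairing_def[of i "vop j f"] pairing_def[of j "vop i f"]
          using pi[OF ei] pj[OF ej] ext_i ext_j ei ej
          by (simp only: vop_extremal nth_i nth_j pairing_def swap) (simp only: algebra_simps)
      next
        case False
        then show ?thesis
          using h i0 j0 ext_i ext_j by (auto simp: vop_def pairing_def)
      qed
    qed
  qed (simp add: vop_def)
qed

text \<open>The image of e_i vanishes on paths with a slope at i. Of the two paths that e_j mixes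
  one has such a slope, so only a diagonal entry of e_j survives.\<close>

lemma vop_neighbour:
  assumes h: "h \<in> paths N" and ext: "extremal N h i" and iN: "i < N" and d: "d = 1 \<or> d = - 1"
    and j: "j = i + 1 \<or> i = j + 1 \<and> 1 \<le> j" and a: "h ! (i - 1) = a"
  shows "vop j (vop i f) (h[i := a + d]) =
    (if extremal N (h[i := a + d]) j
     then cc j (of_int d * (\<omega>1 - of_int a) - 1) * vop i f (h[i := a + d]) else 0)"
proof -
  define h' where "h' = h[i := a + d]"
  have len: "length h = N + 1" using h by (rule path_length)
  have i: "1 \<le> i" "h ! (i + 1) = a" using ext iN a by (auto simp: extremal_def)
  have h': "h' \<in> paths N"
    unfolding h'_def using path_update[OF h ext d] a by simp
  have vals: "h' ! (i - 1) = a" "h' ! i = a + d" "h' ! (i + 1) = a"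
    using i iN len a by (auto simp: h'_def)
  show ?thesis
  proof (cases "extremal N h' j")
    case True
    have lenj: "j < length h'" using True path_length[OF h'] by (auto simp: extremal_def)
    have base: "h' ! (j - 1) = a + d" and hj: "h' ! j = a"
      using j True vals iN by (auto simp: extremal_def)
    have z: "vop i f (h'[j := a + d + d]) = 0"
    proof (rule vop_not_extremal[OF i(1)])
      have "h'[j := a + d + d] ! (i - 1) \<noteq> h'[j := a + d + d] ! (i + 1)"
        using j
      proof
        assume "j = i + 1"
        then show ?thesis using vals lenj d by auto
      next
        assume "i = j + 1 \<and> 1 \<le> j"
        then show ?thesis using vals lenj d by auto
      qed
      then show "\<not> extremal N (h'[j := a + d + d]) i"
        unfolding extremal_def using iN by blast
    qed
    have id: "h'[j := a + d + - d] = h'" using hj by (metis add_diff_cancel_right' diff_conv_add_uminus list_update_id)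
    have pr: "pairing j (vop i f) h' = inn j (a + d) (- d) * vop i f h'"
      using d
    proof
      assume "d = 1"
      then show ?thesis using z id unfolding pairing_def base by simp
    next
      assume "d = - 1"
      then show ?thesis using z id unfolding pairing_def base by simp
    qed
    have "vop j (vop i f) h' = out j (a + d) (- d) * inn j (a + d) (- d) * vop i f h'"
      unfolding vop_extremal[OF h' True] base hj pr by simp
    also have "out j (a + d) (- d) * inn j (a + d) (- d) = cc j (of_int d * (\<omega>1 - of_int a) - 1)"
      using d out_inn[of "- d" j "a + d"] shift_minus(1)[OF d, of a] by auto
    finally show ?thesis using True by (simp add: h'_def)
  next
    case False
    then show ?thesis using j by (auto simp: vop_def h'_def)
  qed
qed

lemma vop_triple_pairing:
  assumes h: "h \<in> paths N" and ext: "extremal N h i"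
    and "pairing i (vop j (vop i f)) h = pairing i f h"
  shows "vop i (vop j (vop i f)) h = vop i f h"
  using assms by (simp add: vop_extremal)

text \<open>Sum over the two fillings of point i. For interior j exactly one of them is extremal at
  j and contributes 1 by unitarity; for j = N both contribute, and the reflection relation makes the
  sum 1.\<close>

lemma vop_triple:
  assumes i: "1 \<le> i" "i < N" and j: "j = i + 1 \<or> i = j + 1 \<and> 1 \<le> j"
  shows "vop i (vop j (vop i f)) = vop i f"
proof
  fix h
  show "vop i (vop j (vop i f)) h = vop i f h"
  proof (cases "h \<in> paths N \<and> extremal N h i")
    case True
    then have h: "h \<in> paths N" and ext: "extremal N h i" by auto
    have len: "length h = N + 1" using h by (rule path_length)
    define a where "a = h ! (i - 1)"
    have hi1: "h ! (i + 1) = a" using ext i by (simp add: extremal_def a_def)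
    define T where "T d = (if extremal N (h[i := a + d]) j
      then cc i (- (of_int d * (\<omega>1 - of_int a))) * cc j (of_int d * (\<omega>1 - of_int a) - 1) else 0)" for d
    have summand: "inn i a d * vop j (vop i f) (h[i := a + d]) = T d * pairing i f h"
      if d: "d = 1 \<or> d = - 1" for d
      using vop_neighbour[OF h ext i(2) d j a_def[symmetric]] vop_update[OF h ext d a_def[symmetric], of f]
        out_inn[OF d, of i a] by (simp add: T_def mult_ac)
    have "pairing i (vop j (vop i f)) h = (T 1 + T (- 1)) * pairing i f h"
      unfolding pairing_def[of i "vop j (vop i f)"] a_def[symmetric]
      using summand[of 1] summand[of "- 1"] by (simp add: distrib_right)
    moreover have "T 1 + T (- 1) = 1"
    proof (cases "j = N")
      case True
      then have ji: "j = i + 1" using j i by auto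
      have "extremal N (h[i := a + d]) j" for d
        using True ji by (simp add: extremal_def)
      then have "T d = cc i (- (of_int d * (\<omega>1 - of_int a))) * cc j (of_int d * (\<omega>1 - of_int a) - 1)" for d
        unfolding T_def by meson
      then show ?thesis
        using i True kk_reflection[of "\<omega>1 - of_int a"] qn_nonzero[of 1 a]
        by (simp add: cc_def)
    next
      case False
      have unit: "cc i (- (of_int d * (\<omega>1 - of_int a))) * cc j (of_int d * (\<omega>1 - of_int a) - 1) = 1"
        if d: "d = 1 \<or> d = - 1" for d
        using False i j rr_unit[OF qn_nonzero(1,3)[OF d, of a]] by (auto simp: cc_def)
      \<comment> \<open>The height beyond j decides which filling is extremal at j; it differs from
        a by one.\<close>
      define x where "x = (if j = i + 1 then h ! (i + 2) else h ! (i - 2))"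
      have ex: "extremal N (h[i := a + d]) j \<longleftrightarrow> x = a + d" for d
        using j i False len by (auto simp: extremal_def x_def numeral_2_eq_2)
      have "x = a + 1 \<or> x = a - 1"
        using j path_step[OF h, of "i + 1"] path_step'[OF h, of j] i hi1 False
        by (auto simp: x_def a_def numeral_2_eq_2)
      then show ?thesis
        using unit[of 1] unit[of "- 1"] ex[of 1] ex[of "- 1"] by (auto simp: T_def)
    qed
    ultimately show ?thesis
      using vop_triple_pairing[OF h ext] by simp
  next
    case False
    then show ?thesis using i by (auto simp: vop_def)
  qed
qed

text \<open>e_0 keeps only the filling with h_1 = -1 and multiplies it by s_1; the diagonal entry
  there is r(\<omega>1), the inverse of s_1.\<close>

lemma vop_triple_0: "vop 1 (vop 0 (vop 1 f)) = vop 1 f"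
proof
  fix h
  show "vop 1 (vop 0 (vop 1 f)) h = vop 1 f h"
  proof (cases "h \<in> paths N \<and> extremal N h 1")
    case True
    then have h: "h \<in> paths N" and ext: "extremal N h 1" by auto
    have h0: "h ! (1 - 1) = 0" using path_0[OF h] by simp
    have len: "1 < length h" using path_length[OF h] N2 by simp
    have paths: "h[1 := 0 + 1] \<in> paths N" "h[1 := 0 + - 1] \<in> paths N"
      using path_update[OF h ext, of 1] path_update[OF h ext, of "- 1"] unfolding h0 by auto
    have "pairing 1 (vop 0 (vop 1 f)) h = inn 1 0 (- 1) * (sL * vop 1 f (h[1 := 0 + - 1]))"
      using paths len unfolding pairing_def[of 1 "vop 0 (vop 1 f)"] h0 by (simp add: vop_def[of 0])
    also have "\<dots> = inn 1 0 (- 1) * out 1 0 (- 1) * sL * pairing 1 f h"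
      using vop_update[OF h ext _ h0, of "- 1" f] by simp
    also have "inn 1 0 (- 1) * out 1 0 (- 1) = inverse sL"
      using out_inn[of "- 1" 1 0] N2 rr_\<omega>1 by (simp add: mult.commute cc_def)
    finally show ?thesis
      using vop_triple_pairing[OF h ext, of 0] by simp
  next
    case False
    then show ?thesis by (auto simp: vop_def)
  qed
qed

lemma vop_module: "tbtl_module N \<eta> \<omega>1 \<omega>2 vscale vop"
proof unfold_locales
  show "vscale a (x + y) = vscale a x + vscale a y" "vscale (a + b) x = vscale a x + vscale b x"
    "vscale a (vscale b x) = vscale (a * b) x" "vscale 1 x = x"
    for a b and x y :: "int list \<Rightarrow> complex"
    by (auto simp: vscale_def fun_eq_iff algebra_simps)
  show "vop i (vop (i + 1) (vop i f)) = vop i f" if "1 \<le> i" "i < N" for i f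
    using vop_triple[OF that] by simp
  show "vop i (vop (i - 1) (vop i f)) = vop i f" if "1 \<le> i" "i < N" for i f
  proof (cases "i = 1")
    case True
    then show ?thesis using vop_triple_0 by simp
  next
    case False
    then show ?thesis using that by (intro vop_triple) auto
  qed
  show "vop N (vop N f) = vscale sR (vop N f)" for f
    using vop_sq[of N] N2 by simp
  show "vop i (vop i f) = vscale dlt (vop i f)" if "1 \<le> i" "i < N" for i f
    using vop_sq[OF that(1)] that(2) by simp
  show "vop i (vop j f) = vop j (vop i f)" if "i + 1 < j" "j \<le> N" for i j f
    using that by (rule vop_comm)
qed (simp_all add: vop_add vop_scale vop_sq_0)

lemma vop_0_basis:
  "h \<in> paths N \<Longrightarrow> vop 0 (basis_fun h) = vscale (if h ! 1 = - 1 then sL else 0) (basis_fun h)"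
  by (auto simp: fun_eq_iff vop_def vscale_def basis_fun_def)

lemma vop_not_extremal_basis:
  assumes "1 \<le> i" "\<not> extremal N h i"
  shows "vop i (basis_fun h) = 0"
proof
  fix p
  have "basis_fun h (p[i := x]) = 0" if "extremal N p i" for x
    using assms(2) extremal_update[OF that] by (auto simp: basis_fun_def)
  then show "vop i (basis_fun h) p = 0 p"
    using assms(1) by (simp add: vop_def pairing_def)
qed

lemma vop_addable_basis:
  assumes h: "h \<in> paths N" and add: "addable N h i"
  shows "vop i (basis_fun h) = basis_fun (flip i h) + vscale (cc i (par h i)) (basis_fun h)"
proof
  fix p
  define a where "a = h ! (i - 1)"
  have ext: "extremal N h i" and hi: "h ! i = a - sg a"
    using add by (auto simp: addable_def a_def)
  have i: "1 \<le> i" "i < length h"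
    using ext path_length[OF h] by (auto simp: extremal_def)
  have d: "sg a = 1 \<or> sg a = - 1" using sg_cases[of a] by auto
  have flip: "flip i h = h[i := a + sg a]"
    using hi by (simp add: flip_def a_def)
  have hid: "h = h[i := a + - sg a]"
    using hi by (metis add_uminus_conv_diff list_update_id)
  have flip': "flip i h \<in> paths N" using h ext by (rule flip_in_paths)
  have other: "h[i := a + sg a] \<noteq> h"
    using i hi d by (metis diff_eq_eq nth_list_update_eq add_left_cancel add_uminus_conv_diff minus_equation_iff one_neq_neg_one)
  have pr: "pairing i (basis_fun h) h = 1"
    using d other hid a_def[symmetric]
    by (cases "sg a = 1") (auto simp: pairing_def basis_fun_def inn_def)
  have up: "vop i (basis_fun h) (flip i h) = 1"
    unfolding flip using vop_update[OF h ext d a_def[symmetric]] pr by (simp add: out_def)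
  have down: "vop i (basis_fun h) h = cc i (par h i)"
    using vop_update[OF h ext _ a_def[symmetric], of "- sg a" "basis_fun h"] d pr hid
    by (auto simp: out_def par_def a_def)
  show "vop i (basis_fun h) p = (basis_fun (flip i h) + vscale (cc i (par h i)) (basis_fun h)) p"
  proof (cases "p = h \<or> p = flip i h")
    case True
    then show ?thesis
      using up down other flip by (auto simp: basis_fun_def vscale_def)
  next
    case False
    have "vop i (basis_fun h) p = 0"
    proof (cases "p \<in> paths N \<and> extremal N p i")
      case True
      have "p[i := p ! (i - 1) + x] \<noteq> h" for x
      proof
        assume ph: "p[i := p ! (i - 1) + x] = h"
        then have pa: "p ! (i - 1) = a" using i by (auto simp: a_def)
        have "p = h[i := p ! i]" using ph by auto
        moreover have "p ! i = a + sg a \<or> p ! i = a + - sg a"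
          using path_step'[of p N i] True d pa by (auto simp: extremal_def)
        ultimately show False
          using False flip hid by auto
      qed
      then show ?thesis
        using True by (simp add: vop_extremal pairing_def basis_fun_def del: add_uminus_conv_diff)
    next
      case False
      then show ?thesis using i by (auto simp: vop_def)
    qed
    then show ?thesis using False by (simp add: basis_fun_def vscale_def)
  qed
qed

lemma addable_fund: "1 \<le> i \<Longrightarrow> i \<le> N \<Longrightarrow> addable N (fund_path N) i"
  by (auto simp: addable_def extremal_def fund_path_nth sg_def)

text \<open>The flipped path has a slope at i - 1, or an upward first step if i = 1, so e_{i-1}
  kills it. This gives the vacuum and the boundary relations at once.\<close>

lemma vop_vop_fund:
  assumes "1 \<le> i" "i \<le> N"
  shows "vop (i - 1) (vop i (basis_fun (fund_path N))) =
    vscale (cc i (par (fund_path N) i)) (vop (i - 1) (basis_fun (fund_path N)))"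
proof -
  let ?p = "fund_path N"
  have add: "addable N ?p i" using assms by (rule addable_fund)
  have len: "length ?p = N + 1" by (simp add: fund_path_def)
  have "vop (i - 1) (basis_fun (flip i ?p)) = 0"
  proof (cases "i = 1")
    case True
    have "flip 1 ?p ! 1 = 1" using len assms True by (simp add: nth_flip fund_path_nth)
    moreover have "flip i ?p \<in> paths N"
      using add by (auto simp: addable_def intro: flip_in_paths fund_path_in_paths)
    ultimately show ?thesis
      using True by (simp add: vop_0_basis vscale_def fun_eq_iff)
  next
    case False
    then obtain j where j: "i = Suc (Suc j)" using assms(1) by (cases i; cases "i - 1") auto
    have "flip i ?p ! j \<noteq> flip i ?p ! (Suc (Suc j))"
      using assms len j by (auto simp: nth_flip fund_path_nth)
    then show ?thesis
      using assms(2) by (intro vop_not_extremal_basis) (auto simp: j extremal_def)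
  qed
  then show ?thesis
    unfolding vop_addable_basis[OF fund_path_in_paths add] vop_add vop_scale by simp
qed

lemma vop_full_vacuum: "tbtl_full_vacuum N \<eta> \<omega>1 \<omega>2 \<theta> vscale vop (basis_fun (fund_path N))"
proof -
  interpret V: tbtl_module N \<eta> \<omega>1 \<omega>2 \<theta> vscale vop by (rule vop_module)
  show ?thesis
  proof unfold_locales
    show "vop 0 (basis_fun (fund_path N)) = vscale sL (basis_fun (fund_path N))"
      using N2 by (simp add: vop_0_basis fund_path_in_paths fund_path_nth)
    show "vop (i - 1) (vop i (basis_fun (fund_path N))) = vscale (V.ss i) (vop (i - 1) (basis_fun (fund_path N)))"
      if "1 \<le> i" "i < N" for i
      using that vop_vop_fund[of i] V.cc_par_fund[of i] by simp
    show "vop (N - 1) (vop N (basis_fun (fund_path N))) = vscale (kk V.uN) (vop (N - 1) (basis_fun (fund_path N)))"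
      using N2 vop_vop_fund[of N] V.cc_par_fund[of N] by simp
  qed
qed

text \<open>The path vectors of the model are the point functions; this is the source of
  independence.\<close>

lemma Bv_basis:
  assumes "h \<in> paths N"
  shows "tbtl_full_vacuum.Bv N \<eta> \<omega>1 \<omega>2 \<theta> vscale vop (basis_fun (fund_path N)) h (basis_fun h)"
proof -
  interpret V: tbtl_full_vacuum N \<eta> \<omega>1 \<omega>2 \<theta> vscale vop "basis_fun (fund_path N)"
    by (rule vop_full_vacuum)
  have XX: "V.XX i (par h i) (basis_fun h) = basis_fun (flip i h)" if "h \<in> paths N" "addable N h i" for h i
    unfolding V.XX_def vop_addable_basis[OF that] by simp
  from assms show ?thesis
  proof (induction h rule: area_less_induct)
    case (less h)
    show ?case
    proof (cases "h = fund_path N")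
      case True
      then show ?thesis using V.Bv_fund by simp
    next
      case False
      then obtain i where i: "removable N h i" using ex_removable less(1) by blast
      have len: "length h = N + 1" using less(1) by (rule path_length)
      have flip: "flip i h \<in> paths N"
        using i less(1) by (auto simp: removable_def intro: flip_in_paths)
      have add: "addable N (flip i h) i" using i len by (rule addable_flip)
      have "V.Bv (flip i (flip i h)) (V.XX i (par (flip i h) i) (basis_fun (flip i h)))"
        using less(2)[OF flip area_remove[OF i len]] add by (rule V.Bv_add)
      then show ?thesis
        using i unfolding XX[OF flip add] by (simp add: flip_flip removable_def extremal_def)
    qed
  qed
qed

text \<open>The possible support of a joint eigenvector of the factors of \<open>alt n\<close>:
  being extremal at their indices freezes the heights of the other parity.\<close>

definition alternating_path :: "nat \<Rightarrow> int list \<Rightarrow> bool" where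
  "alternating_path n h \<longleftrightarrow> h \<in> paths N \<and> (\<forall>j \<le> N. even (n + j) \<longrightarrow> h ! j = fund_path N ! j)"

lemma alternating_pathI:
  assumes h: "h \<in> paths N" and n: "n = N \<or> n = N + 1"
    and ext: "\<And>i. 1 \<le> i \<Longrightarrow> i < n \<Longrightarrow> odd (n + i) \<Longrightarrow> extremal N h i" and h1: "odd n \<Longrightarrow> h ! 1 = - 1"
  shows "alternating_path n h"
proof -
  have "j \<le> N \<Longrightarrow> even (n + j) \<Longrightarrow> h ! j = fund_path N ! j" for j
  proof (induction j rule: less_induct)
    case (less j)
    show ?case
    proof (cases "j < 2")
      case True
      then have "j = 0 \<or> j = 1" by auto
      then show ?thesis
        using path_0[OF h] h1 less.prems by (auto simp: fund_path_nth)
    next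
      case False
      then obtain l where l: "j = Suc (Suc l)" by (metis not_less_eq numeral_2_eq_2 not0_implies_Suc less_Suc0 not_less0)
      have "extremal N h (Suc l)" using less.prems n l by (intro ext) auto
      then show ?thesis
        using less.IH[of l] less.prems l by (auto simp: extremal_def fund_path_nth)
    qed
  qed
  then show ?thesis using h by (simp add: alternating_path_def)
qed

text \<open>A nonzero eigenvalue puts y in the image of e_i. There, vanishing at the path with a
  tile at i forces vanishing at the path without it, so everything is governed by the path carrying
  all admissible tiles.\<close>

lemma fixed_vector_zero:
  assumes n: "n = N \<or> n = N + 1"
    and fixed: "\<And>i. i < n \<Longrightarrow> odd (n + i) \<Longrightarrow> \<exists>c. c \<noteq> 0 \<and> vop i y = vscale c y"
    and top: "\<And>h. alternating_path n h \<Longrightarrow> (\<And>i. i < n \<Longrightarrow> odd (n + i) \<Longrightarrow> \<not> addable N h i) \<Longrightarrow> y h = 0"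
  shows "y = 0"
proof
  fix h
  have supp: "y h = 0" if "\<not> alternating_path n h" for h
  proof -
    have "\<exists>i < n. odd (n + i) \<and> vop i y h = 0"
    proof (cases "h \<in> paths N")
      case False
      then have "vop (n - 1) y h = 0" by (simp add: vop_def)
      then show ?thesis using n N2 by (intro exI[of _ "n - 1"]) auto
    next
      case True
      show ?thesis
      proof (cases "\<exists>i. 1 \<le> i \<and> i < n \<and> odd (n + i) \<and> \<not> extremal N h i")
        case True
        then show ?thesis using vop_not_extremal by blast
      next
        case False
        then have "odd n \<and> h ! 1 \<noteq> - 1"
          using that alternating_pathI[OF \<open>h \<in> paths N\<close> n] by blast
        then show ?thesis
          using n N2 by (intro exI[of _ 0]) (auto simp: vop_def)
      qed
    qed
    then obtain i c where "c \<noteq> 0" "vop i y = vscale c y" "vop i y h = 0"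
      using fixed by blast
    then show ?thesis by (simp add: vscale_def)
  qed
  \<comment> \<open>Points from k on already carry their tiles. At k = 0 this is the top path, at k
    = n there is no condition left.\<close>
  have "(\<And>i. k \<le> i \<Longrightarrow> i < n \<Longrightarrow> odd (n + i) \<Longrightarrow> \<not> addable N h i) \<Longrightarrow> y h = 0" for k h
  proof (induction k arbitrary: h)
    case 0
    then show ?case using supp top by blast
  next
    case (Suc k)
    show ?case
    proof (cases "alternating_path n h \<and> k < n \<and> odd (n + k) \<and> addable N h k")
      case False
      then show ?thesis
        using supp Suc.IH[of h] Suc.prems by (metis le_antisym not_less_eq_eq)
    next
      case True
      then have h: "h \<in> paths N" and k: "k < n" "odd (n + k)" and add: "addable N h k"
        by (auto simp: alternating_path_def)
      have len: "length h = N + 1" using h by (rule path_length)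
      have ext: "extremal N h k" using add by (simp add: addable_def)
      have far: "\<not> addable N (flip k h) i" if "k \<le> i" "i < n" "odd (n + i)" for i
      proof (cases "i = k")
        case True
        then show ?thesis using removable_flip[OF add len] removable_not_addable by blast
      next
        case False
        with that k(2) have ki: "k + 1 < i" by (metis Suc_eq_plus1 le_neq_implies_less even_Suc add_Suc_right less_antisym not_less_eq)
        have "addable N (flip k h) i = addable N h i"
          unfolding addable_def using ki that n len extremal_flip_far[of i k h N]
          by (auto simp: nth_flip)
        then show ?thesis using Suc.prems[of i] ki that by auto
      qed
      then have "y (flip k h) = 0" by (rule Suc.IH)
      moreover obtain c where c: "c \<noteq> 0" "vop k y = vscale c y" using fixed k by blast
      ultimately have z: "vop k y (flip k h) = 0" by (simp add: vscale_def)
      define a where "a = h ! (k - 1)"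
      have d: "sg a = 1 \<or> sg a = - 1" using sg_cases[of a] by auto
      have fl: "flip k h = h[k := a + sg a]"
        using add by (simp add: flip_def addable_def a_def)
      have "pairing k y h = 0"
        using z vop_update[OF h ext d a_def[symmetric], of y] unfolding fl by (simp add: out_def)
      then have "vop k y h = 0"
        using vop_extremal[OF h ext] by simp
      then show ?thesis using c by (simp add: vscale_def)
    qed
  qed
  from this[of n h] show "y h = 0 h" by simp
qed

text \<open>Half of the heights are frozen, and at every other point except 0 a tile must be
  present.\<close>

lemma top_alternating_unique:
  assumes n: "n = N \<or> n = N + 1"
    and h: "alternating_path n h" "\<And>i. i < n \<Longrightarrow> odd (n + i) \<Longrightarrow> \<not> addable N h i"
    and h': "alternating_path n h'" "\<And>i. i < n \<Longrightarrow> odd (n + i) \<Longrightarrow> \<not> addable N h' i"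
  shows "h = h'"
proof (rule path_eqI)
  have val: "p ! i = (if even (n + i) then fund_path N ! i else if i = 0 then 0
      else fund_path N ! (i - 1) + sg (fund_path N ! (i - 1)))"
    if p: "alternating_path n p" "\<And>i. i < n \<Longrightarrow> odd (n + i) \<Longrightarrow> \<not> addable N p i" and i: "i \<le> N" for p i
  proof (cases "even (n + i) \<or> i = 0")
    case True
    then show ?thesis
      using p(1) i path_0 by (auto simp: alternating_path_def)
  next
    case False
    have pp: "p \<in> paths N" using p(1) by (simp add: alternating_path_def)
    have near: "p ! (i - 1) = fund_path N ! (i - 1)" "i < N \<Longrightarrow> p ! (i + 1) = fund_path N ! (i + 1)"
      using p(1) i False by (auto simp: alternating_path_def)
    have ext: "extremal N p i"
      using near i False by (auto simp: extremal_def fund_path_nth)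
    have "i \<noteq> N \<or> n = N + 1" using False n by auto
    then have "i < n" using i n by auto
    then have "\<not> addable N p i" using p(2) False by blast
    then have "removable N p i" using extremal_cases[OF pp ext] by blast
    then show ?thesis using False near by (simp add: removable_def)
  qed
  show "h ! i = h' ! i" if "i \<le> N" for i
    using val[OF h that] val[OF h' that] by simp
qed (use h h' in \<open>auto simp: alternating_path_def\<close>)

text \<open>Subtract the multiple of x that agrees with y at the top path; the difference is a joint
  eigenvector for the same eigenvalues.\<close>

lemma fixed_vectors_proportional:
  assumes n: "n = N \<or> n = N + 1" and x: "x \<noteq> 0"
    and fixed: "\<And>i. i < n \<Longrightarrow> odd (n + i) \<Longrightarrow> \<exists>c. c \<noteq> 0 \<and> vop i x = vscale c x \<and> vop i y = vscale c y"
  shows "\<exists>c. y = vscale c x"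
proof -
  obtain h where h: "alternating_path n h" "\<And>i. i < n \<Longrightarrow> odd (n + i) \<Longrightarrow> \<not> addable N h i" "x h \<noteq> 0"
    using fixed_vector_zero[OF n, of x] fixed x by blast
  define z where "z = y + vscale (- (y h / x h)) x"
  have "z = 0"
  proof (rule fixed_vector_zero[OF n])
    fix i assume "i < n" "odd (n + i)"
    then obtain c where c: "c \<noteq> 0" "vop i x = vscale c x" "vop i y = vscale c y" using fixed by blast
    have "vop i z = vscale c z"
      unfolding z_def vop_add vop_scale c(2,3) by (auto simp: vscale_def fun_eq_iff algebra_simps)
    then show "\<exists>c. c \<noteq> 0 \<and> vop i z = vscale c z"
      using c(1) by blast
  next
    fix h' assume "alternating_path n h'" "\<And>i. i < n \<Longrightarrow> odd (n + i) \<Longrightarrow> \<not> addable N h' i"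
    then have "h' = h" using top_alternating_unique[OF n] h by blast
    then show "z h' = 0" using h(3) by (simp add: z_def vscale_def)
  qed
  have "y p = vscale (y h / x h) x p" for p
    using fun_cong[OF \<open>z = 0\<close>, of p] unfolding z_def by (simp add: vscale_def)
  then have "y = vscale (y h / x h) x" by (rule ext)
  then show ?thesis ..
qed

lemma vop_quotient:
  defines "valt \<equiv> tbtl_module.alt vop"
  shows "valt N (valt (Suc N) (valt N f)) = vscale (b_param N \<eta> \<omega>1 \<omega>2 \<theta>) (valt N f)"
    "valt (Suc N) (valt N (valt (Suc N) f)) = vscale (b_param N \<eta> \<omega>1 \<omega>2 \<theta>) (valt (Suc N) f)"
proof -
  let ?v = "basis_fun (fund_path N)"
  interpret V: tbtl_full_vacuum N \<eta> \<omega>1 \<omega>2 \<theta> vscale vop ?v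
    by (rule vop_full_vacuum)
  have v0: "?v \<noteq> 0" by (auto simp: fun_eq_iff basis_fun_def)
  have add: "addable N (fund_path N) N" using N2 by (intro addable_fund) auto
  have ne: "flip N (fund_path N) \<noteq> fund_path N"
    using removable_flip[OF add] removable_not_addable[of N "fund_path N" N] add by (auto simp: fund_path_def)
  have "vop N ?v (flip N (fund_path N)) \<noteq> 0"
    unfolding vop_addable_basis[OF fund_path_in_paths add] using ne by (simp add: basis_fun_def vscale_def)
  then have vN: "vop N ?v \<noteq> 0" by auto
  have proportional: "\<exists>c. V.alt n f = vscale c (V.alt n ?v)" if n: "n = N \<or> n = N + 1" for n
  proof (rule fixed_vectors_proportional[OF n])
    show "V.alt n ?v \<noteq> 0"
      using n V.alt_N_v0_nonzero[OF v0] V.alt_Suc_N_v0_nonzero[OF vN] by auto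
  next
    fix i assume "i < n" "odd (n + i)"
    then show "\<exists>c. c \<noteq> 0 \<and> vop i (V.alt n ?v) = vscale c (V.alt n ?v) \<and> vop i (V.alt n f) = vscale c (V.alt n f)"
      using V.ee_alt[of n i] n by (intro exI[of _ "V.cst i"]) auto
  qed
  obtain c where c: "V.alt N f = vscale c (V.alt N ?v)" using proportional by blast
  show "valt N (valt (Suc N) (valt N f)) = vscale (b_param N \<eta> \<omega>1 \<omega>2 \<theta>) (valt N f)"
    unfolding valt_def c by (simp add: V.alt_scale V.quotient_v0 mult.commute)
  obtain c' where c': "V.alt (Suc N) f = vscale c' (V.alt (Suc N) ?v)" using proportional[of "N + 1"] by auto
  show "valt (Suc N) (valt N (valt (Suc N) f)) = vscale (b_param N \<eta> \<omega>1 \<omega>2 \<theta>) (valt (Suc N) f)"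
    unfolding valt_def c' by (simp add: V.alt_scale V.quotient_v0 mult.commute)
qed

end

section \<open>The free algebra\<close>

lemma fpoly_induct [case_names zero add]:
  assumes "P 0" and "\<And>x w c. P x \<Longrightarrow> P (x + Poly_Mapping.single w c)"
  shows "P (x :: fpoly)"
proof (induction x rule: update_induct)
  case const
  then show ?case by (rule assms(1))
next
  case (update x w c)
  have "Poly_Mapping.update w c x = x + Poly_Mapping.single w c"
    using update(1) by (auto simp: poly_mapping_eq_iff fun_eq_iff lookup_update lookup_add lookup_single in_keys_iff when_def)
  then show ?case using update(3) assms(2) by simp
qed

lemma const_add: "const (c + d) = const c + const d"
  by (simp add: const_def single_add)

lemma const_mult: "const (c * d) = const c * const d"
  by (simp add: const_def mult_single)

lemma const_one: "const 1 = 1"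
  by (simp add: const_def)

lemma const_central: "const c * x = x * const c"
  by (induction x rule: fpoly_induct) (simp_all add: distrib_left distrib_right const_def mult_single mult.commute)

lemma const_single: "const c * Poly_Mapping.single w d = Poly_Mapping.single w (c * d)"
  by (simp add: const_def mult_single)

section \<open>Realising a quotient space inside the space\<close>

context vector_space
begin

text \<open>Extend a basis of A to one of B and send the part in A to 0. The whole space is mapped
  into B, so operators built from p stay total.\<close>

lemma ex_linear_projection:
  assumes "subspace A" "subspace B" "A \<subseteq> B"
  shows "\<exists>p. Vector_Spaces.linear scale scale p \<and> (\<forall>x. p x \<in> B) \<and> (\<forall>x \<in> A. p x = 0) \<and> (\<forall>x \<in> B. p x - x \<in> A)"
proof -
  interpret vector_space_pair scale scale ..
  obtain BA where BA: "BA \<subseteq> A" "independent BA" "A \<subseteq> span BA"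
    by (rule maximal_independent_subset)
  obtain BB where BB: "BA \<subseteq> BB" "BB \<subseteq> B" "independent BB" "B \<subseteq> span BB"
    using maximal_independent_subset_extend[of BA B] BA assms(3) by blast
  obtain p where lin: "Vector_Spaces.linear scale scale p"
    and p: "\<And>x. x \<in> BB \<Longrightarrow> p x = (if x \<in> BA then 0 else x)"
    and rng: "range p = span ((\<lambda>x. if x \<in> BA then 0 else x) ` BB)"
    using linear_independent_extend_subspace[OF BB(3), of "\<lambda>x. if x \<in> BA then 0 else x"] by blast
  interpret p: Vector_Spaces.linear scale scale p by (rule lin)
  have "(\<lambda>x. if x \<in> BA then 0 else x) ` BB \<subseteq> B"
    using BB(2) subspace_0[OF assms(2)] by auto
  then have "range p \<subseteq> B"
    unfolding rng by (rule span_minimal[OF _ assms(2)])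
  moreover have "p x = 0" if "x \<in> A" for x
  proof -
    have "x \<in> span BA" using that BA by blast
    then show ?thesis
      by (rule p.eq_0_on_span[rotated]) (use p BB(1) in auto)
  qed
  moreover have "p x - x \<in> A" if "x \<in> B" for x
  proof -
    have "x \<in> span BB" using that BB by blast
    then show ?thesis
    proof (induction rule: span_induct_alt)
      case base
      then show ?case using subspace_0[OF assms(1)] by (simp add: p.zero)
    next
      case (step c b y)
      have "p b - b \<in> A"
        using p[OF step(1)] BA(1) subspace_0[OF assms(1)] subspace_neg[OF assms(1)] by auto
      then have "scale c (p b - b) + (p y - y) \<in> A"
        using step(2) subspace_add[OF assms(1)] subspace_scale[OF assms(1)] by blast
      then show ?case by (simp add: p.add p.scale scale_right_diff_distrib algebra_simps)
    qed
  qed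
  ultimately show ?thesis using lin by (intro exI[of _ p]) auto
qed

end

section \<open>Evaluating noncommutative polynomials in a module\<close>

context tbtl_module
begin

definition wact :: "word \<Rightarrow> 'v \<Rightarrow> 'v" where
  "wact w = foldr ee (letters w)"

definition act :: "fpoly \<Rightarrow> 'v \<Rightarrow> 'v" where
  "act x v = (\<Sum>w \<in> Poly_Mapping.keys x. Poly_Mapping.lookup x w *s wact w v)"

lemma wact_add: "wact w (u + v) = wact w u + wact w v"
proof -
  have "foldr ee l (u + v) = foldr ee l u + foldr ee l v" for l
    by (induction l) (simp_all add: ee_add)
  then show ?thesis by (simp add: wact_def)
qed

lemma wact_scale: "wact w (c *s v) = c *s wact w v"
proof -
  have "foldr ee l (c *s v) = c *s foldr ee l v" for l
    by (induction l) (simp_all add: ee_scale)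
  then show ?thesis by (simp add: wact_def)
qed

lemma wact_plus: "wact (u + w) v = wact u (wact w v)"
  by (simp add: wact_def plus_word_def)

lemma act_superset:
  assumes "finite A" "Poly_Mapping.keys x \<subseteq> A"
  shows "act x v = (\<Sum>w \<in> A. Poly_Mapping.lookup x w *s wact w v)"
  unfolding act_def using assms by (intro sum.mono_neutral_left) (auto simp: in_keys_iff)

lemma act_add: "act (x + y) v = act x v + act y v"
proof -
  let ?A = "Poly_Mapping.keys x \<union> Poly_Mapping.keys y"
  have "act (x + y) v = (\<Sum>w \<in> ?A. Poly_Mapping.lookup (x + y) w *s wact w v)"
    by (rule act_superset) (simp_all add: Poly_Mapping.keys_add)
  then show ?thesis
    by (simp add: act_superset[of ?A x] act_superset[of ?A y] lookup_add scale_left_distrib sum.distrib)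
qed

lemma act_single: "act (Poly_Mapping.single w c) v = c *s wact w v"
  by (simp add: act_superset[of "{w}"])

lemma act_zero: "act 0 v = 0"
  by (simp add: act_def)

lemma act_gen: "act (gen i) v = ee i v"
  by (simp add: gen_def act_single wact_def)

lemma act_const: "act (const c) v = c *s v"
  by (simp add: const_def act_single wact_def zero_word_def)

lemma act_one: "act 1 v = v"
  using act_const[of 1 v] by (simp add: const_one)

lemma act_minus: "act (x - y) v = act x v - act y v"
proof -
  have "act (x - y + y) v = act (x - y) v + act y v" by (rule act_add)
  then show ?thesis by (simp add: eq_diff_eq)
qed

lemma act_right_scale: "act x (c *s v) = c *s act x v"
  by (simp add: act_def wact_scale scale_sum_right mult.commute)

lemma act_right_zero: "act x 0 = 0"
  using act_right_scale[of x 0 0] by simp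

lemma act_mult: "act (x * y) v = act x (act y v)"
proof (induction x rule: fpoly_induct)
  case zero
  then show ?case by (simp add: act_zero)
next
  case (add x u c)
  have "act (Poly_Mapping.single u c * y) v = c *s wact u (act y v)"
  proof (induction y rule: fpoly_induct)
    case zero
    then show ?case using wact_scale[of u 0 0] by (simp add: act_zero)
  next
    case (add y w d)
    then show ?case
      by (simp add: distrib_left act_add mult_single act_single wact_plus wact_add wact_scale scale_right_distrib)
  qed
  then show ?case
    using add by (simp add: distrib_right act_add act_single)
qed

lemma act_sum: "act (sum p A) v = (\<Sum>i \<in> A. act (p i) v)"
  by (induction A rule: infinite_finite_induct) (simp_all add: act_zero act_add)

lemma act_prod_list_gen: "act (prod_list (map gen l)) v = foldr ee l v"
  by (induction l arbitrary: v) (simp_all add: act_one act_mult act_gen)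

text \<open>The outermost index N - 1 of \<open>alt N\<close> is odd for N even, so
  \<open>alt N\<close> is then I_1, and otherwise I_2; the primed names absorb this.\<close>

lemma act_I1_I2:
  "act I1' v = alt N v" "act I2' v = alt (Suc N) v"
  if "I1' = (if even N then I1 N else I2 N)" "I2' = (if even N then I2 N else I1 N)"
proof -
  have "act (I1 N) v = (if even N then alt N v else alt (Suc N) v)"
    unfolding I1_def act_prod_list_gen
    using foldr_alternate(1)[of "N + 1" v] foldr_alternate(2)[of "N + 1" v] by (cases "even N") simp_all
  moreover have "act (I2 N) v = (if even N then alt (Suc N) v else alt N v)"
    unfolding I2_def act_prod_list_gen
    using foldr_alternate(1)[of "N + 1" v] foldr_alternate(2)[of "N + 1" v] by (cases "even N") simp_all
  ultimately show "act I1' v = alt N v" "act I2' v = alt (Suc N) v"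
    using that by simp_all
qed

end

section \<open>Polynomial lifts of the distinguished elements\<close>

context tbtl_params
begin

primrec Ep :: "nat \<Rightarrow> fpoly" where
  "Ep 0 = 1"
| "Ep (Suc i) = const (sL powi ((- 1) ^ Suc i)) * (Ep i * gen i * Ep i)"

definition Xp :: "nat \<Rightarrow> complex \<Rightarrow> fpoly" where
  "Xp i u = gen i - const (cc i u)"

definition gp :: "nat \<Rightarrow> fpoly" where
  "gp i = (if i = 0 then const (qpow \<eta> \<omega>1) - const (qpow \<eta> (1 + \<omega>1) - qpow \<eta> (- 1 - \<omega>1)) * gen 0
     else gen i - const (qpow \<eta> (- 1)))"

primrec Jp :: "nat \<Rightarrow> fpoly" where
  "Jp 0 = gp 0"
| "Jp (Suc i) = gp (Suc i) * Jp i * gp (Suc i)"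

text \<open>Generators do not commute in the free algebra, so a representative may depend on the
  order of additions; its effect on a vacuum vector does not.\<close>

inductive Bp :: "int list \<Rightarrow> fpoly \<Rightarrow> bool" where
  Bp_fund: "Bp (fund_path N) (Ep N)"
| Bp_add: "Bp h x \<Longrightarrow> addable N h i \<Longrightarrow> Bp (flip i h) (Xp i (par h i) * x)"

end

context tbtl_module
begin

lemma act_Ep: "act (Ep i) v = EE i v"
  by (induction i arbitrary: v) (simp_all add: act_one act_mult act_const act_gen ss_def)

lemma act_Xp: "act (Xp i u) v = XX i u v"
  by (simp add: Xp_def XX_def act_minus act_gen act_const)

lemma act_gp: "act (gp i) v = gg i v"
  by (simp add: gp_def gg_def act_minus act_mult act_gen act_const)

lemma act_Jp: "act (Jp i) v = JJ i v"
  by (induction i arbitrary: v) (simp_all add: act_mult act_gp)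

end

context tbtl_full_vacuum
begin

text \<open>The vector z allows two uses: the normal form of 1 in the quotient, and v0 itself in the
  path model.\<close>

lemma Bp_Bv:
  assumes "EE N z = v0" "Bp h x"
  shows "Bv h (act x z)"
  using assms(2)
  by induction (simp_all add: act_Ep act_mult act_Xp assms(1) Bv_fund Bv_add)

lemma Bp_bv: "EE N z = v0 \<Longrightarrow> Bp h x \<Longrightarrow> act x z = bv h"
  using Bp_Bv Bv_eq_bv by blast

lemma ex_Bp: "h \<in> paths N \<Longrightarrow> \<exists>x. Bp h x"
proof -
  have "Bv h v \<Longrightarrow> \<exists>x. Bp h x" for v
    by (induction rule: Bv.induct) (blast intro: Bp_fund Bp_add)+
  then show "h \<in> paths N \<Longrightarrow> \<exists>x. Bp h x" using Bv_bv by blast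
qed

lemma bv_span:
  assumes "\<And>w. w \<in> Poly_Mapping.keys x \<Longrightarrow> set (letters w) \<subseteq> {..N}"
  shows "\<exists>c. act x v0 = (\<Sum>h \<in> paths N. c h *s bv h)"
proof -
  define A where "A = range (\<lambda>c. \<Sum>h \<in> paths N. c h *s bv h)"
  have AI: "(\<Sum>h \<in> paths N. c h *s bv h) \<in> A" for c by (simp add: A_def)
  have sub: "subspace A"
  proof (rule subspaceI)
    show "0 \<in> A" using AI[of "\<lambda>_. 0"] by simp
    show "x + y \<in> A" if xy: "x \<in> A" "y \<in> A" for x y
    proof -
      obtain c d where "x = (\<Sum>h \<in> paths N. c h *s bv h)" "y = (\<Sum>h \<in> paths N. d h *s bv h)"
        using xy unfolding A_def by blast
      then show ?thesis using AI[of "\<lambda>h. c h + d h"] by (simp add: scale_left_distrib sum.distrib)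
    qed
    show "a *s x \<in> A" if x: "x \<in> A" for a x
    proof -
      obtain c where "x = (\<Sum>h \<in> paths N. c h *s bv h)" using x unfolding A_def by blast
      then show ?thesis using AI[of "\<lambda>h. a * c h"] by (simp add: scale_sum_right)
    qed
  qed
  have bvA: "bv h \<in> A" if "h \<in> paths N" for h
  proof -
    have "bv h = (\<Sum>h' \<in> paths N. (if h' = h then 1 else 0) *s bv h')"
      using that finite_paths by (simp add: if_distrib[of "\<lambda>a. a *s _"] cong: if_cong)
    then show ?thesis using AI[of "\<lambda>h'. if h' = h then 1 else 0"] by simp
  qed
  have ee_bv: "ee i (bv h) \<in> A" if i: "i \<le> N" and h: "h \<in> paths N" for i h
  proof -
    consider "i = 0" | "slope N h i" | "addable N h i" | "removable N h i"
      using extremal_cases[OF h, of i] i unfolding extremal_def slope_def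
      by (metis le_neq_implies_less less_one not_less)
    then show ?thesis
    proof cases
      case 1
      then show ?thesis using ee_0_bv[OF h] bvA[OF h] sub by (simp add: subspace_scale)
    next
      case 2
      then show ?thesis using slope_zero[OF h] sub by (simp add: subspace_0)
    next
      case 3
      then have "bv (flip i h) \<in> A"
        using h by (intro bvA) (auto simp: addable_def intro: flip_in_paths)
      then show ?thesis
        unfolding ee_bv_addable[OF h 3] using bvA[OF h] sub by (intro subspace_add subspace_scale)
    next
      case 4
      then have "bv (flip i h) \<in> A"
        using h by (intro bvA) (auto simp: removable_def intro: flip_in_paths)
      then show ?thesis
        unfolding ee_bv_removable[OF h 4] using bvA[OF h] sub by (intro subspace_add subspace_scale)
    qed
  qed
  have ee_A: "ee i v \<in> A" if i: "i \<le> N" and v: "v \<in> A" for i v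
  proof -
    obtain c where "v = (\<Sum>h \<in> paths N. c h *s bv h)" using v unfolding A_def by blast
    then have "ee i v = (\<Sum>h \<in> paths N. c h *s ee i (bv h))" by (simp add: ee.sum ee_scale)
    then show ?thesis
      using ee_bv[OF i] sub by (auto intro!: subspace_sum subspace_scale)
  qed
  have "foldr ee l v0 \<in> A" if "set l \<subseteq> {..N}" for l
    using that
  proof (induction l)
    case Nil
    then show ?case using bvA[OF fund_path_in_paths] by (simp add: bv_fund)
  next
    case (Cons i l)
    then show ?case by (simp add: ee_A)
  qed
  then have "act x v0 \<in> A"
    unfolding act_def wact_def using assms sub by (intro subspace_sum subspace_scale) auto
  then show ?thesis unfolding A_def by blast
qed

end

section \<open>The double quotient\<close>

context tbtl_params
begin

abbreviation FF :: "fpoly ring" where "FF \<equiv> free_alg N"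
abbreviation CC :: "fpoly set" where "CC \<equiv> carrier FF"
abbreviation rels :: "fpoly set" where "rels \<equiv> tbtl_rels N \<eta> \<omega>1 \<omega>2 \<union> dq_rels N \<eta> \<omega>1 \<omega>2 \<theta>"
abbreviation AA :: "(complex, fpoly set) module" where "AA \<equiv> Ab N \<eta> \<omega>1 \<omega>2 \<theta>"

definition idl :: "fpoly set" where "idl = Idl\<^bsub>FF\<^esub> rels"

definition cls :: "fpoly \<Rightarrow> fpoly set" where "cls x = idl +>\<^bsub>FF\<^esub> x"

lemma FF_simps [simp]: "x \<otimes>\<^bsub>FF\<^esub> y = x * y" "\<one>\<^bsub>FF\<^esub> = 1" "\<zero>\<^bsub>FF\<^esub> = 0" "x \<oplus>\<^bsub>FF\<^esub> y = x + y"
  by (simp_all add: free_alg_def)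

interpretation F: ring FF by (rule ring_free_alg)

lemma CC_add [simp]: "x \<in> CC \<Longrightarrow> y \<in> CC \<Longrightarrow> x + y \<in> CC"
  using F.a_closed by simp

lemma CC_mult [simp]: "x \<in> CC \<Longrightarrow> y \<in> CC \<Longrightarrow> x * y \<in> CC"
  using F.m_closed by simp

lemma CC_zero [simp]: "0 \<in> CC" and CC_one [simp]: "1 \<in> CC"
  using F.zero_closed F.one_closed by simp_all

lemma CC_uminus [simp]: "x \<in> CC \<Longrightarrow> - x \<in> CC"
  by (simp add: free_alg_def)

lemma CC_minus [simp]: "x \<in> CC \<Longrightarrow> y \<in> CC \<Longrightarrow> x - y \<in> CC"
  using CC_add[of x "- y"] by simp

lemma CC_const [simp]: "const c \<in> CC"
  by (simp add: free_alg_def const_def zero_word_def)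

lemma CC_gen [simp]: "i \<le> N \<Longrightarrow> gen i \<in> CC"
  by (simp add: free_alg_def gen_def)

lemma CC_sum: "(\<And>i. i \<in> A \<Longrightarrow> p i \<in> CC) \<Longrightarrow> sum p A \<in> CC"
  by (induction A rule: infinite_finite_induct) simp_all

lemma FF_minus: "x \<in> CC \<Longrightarrow> y \<in> CC \<Longrightarrow> x \<ominus>\<^bsub>FF\<^esub> y = x - y"
  using F.minus_equality[of "- y" y] by (simp add: F.minus_eq)

lemma CC_I: "I1 N \<in> CC" "I2 N \<in> CC"
proof -
  have *: "set l \<subseteq> {..N} \<Longrightarrow> prod_list (map gen l) \<in> CC" for l
    by (induction l) simp_all
  show "I1 N \<in> CC"
    unfolding I1_def by (rule *) auto
  show "I2 N \<in> CC"
    unfolding I2_def by (rule *) auto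
qed

lemma rels_CC: "rels \<subseteq> CC"
  using N2 CC_I by (auto simp: tbtl_rels_def dq_rels_def)

lemma idl_ideal: "ideal idl FF"
  unfolding idl_def by (rule F.genideal_ideal[OF rels_CC])

lemma rels_idl: "x \<in> rels \<Longrightarrow> x \<in> idl"
  unfolding idl_def using F.genideal_self[OF rels_CC] by blast

interpretation I: ideal idl FF by (rule idl_ideal)

lemma idl_CC: "x \<in> idl \<Longrightarrow> x \<in> CC"
  using I.Icarr by simp

lemma idl_add: "x \<in> idl \<Longrightarrow> y \<in> idl \<Longrightarrow> x + y \<in> idl"
  using I.a_closed by simp

lemma idl_mult: "x \<in> idl \<Longrightarrow> y \<in> CC \<Longrightarrow> y * x \<in> idl" "x \<in> idl \<Longrightarrow> y \<in> CC \<Longrightarrow> x * y \<in> idl"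
  using I.I_l_closed I.I_r_closed by simp_all

lemma idl_zero: "0 \<in> idl"
  using I.zero_closed by simp

lemma idl_minus: "x \<in> idl \<Longrightarrow> y \<in> idl \<Longrightarrow> x - y \<in> idl"
proof -
  have "const (- 1) = - 1" by (simp add: const_def single_uminus)
  then show "x \<in> idl \<Longrightarrow> y \<in> idl \<Longrightarrow> x - y \<in> idl"
    using idl_add[of x "const (- 1) * y"] idl_mult(1)[of y "const (- 1)"] by simp
qed

lemma cls_eq_iff: "x \<in> CC \<Longrightarrow> y \<in> CC \<Longrightarrow> cls x = cls y \<longleftrightarrow> x - y \<in> idl"
  unfolding cls_def using F.quotient_eq_iff_same_a_r_cos[OF idl_ideal] FF_minus by metis

lemma AA_carrier: "carrier AA = cls ` CC"
  by (auto simp: Ab_def presented_alg_def Let_def FactRing_def A_RCOSETS_def' cls_def idl_def)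

lemma cls_carrier [simp]: "x \<in> CC \<Longrightarrow> cls x \<in> carrier AA"
  by (simp add: AA_carrier)

lemma AA_one: "\<one>\<^bsub>AA\<^esub> = cls 1"
  by (simp add: Ab_def presented_alg_def Let_def FactRing_def cls_def idl_def)

lemma AA_zero: "\<zero>\<^bsub>AA\<^esub> = cls 0"
proof -
  have "\<zero>\<^bsub>AA\<^esub> = idl"
    by (simp add: Ab_def presented_alg_def Let_def FactRing_def idl_def)
  also have "idl \<subseteq> CC" using idl_CC by blast
  then have "idl = idl +>\<^bsub>FF\<^esub> \<zero>\<^bsub>FF\<^esub>"
    by (rule F.a_coset_add_zero[symmetric])
  finally show ?thesis by (simp add: cls_def)
qed

lemma AA_add: "x \<in> CC \<Longrightarrow> y \<in> CC \<Longrightarrow> cls x \<oplus>\<^bsub>AA\<^esub> cls y = cls (x + y)"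
  using I.a_rcos_sum[of x y]
  by (simp add: Ab_def presented_alg_def Let_def FactRing_def cls_def idl_def)

lemma AA_mult: "x \<in> CC \<Longrightarrow> y \<in> CC \<Longrightarrow> cls x \<otimes>\<^bsub>AA\<^esub> cls y = cls (x * y)"
  using I.rcoset_mult_add[of x y]
  by (simp add: Ab_def presented_alg_def Let_def FactRing_def cls_def idl_def)

lemma AA_smult: "x \<in> CC \<Longrightarrow> c \<odot>\<^bsub>AA\<^esub> cls x = cls (const c * x)"
  using I.rcoset_mult_add[of "const c" x]
  by (simp add: Ab_def presented_alg_def Let_def FactRing_def cls_def idl_def)

lemma AA_abelian_group: "abelian_group AA"
proof (rule abelian_groupI)
  fix x assume "x \<in> carrier AA"
  then obtain p where "p \<in> CC" "x = cls p" by (auto simp: AA_carrier)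
  then show "\<exists>y\<in>carrier AA. y \<oplus>\<^bsub>AA\<^esub> x = \<zero>\<^bsub>AA\<^esub>"
    by (intro bexI[of _ "cls (- p)"]) (simp_all add: AA_add AA_zero)
qed (auto simp: AA_carrier AA_add AA_zero ac_simps)

interpretation A: abelian_group AA by (rule AA_abelian_group)

lemma AA_minus: "x \<in> CC \<Longrightarrow> y \<in> CC \<Longrightarrow> cls x \<ominus>\<^bsub>AA\<^esub> cls y = cls (x - y)"
  using A.minus_equality[of "cls (- y)" "cls y"] by (simp add: A.minus_eq AA_add AA_zero)

lemma AA_finsum:
  "finite A \<Longrightarrow> (\<And>i. i \<in> A \<Longrightarrow> p i \<in> CC) \<Longrightarrow> (\<Oplus>\<^bsub>AA\<^esub>i\<in>A. cls (p i)) = cls (sum p A)"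
  by (induction A rule: finite_induct) (simp_all add: AA_zero AA_add CC_sum)

lemma CC_Ep: "i \<le> N + 1 \<Longrightarrow> Ep i \<in> CC"
  by (induction i) simp_all

lemma e_cls: "e N \<eta> \<omega>1 \<omega>2 \<theta> i = cls (gen i)"
  by (simp add: e_def cls_def idl_def)

lemma E_cls: "i \<le> N \<Longrightarrow> E N \<eta> \<omega>1 \<omega>2 \<theta> i = cls (Ep i)"
  by (induction i) (simp_all add: AA_one e_cls AA_mult AA_smult CC_Ep)

lemma CC_Xp: "i \<le> N \<Longrightarrow> Xp i u \<in> CC"
  by (simp add: Xp_def)

lemma X_cls: "i \<le> N \<Longrightarrow> X N \<eta> \<omega>1 \<omega>2 \<theta> i u = cls (Xp i u)"
  by (simp add: X_def R_def K_def Xp_def cc_def e_cls AA_one AA_smult AA_minus)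

lemma CC_Jp: "i < N \<Longrightarrow> Jp i \<in> CC"
  by (induction i) (simp_all add: gp_def)

lemma JB_cls: "i < N \<Longrightarrow> JB N \<eta> \<omega>1 \<omega>2 \<theta> i = cls (Jp i)"
proof (induction i)
  case 0
  then show ?case by (simp add: g_def gp_def e_cls AA_one AA_smult AA_minus)
next
  case (Suc i)
  then have "g N \<eta> \<omega>1 \<omega>2 \<theta> (Suc i) = cls (gp (Suc i))" "gp (Suc i) \<in> CC"
    by (simp_all add: g_def gp_def e_cls AA_one AA_smult AA_minus)
  then show ?case using Suc by (simp add: AA_mult CC_Jp)
qed

lemma CC_Bp: "Bp h x \<Longrightarrow> x \<in> CC"
  by (induction rule: Bp.induct) (auto simp: CC_Ep CC_Xp addable_def extremal_def)

lemma Bp_left_ideal: "Bp h x \<Longrightarrow> \<exists>y \<in> CC. x = y * Ep N"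
proof (induction rule: Bp.induct)
  case Bp_fund
  then show ?case by (intro bexI[of _ 1]) simp_all
next
  case (Bp_add h x i)
  then obtain y where "y \<in> CC" "x = y * Ep N" by blast
  then show ?case
    using Bp_add by (intro bexI[of _ "Xp i (par h i) * y"]) (auto simp: mult.assoc CC_Xp addable_def extremal_def)
qed

lemma added_iff:
  "added_above N h i h' \<longleftrightarrow> addable N h i \<and> h' = flip i h \<and> h ! (i - 1) \<ge> 0"
  "added_below N h i h' \<longleftrightarrow> addable N h i \<and> h' = flip i h \<and> h ! (i - 1) < 0"
  by (auto simp: added_above_def added_below_def addable_def extremal_def flip_def sg_def simp del: One_nat_def)

lemma B1_vec_Bp: "B1_vec N \<eta> \<omega>1 \<omega>2 \<theta> h v \<Longrightarrow> \<exists>x. Bp h x \<and> v = cls x"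
proof (induction rule: B1_vec.induct)
  case fund
  then show ?case using Bp_fund E_cls by blast
next
  case (above h v i h')
  then obtain x where x: "Bp h x" "v = cls x" by blast
  have h': "addable N h i" "h' = flip i h" "h ! (i - 1) \<ge> 0"
    using above(2) by (simp_all add: added_iff)
  then have "par h i = \<omega>1 - of_int (h ! (i - 1))" "i \<le> N"
    by (simp_all add: par_def sg_def addable_def extremal_def)
  then show ?case
    using x h' Bp_add[OF x(1) h'(1)] CC_Bp[OF x(1)] by (auto simp: X_cls AA_mult CC_Xp)
next
  case (below h v i h')
  then obtain x where x: "Bp h x" "v = cls x" by blast
  have h': "addable N h i" "h' = flip i h" "h ! (i - 1) < 0"
    using below(2) by (simp_all add: added_iff)
  then have "par h i = - \<omega>1 + of_int (h ! (i - 1))" "i \<le> N"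
    by (simp_all add: par_def sg_def addable_def extremal_def)
  then show ?case
    using x h' Bp_add[OF x(1) h'(1)] CC_Bp[OF x(1)] by (auto simp: X_cls AA_mult CC_Xp)
qed

lemma Bp_B1_vec: "Bp h x \<Longrightarrow> B1_vec N \<eta> \<omega>1 \<omega>2 \<theta> h (cls x)"
proof (induction rule: Bp.induct)
  case Bp_fund
  then show ?case using B1_vec.fund[of N \<eta> \<omega>1 \<omega>2 \<theta>] E_cls by simp
next
  case (Bp_add h x i)
  have i: "i \<le> N" using Bp_add(2) by (simp add: addable_def extremal_def)
  have eq: "cls (Xp i (par h i) * x) = X N \<eta> \<omega>1 \<omega>2 \<theta> i (par h i) \<otimes>\<^bsub>AA\<^esub> cls x"
    using i CC_Bp[OF Bp_add(1)] by (simp add: X_cls AA_mult CC_Xp)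
  show ?case
  proof (cases "h ! (i - 1) \<ge> 0")
    case True
    then have "par h i = \<omega>1 - of_int (h ! (i - 1))" by (simp add: par_def sg_def)
    then show ?thesis
      unfolding eq using B1_vec.above[OF Bp_add(3), of i "flip i h"] True Bp_add(2) by (simp add: added_iff)
  next
    case False
    then have "par h i = - \<omega>1 + of_int (h ! (i - 1))" by (simp add: par_def sg_def)
    then show ?thesis
      unfolding eq using B1_vec.below[OF Bp_add(3), of i "flip i h"] False Bp_add(2) by (simp add: added_iff)
  qed
qed

text \<open>Polynomials that annihilate every function form a two-sided ideal; quantifying over all
  functions gives closure under right multiplication.\<close>

lemma vop_act_idl:
  assumes "x \<in> idl"
  shows "tbtl_module.act vscale vop x f = 0"
proof -
  interpret V: tbtl_module N \<eta> \<omega>1 \<omega>2 \<theta> vscale vop by (rule vop_module)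
  define ker where "ker = {x \<in> CC. \<forall>f. V.act x f = 0}"
  have "ideal ker FF"
  proof (rule idealI[OF ring_free_alg])
    show "subgroup ker (add_monoid FF)"
    proof (rule F.add.subgroupI)
      show "ker \<noteq> {}" using CC_zero by (auto simp: ker_def V.act_zero)
      show "\<ominus>\<^bsub>FF\<^esub> x \<in> ker" if "x \<in> ker" for x
        using that FF_minus[of 0 x] V.act_minus[of 0 x] F.minus_eq[of 0 x]
        by (auto simp: ker_def V.act_zero)
    qed (auto simp: ker_def V.act_add)
  qed (auto simp: ker_def V.act_mult V.act_right_zero)
  moreover have "rels \<subseteq> ker"
  proof
    fix x assume x: "x \<in> rels"
    have sq: "V.act (gen i * gen i - const dlt * gen i) f = 0" if "1 \<le> i" "i \<le> N - 1" for i f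
      using V.ee_sq[of i f] that by (simp add: V.act_minus V.act_mult V.act_gen V.act_const)
    have up: "V.act (gen i * gen j * gen i - gen i) f = 0"
      if "1 \<le> i" "i \<le> N - 1" "j = i + 1 \<or> i = j + 1" for i j f
      using V.ee_up[of i f] V.ee_down[of i f] that by (auto simp: V.act_minus V.act_mult V.act_gen)
    have bd: "V.act (gen 0 * gen 0 - const sL * gen 0) f = 0" "V.act (gen N * gen N - const sR * gen N) f = 0" for f
      by (simp_all add: V.act_minus V.act_mult V.act_gen V.act_const V.ee_sq_0 V.ee_sq_N)
    have comm: "V.act (gen i * gen j - gen j * gen i) f = 0"
      if "i \<le> N" "j \<le> N" "i + 1 < j \<or> j + 1 < i" for i j f
      using V.ee_comm[of i j f] V.ee_comm[of j i f] that by (auto simp: V.act_minus V.act_mult V.act_gen)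
    have "\<forall>f. V.act x f = 0" if "x \<in> tbtl_rels N \<eta> \<omega>1 \<omega>2"
      using that sq up bd comm unfolding tbtl_rels_def by blast
    moreover have "\<forall>f. V.act x f = 0" if "x \<in> dq_rels N \<eta> \<omega>1 \<omega>2 \<theta>"
      using that vop_quotient V.act_I1_I2[OF refl refl] unfolding dq_rels_def
      by (cases "even N") (auto simp: V.act_minus V.act_mult V.act_const)
    ultimately show "x \<in> ker"
      using x rels_CC unfolding ker_def by blast
  qed
  ultimately have "idl \<subseteq> ker"
    unfolding idl_def by (rule F.genideal_minimal)
  then show ?thesis using assms by (auto simp: ker_def)
qed

definition pscale :: "complex \<Rightarrow> fpoly \<Rightarrow> fpoly" where
  "pscale c x = const c * x"

lemma pscale_vector_space: "vector_space pscale"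
  by unfold_locales (simp_all add: pscale_def distrib_left distrib_right const_add const_mult const_one mult.assoc)

text \<open>A linear projection that identifies the quotient with a subspace of the free algebra lets the
  algebra act on a whole type.\<close>

lemma ex_normal_form:
  "\<exists>P. Vector_Spaces.linear pscale pscale P \<and> (\<forall>x. P x \<in> CC) \<and> (\<forall>x \<in> idl. P x = 0) \<and> (\<forall>x \<in> CC. P x - x \<in> idl)"
proof -
  interpret vector_space pscale by (rule pscale_vector_space)
  have "subspace idl"
    by (rule subspaceI) (auto simp: idl_zero idl_add idl_mult pscale_def)
  moreover have "subspace CC"
    by (rule subspaceI) (auto simp: pscale_def)
  ultimately show ?thesis
    by (rule ex_linear_projection) (auto intro: idl_CC)
qed

definition nf :: "fpoly \<Rightarrow> fpoly" where
  "nf = (SOME P. Vector_Spaces.linear pscale pscale P \<and> (\<forall>x. P x \<in> CC) \<and> (\<forall>x \<in> idl. P x = 0) \<and> (\<forall>x \<in> CC. P x - x \<in> idl))"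

lemma nf: "Vector_Spaces.linear pscale pscale nf" "nf x \<in> CC" "x \<in> idl \<Longrightarrow> nf x = 0" "x \<in> CC \<Longrightarrow> nf x - x \<in> idl"
  using someI_ex[OF ex_normal_form] unfolding nf_def by blast+

lemma nf_add: "nf (x + y) = nf x + nf y" and nf_diff: "nf (x - y) = nf x - nf y"
  and nf_const: "nf (const c * x) = const c * nf x"
proof -
  interpret nf: Vector_Spaces.linear pscale pscale nf by (rule nf(1))
  show "nf (x + y) = nf x + nf y" "nf (x - y) = nf x - nf y" by (rule nf.add nf.diff)+
  show "nf (const c * x) = const c * nf x" using nf.scale[of c x] by (simp add: pscale_def)
qed

lemma nf_eq_iff: "x \<in> CC \<Longrightarrow> y \<in> CC \<Longrightarrow> nf x = nf y \<longleftrightarrow> cls x = cls y"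
proof -
  assume xy: "x \<in> CC" "y \<in> CC"
  have "x - y \<in> idl" if "nf x = nf y"
  proof -
    have "(nf y - y) - (nf x - x) \<in> idl" using xy nf(4) idl_minus by blast
    then show ?thesis using that by simp
  qed
  moreover have "nf x = nf y" if "x - y \<in> idl"
    using nf(3)[OF that] by (simp add: nf_diff)
  ultimately show ?thesis using cls_eq_iff[OF xy] by blast
qed

text \<open>Left multiplication transported to normal forms. The inner \<open>nf\<close> first moves
  an arbitrary argument into the algebra on 0, ..., N, so the relations hold on the whole
  type.\<close>

definition pop :: "nat \<Rightarrow> fpoly \<Rightarrow> fpoly" where
  "pop i v = nf (gen i * nf v)"

lemma nf_mult_nf: "x \<in> CC \<Longrightarrow> y \<in> CC \<Longrightarrow> nf (x * nf y) = nf (x * y)"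
proof -
  assume xy: "x \<in> CC" "y \<in> CC"
  have "x * (nf y - y) \<in> idl" using idl_mult(1)[OF nf(4)[OF xy(2)] xy(1)] .
  then have "nf (x * nf y - x * y) = 0" by (simp add: nf(3) right_diff_distrib)
  then show ?thesis by (simp add: nf_diff)
qed

lemma nf_nf: "x \<in> CC \<Longrightarrow> nf (nf x) = nf x"
  using nf_mult_nf[of 1 x] by simp

lemma pop_nf: "i \<le> N \<Longrightarrow> x \<in> CC \<Longrightarrow> pop i (nf x) = nf (gen i * x)"
  using nf(2) by (simp add: pop_def nf_mult_nf)

lemma nf_rel: "x - y \<in> rels \<Longrightarrow> z \<in> CC \<Longrightarrow> nf (x * z) = nf (y * z)"
proof -
  assume xy: "x - y \<in> rels" and z: "z \<in> CC"
  have "(x - y) * z \<in> idl" using idl_mult(2)[OF rels_idl[OF xy] z] .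
  then have "nf (x * z - y * z) = 0" by (simp only: nf(3) left_diff_distrib[symmetric])
  then show ?thesis by (simp add: nf_diff)
qed

lemma pop_module: "tbtl_module N \<eta> \<omega>1 \<omega>2 pscale pop"
proof -
  interpret vector_space pscale by (rule pscale_vector_space)
  show ?thesis
  proof unfold_locales
    show "pop i (x + y) = pop i x + pop i y" for i x y
      by (simp add: pop_def nf_add distrib_left)
    show "pop i (pscale c x) = pscale c (pop i x)" for i c x
      by (simp add: pop_def pscale_def nf_const const_central[of c "nf x"] mult.assoc[symmetric])
        (simp add: const_central[symmetric] nf_const)
    show "pop i (pop i v) = pscale dlt (pop i v)" if "1 \<le> i" "i < N" for i v
    proof -
      have "gen i * gen i - const dlt * gen i \<in> rels"
        using that by (auto simp: tbtl_rels_def)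
      from nf_rel[OF this nf(2)[of v]] show ?thesis
        using that nf(2) by (simp add: pop_def nf_nf nf_mult_nf pscale_def mult.assoc nf_const)
    qed
    show "pop i (pop (i + 1) (pop i v)) = pop i v" if "1 \<le> i" "i < N" for i v
    proof -
      have "i \<le> N - 1" using that by auto
      then have "gen i * gen (i + 1) * gen i - gen i \<in> rels"
        using that unfolding tbtl_rels_def by blast
      from nf_rel[OF this nf(2)[of v]] show ?thesis
        using that nf(2) by (simp add: pop_def nf_nf nf_mult_nf mult.assoc)
    qed
    show "pop i (pop (i - 1) (pop i v)) = pop i v" if "1 \<le> i" "i < N" for i v
    proof -
      have "i \<le> N - 1" "i = (i - 1) + 1" using that by auto
      then have "gen i * gen (i - 1) * gen i - gen i \<in> rels"
        using that unfolding tbtl_rels_def by blast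
      from nf_rel[OF this nf(2)[of v]] show ?thesis
        using that nf(2) by (simp add: pop_def nf_nf nf_mult_nf mult.assoc)
    qed
    show "pop 0 (pop 0 v) = pscale sL (pop 0 v)" for v
    proof -
      have "gen 0 * gen 0 - const sL * gen 0 \<in> rels" by (auto simp: tbtl_rels_def)
      from nf_rel[OF this nf(2)[of v]] show ?thesis
        using nf(2) by (simp add: pop_def nf_nf nf_mult_nf pscale_def mult.assoc nf_const)
    qed
    show "pop N (pop N v) = pscale sR (pop N v)" for v
    proof -
      have "gen N * gen N - const sR * gen N \<in> rels" by (auto simp: tbtl_rels_def)
      from nf_rel[OF this nf(2)[of v]] show ?thesis
        using nf(2) by (simp add: pop_def nf_nf nf_mult_nf pscale_def mult.assoc nf_const)
    qed
    show "pop i (pop j v) = pop j (pop i v)" if "i + 1 < j" "j \<le> N" for i j v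
    proof -
      have "i \<le> N" using that by auto
      then have "gen i * gen j - gen j * gen i \<in> rels"
        using that unfolding tbtl_rels_def by blast
      from nf_rel[OF this nf(2)[of v]] show ?thesis
        using that nf(2) by (simp add: pop_def nf_nf nf_mult_nf mult.assoc)
    qed
  qed
qed

lemma fpoly_eq_sum: "x = (\<Sum>w \<in> Poly_Mapping.keys x. const (Poly_Mapping.lookup x w) * prod_list (map gen (letters w)))"
proof -
  have word: "prod_list (map gen l) = Poly_Mapping.single (Word l) 1" for l
    by (induction l) (simp_all add: gen_def mult_single plus_word_def flip: zero_word_def)
  have "Poly_Mapping.lookup (\<Sum>w \<in> Poly_Mapping.keys x. Poly_Mapping.single w (Poly_Mapping.lookup x w)) u
      = Poly_Mapping.lookup x u" for u
    by (simp add: lookup_sum lookup_single when_def in_keys_iff)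
  then show ?thesis
    by (simp add: word const_single poly_mapping_eq_iff fun_eq_iff)
qed

text \<open>Identifies the action on normal forms with the left regular module of the quotient;
  \<open>nf_eq_iff\<close> then translates back to classes.\<close>

lemma pop_act_nf:
  assumes x: "x \<in> CC" and y: "y \<in> CC"
  shows "tbtl_module.act pscale pop x (nf y) = nf (x * y)"
proof -
  interpret M: tbtl_module N \<eta> \<omega>1 \<omega>2 \<theta> pscale pop by (rule pop_module)
  have word: "prod_list (map gen l) \<in> CC \<and> M.act (prod_list (map gen l)) (nf y) = nf (prod_list (map gen l) * y)"
    if "set l \<subseteq> {..N}" for l
    using that by (induction l) (simp_all add: M.act_one M.act_mult M.act_gen pop_nf y mult.assoc)
  let ?K = "Poly_Mapping.keys x" and ?c = "Poly_Mapping.lookup x" and ?p = "\<lambda>w. prod_list (map gen (letters w))"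
  have letters: "set (letters w) \<subseteq> {..N}" if "w \<in> ?K" for w
    using x that by (simp add: free_alg_def)
  have nf_sum: "nf (sum q A) = (\<Sum>w \<in> A. nf (q w))" for q and A :: "word set"
    using nf(3)[OF idl_zero] by (induction A rule: infinite_finite_induct) (simp_all add: nf_add)
  have "M.act (\<Sum>w \<in> ?K. const (?c w) * ?p w) (nf y) = (\<Sum>w \<in> ?K. const (?c w) * nf (?p w * y))"
    using word letters by (simp add: M.act_sum M.act_mult M.act_const pscale_def)
  also have "\<dots> = nf ((\<Sum>w \<in> ?K. const (?c w) * ?p w) * y)"
    by (simp add: nf_sum sum_distrib_right mult.assoc nf_const)
  finally show ?thesis
    by (simp flip: fpoly_eq_sum)
qed

text \<open>Multiplied by E_N on the right, the quotient relation becomes the hypothesis of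
  \<open>boundary_from_quotient\<close>.\<close>

lemma pop_full_vacuum: "tbtl_full_vacuum N \<eta> \<omega>1 \<omega>2 \<theta> pscale pop (nf (Ep N))"
proof -
  interpret M: tbtl_module N \<eta> \<omega>1 \<omega>2 \<theta> pscale pop by (rule pop_module)
  have v0: "M.EE N (nf 1) = nf (Ep N)"
    using pop_act_nf[of "Ep N" 1] by (simp add: CC_Ep M.act_Ep)
  interpret M: tbtl_vacuum N \<eta> \<omega>1 \<omega>2 \<theta> pscale pop "nf (Ep N)"
    using M.vacuum_EE[of "nf 1"] unfolding v0 .
  define J1 where "J1 = (if even N then I1 N else I2 N)"
  define J2 where "J2 = (if even N then I2 N else I1 N)"
  have J: "J1 \<in> CC" "J2 \<in> CC" using CC_I by (simp_all add: J1_def J2_def)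
  note act_J = M.act_I1_I2[OF J1_def J2_def, symmetric]
  let ?b = "b_param N \<eta> \<omega>1 \<omega>2 \<theta>"
  have "J1 * J2 * J1 - const ?b * J1 \<in> rels"
    by (auto simp: J1_def J2_def dq_rels_def)
  from nf_rel[OF this, of "Ep N"]
  have "nf (J1 * (J2 * (J1 * Ep N))) = const ?b * nf (J1 * Ep N)"
    by (simp add: CC_Ep mult.assoc nf_const)
  then have "M.alt N (M.alt (Suc N) (M.alt N (nf (Ep N)))) = pscale ?b (M.alt N (nf (Ep N)))"
    using J by (simp add: act_J pop_act_nf CC_Ep pscale_def)
  then have "pop (N - 1) (pop N (nf (Ep N))) = pscale (kk M.uN) (pop (N - 1) (nf (Ep N)))"
    by (rule M.boundary_from_quotient)
  then show ?thesis
    by unfold_locales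
qed

text \<open>Spanning and eigenvalues are read off in the quotient module M, independence in the path
  model V; both evaluate the same polynomial representatives.\<close>

lemma path_basis_theorem:
  "(\<forall>h \<in> paths N. \<exists>!v. B1_vec N \<eta> \<omega>1 \<omega>2 \<theta> h v) \<and>
    is_basis AA (W N \<eta> \<omega>1 \<omega>2 \<theta>) (paths N) (b_vec N \<eta> \<omega>1 \<omega>2 \<theta>) \<and>
    (\<forall>n < N. \<forall>h \<in> paths N. JB N \<eta> \<omega>1 \<omega>2 \<theta> n \<otimes>\<^bsub>AA\<^esub> b_vec N \<eta> \<omega>1 \<omega>2 \<theta> h =
       murphy_weight \<eta> \<omega>1 n h \<odot>\<^bsub>AA\<^esub> b_vec N \<eta> \<omega>1 \<omega>2 \<theta> h)"
proof -
  interpret M: tbtl_full_vacuum N \<eta> \<omega>1 \<omega>2 \<theta> pscale pop "nf (Ep N)"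
    by (rule pop_full_vacuum)
  let ?v = "basis_fun (fund_path N)"
  interpret V: tbtl_full_vacuum N \<eta> \<omega>1 \<omega>2 \<theta> vscale vop ?v
    by (rule vop_full_vacuum)
  have M0: "M.EE N (nf 1) = nf (Ep N)"
    using pop_act_nf[of "Ep N" 1] by (simp add: CC_Ep M.act_Ep)
  have M_bv: "nf x = M.bv h" if "Bp h x" for h x
    using M.Bp_bv[OF M0 that] pop_act_nf[of x 1] CC_Bp[OF that] by simp
  have V_bv: "V.act x ?v = basis_fun h" if "Bp h x" for h x
  proof -
    have "h \<in> paths N" using M.Bp_Bv[OF M0 that] by (rule M.Bv_path)
    then show ?thesis
      using V.Bp_bv[OF V.EE_v0[OF order_refl] that] V.Bv_eq_bv[OF Bv_basis] by simp
  qed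
  \<comment> \<open>Any representative will do: by \<open>M_bv\<close> and \<open>nf_eq_iff\<close>
    its class depends on the path alone.\<close>
  define bp where "bp h = (SOME x. Bp h x)" for h
  have bp: "Bp h (bp h)" if "h \<in> paths N" for h
    unfolding bp_def using M.ex_Bp[OF that] by (rule someI_ex)
  have bpC: "bp h \<in> CC" if "h \<in> paths N" for h
    using bp[OF that] by (rule CC_Bp)
  have unique: "v = cls (bp h)" if v: "B1_vec N \<eta> \<omega>1 \<omega>2 \<theta> h v" and h: "h \<in> paths N" for h v
  proof -
    obtain x where x: "Bp h x" "v = cls x" using B1_vec_Bp[OF v] by blast
    then show ?thesis
      using nf_eq_iff[OF CC_Bp[OF x(1)] bpC[OF h]] M_bv bp[OF h] by metis
  qed
  have B1: "B1_vec N \<eta> \<omega>1 \<omega>2 \<theta> h (cls (bp h))" if "h \<in> paths N" for h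
    by (rule Bp_B1_vec[OF bp[OF that]])
  have ex1: "\<exists>!v. B1_vec N \<eta> \<omega>1 \<omega>2 \<theta> h v" if "h \<in> paths N" for h
    using unique[OF _ that] B1[OF that] by blast
  have bvec: "b_vec N \<eta> \<omega>1 \<omega>2 \<theta> h = cls (bp h)" if "h \<in> paths N" for h
    unfolding b_vec_def using unique[OF _ that] B1[OF that] by (rule the_equality[rotated])
  have comb: "(\<Oplus>\<^bsub>AA\<^esub>h\<in>paths N. c h \<odot>\<^bsub>AA\<^esub> b_vec N \<eta> \<omega>1 \<omega>2 \<theta> h) = cls (\<Sum>h\<in>paths N. const (c h) * bp h)"
    (is "?L c = _") for c
  proof -
    have "?L c = (\<Oplus>\<^bsub>AA\<^esub>h\<in>paths N. cls (const (c h) * bp h))"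
      by (rule A.finsum_cong') (auto simp: bvec AA_smult bpC)
    also have "\<dots> = cls (\<Sum>h\<in>paths N. const (c h) * bp h)"
      by (rule AA_finsum) (auto simp: finite_paths bpC)
    finally show ?thesis .
  qed
  have combC: "(\<Sum>h\<in>paths N. const (c h) * bp h) \<in> CC" for c
    by (rule CC_sum) (simp add: bpC)
  \<comment> \<open>A vanishing combination lies in the ideal, which annihilates the path model; on
    the fundamental point function it evaluates to the same combination of point functions.\<close>
  have indep: "c h = 0" if z: "?L c = \<zero>\<^bsub>AA\<^esub>" and h: "h \<in> paths N" for c h
  proof -
    have "(\<Sum>h\<in>paths N. const (c h) * bp h) \<in> idl"
      using z cls_eq_iff[OF combC CC_zero] by (simp add: comb AA_zero)
    then have "V.act (\<Sum>h\<in>paths N. const (c h) * bp h) ?v = 0"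
      by (rule vop_act_idl)
    also have "V.act (\<Sum>h\<in>paths N. const (c h) * bp h) ?v = (\<Sum>h\<in>paths N. vscale (c h) (basis_fun h))"
      unfolding V.act_sum V.act_mult V.act_const by (rule sum.cong) (simp_all add: V_bv[OF bp])
    finally have "(\<Sum>h\<in>paths N. vscale (c h) (basis_fun h)) h = 0" by simp
    moreover have "(\<Sum>p\<in>A. vscale (c p) (basis_fun p)) h = (\<Sum>p\<in>A. vscale (c p) (basis_fun p) h)" for A
      by (induction A rule: infinite_finite_induct) simp_all
    ultimately show ?thesis
      using h finite_paths by (simp add: vscale_def basis_fun_def if_distrib[of "(*) _"] cong: if_cong)
  qed
  have W1: "?L c \<in> W N \<eta> \<omega>1 \<omega>2 \<theta>" for c
  proof -
    obtain y where y: "\<And>h. h \<in> paths N \<Longrightarrow> y h \<in> CC \<and> bp h = y h * Ep N"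
      using Bp_left_ideal[OF bp] by metis
    have C: "(\<Sum>h\<in>paths N. const (c h) * y h) \<in> CC"
      by (rule CC_sum) (simp add: y)
    have "(\<Sum>h\<in>paths N. const (c h) * bp h) = (\<Sum>h\<in>paths N. const (c h) * y h) * Ep N"
      by (simp add: y sum_distrib_right mult.assoc)
    then have "?L c = cls (\<Sum>h\<in>paths N. const (c h) * y h) \<otimes>\<^bsub>AA\<^esub> E N \<eta> \<omega>1 \<omega>2 \<theta> N"
      using C by (simp add: comb E_cls AA_mult CC_Ep)
    then show ?thesis
      unfolding W_def using C cls_carrier by blast
  qed
  \<comment> \<open>An element of the left ideal is the class of some x E_N. Acting on the vacuum, x
    lands in the span of the path vectors, and normal forms carry this back to classes.\<close>
  have W2: "\<exists>c. w = ?L c" if "w \<in> W N \<eta> \<omega>1 \<omega>2 \<theta>" for w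
  proof -
    have "\<exists>y. w = y \<otimes>\<^bsub>AA\<^esub> E N \<eta> \<omega>1 \<omega>2 \<theta> N \<and> y \<in> cls ` CC"
      using that unfolding W_def AA_carrier by (rule CollectD)
    then obtain y where y: "w = y \<otimes>\<^bsub>AA\<^esub> E N \<eta> \<omega>1 \<omega>2 \<theta> N" "y \<in> cls ` CC"
      by (elim exE conjE)
    then obtain x where x1: "x \<in> CC" "y = cls x"
      by (elim imageE)
    have x: "x \<in> CC" "w = cls (x * Ep N)"
      unfolding y(1) x1(2) E_cls[OF order_refl] using x1(1) by (simp_all add: AA_mult CC_Ep)
    have "set (letters u) \<subseteq> {..N}" if "u \<in> Poly_Mapping.keys x" for u
      using x(1) that by (simp add: free_alg_def)
    then obtain c where c: "M.act x (nf (Ep N)) = (\<Sum>h\<in>paths N. pscale (c h) (M.bv h))"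
      using M.bv_span by blast
    have nf_sum: "nf (sum q A) = (\<Sum>h \<in> A. nf (q h))" for q and A :: "int list set"
      using nf(3)[OF idl_zero] by (induction A rule: infinite_finite_induct) (simp_all add: nf_add)
    have "nf (x * Ep N) = nf (\<Sum>h\<in>paths N. const (c h) * bp h)"
      using c x(1) by (simp add: pop_act_nf CC_Ep nf_sum nf_const pscale_def M_bv[OF bp])
    then have "w = ?L c"
      unfolding comb x(2) using x(1) combC by (subst nf_eq_iff[symmetric]) (simp_all add: CC_Ep)
    then show ?thesis by (rule exI[of _ c])
  qed
  have W_eq: "W N \<eta> \<omega>1 \<omega>2 \<theta> = {?L c | c. True}"
  proof (intro subset_antisym subsetI)
    fix w assume "w \<in> {?L c | c. True}"
    then obtain c where "w = ?L c" by (elim CollectE exE conjE)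
    then show "w \<in> W N \<eta> \<omega>1 \<omega>2 \<theta>" by (simp only: W1)
  next
    fix w assume "w \<in> W N \<eta> \<omega>1 \<omega>2 \<theta>"
    from W2[OF this] show "w \<in> {?L c | c. True}" by simp
  qed
  have basis: "is_basis AA (W N \<eta> \<omega>1 \<omega>2 \<theta>) (paths N) (b_vec N \<eta> \<omega>1 \<omega>2 \<theta>)"
    unfolding is_basis_def
  proof (intro conjI allI impI ballI)
    show "b_vec N \<eta> \<omega>1 \<omega>2 \<theta> ` paths N \<subseteq> carrier AA"
      by (auto simp: bvec bpC)
  qed (fact finite_paths indep W_eq)+
  have "JB N \<eta> \<omega>1 \<omega>2 \<theta> n \<otimes>\<^bsub>AA\<^esub> b_vec N \<eta> \<omega>1 \<omega>2 \<theta> h =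
      murphy_weight \<eta> \<omega>1 n h \<odot>\<^bsub>AA\<^esub> b_vec N \<eta> \<omega>1 \<omega>2 \<theta> h" if n: "n < N" and h: "h \<in> paths N" for n h
  proof -
    have "nf (Jp n * bp h) = M.JJ n (M.bv h)"
      using n pop_act_nf[of "Jp n" "bp h"] M_bv[OF bp[OF h]] by (simp add: CC_Jp bpC[OF h] M.act_Jp)
    also have "\<dots> = nf (const (murphy_weight \<eta> \<omega>1 n h) * bp h)"
      using M.JJ_bv[OF n h] M_bv[OF bp[OF h]] by (simp add: nf_const pscale_def)
    finally show ?thesis
      using n h by (simp add: nf_eq_iff CC_Jp bpC JB_cls bvec AA_mult AA_smult)
  qed
  then show ?thesis
    using ex1 basis by blast
qed

end

theorem theorem5p10:
  fixes N :: nat and \<eta> \<omega>1 \<omega>2 \<theta> :: complex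
  assumes "N \<ge> 2" and "generic \<eta> \<omega>1 \<omega>2"
  shows "(\<forall>h \<in> paths N. \<exists>!v. B1_vec N \<eta> \<omega>1 \<omega>2 \<theta> h v) \<and>
    is_basis (Ab N \<eta> \<omega>1 \<omega>2 \<theta>) (W N \<eta> \<omega>1 \<omega>2 \<theta>) (paths N) (b_vec N \<eta> \<omega>1 \<omega>2 \<theta>) \<and>
    (\<forall>n < N. \<forall>h \<in> paths N.
       JB N \<eta> \<omega>1 \<omega>2 \<theta> n \<otimes>\<^bsub>Ab N \<eta> \<omega>1 \<omega>2 \<theta>\<^esub> b_vec N \<eta> \<omega>1 \<omega>2 \<theta> h =
       qpow \<eta> (\<omega>1 * of_int (h ! (n + 1) - h ! n)
               - of_int ((h ! (n + 1))\<^sup>2 - (h ! n)\<^sup>2) / 2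
               + (1 - 2 * of_nat n) / 2)
         \<odot>\<^bsub>Ab N \<eta> \<omega>1 \<omega>2 \<theta>\<^esub> b_vec N \<eta> \<omega>1 \<omega>2 \<theta> h)"
proof -
  interpret tbtl_params N \<eta> \<omega>1 \<omega>2 \<theta>
    using assms by unfold_locales
  show ?thesis
    using path_basis_theorem unfolding murphy_weight_def .
qed

end
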